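(* The concurrent parallel level data structure (CPLDS) algorithm, consisting of the batched update algorithm and the asynchronous read algorithm specified in the context, is linearizable (every operation, read or edge update, appears to take effect instantaneously at a moment between its invocation and its response). It is also live: every update terminates in a finite number of steps, and reads are lock-free (if reads are invoked infinitely often, then some operation in the system terminates in a finite number of steps, infinitely often).
   Context: **Model.** $G$ is an undirected, unweighted graph on vertex set $\{0,\dots,n-1\}$ whose edges change over time. Processes communicate through shared memory and are partitioned into update processes and read processes. Update processes are synchronous (computation and communication delays are bounded by a known constant). Read processes are asynchronous (arbitrarily delayed). No process fails. Updates (edge insertions/deletions) arrive in batches, one batch executed after another; each batch $\mathcal B$ contains only insertions or only deletions, and all update processes collectively execute each batch in parallel. A read of a vertex $v$ is executed by a single read process, concurrently with batches and other reads. **Sequential behaviour.** An update adds or removes an edge of $G$ and updates the levels of the vertices accordingly; it has no return value. A read of $v$ returns the coreness estimate computed from the level of $v$. In a sequential execution, the update that moves a vertex $u$ also moves every vertex whose level change is (transitively) caused by that of $u$. So all level changes of vertices in one dependency DAG (defined below), from their levels before the batch to their levels after the batch, must take effect atomically. **Level data structure (LDS).** Fix constants $\delta,\lambda>0$. Vertices are partitioned into $K=O(\log^2 n)$ levels $0,\dots,K-1$, partitioned into groups $g_0,\dots,g_{\lceil\log_{1+\delta} n\rceil}$ of $4\lceil\log_{1+\delta}n\rceil$ contiguous levels each. Let $\ell(v)$ be the (live) level of $v$, and $Z_\ell$ the set of vertices at levels $\ge \ell$. Invariant 1: if $\ell(v)=\ell<K$ and $\ell\in g_i$, then $v$ has at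 most $(2+3/\lambda)(1+\delta)^i$ neighbors in $Z_\ell$. Invariant 2: if $\ell(v)=\ell>0$ and $\ell-1\in g_i$, then $v$ has at least $(1+\delta)^i$ neighbors in $Z_{\ell-1}$. The coreness estimate is $\hat k(v)=(1+\delta)^{\max(\lfloor(\ell(v)+1)/(4\lceil\log_{1+\delta}n\rceil)\rfloor-1,\,0)}$. **Global state.** An integer `batch_number`, incremented at the start of every batch, and an array `desc_array` with one descriptor per vertex. A descriptor is either the special value UNMARKED, or marked, in which case it has a field `parent` (the index of the vertex's parent in its dependency DAG, or the special value I_AM_ROOT) and a field `old_level`. A vertex is marked iff its entry of `desc_array` is marked. **Execution of a batch $\mathcal B$.** First all edges of $\mathcal B$ are inserted into (or deleted from) $G$. Then the levels are visited in increasing order, the vertices of a level being processed in parallel. For an insertion batch, each vertex of the current level violating Invariant 1 is moved up one level; each level is visited at most once. For a deletion batch, each vertex violating Invariant 2 computes its desire level (the highest level below its current one at which it satisfies Invariant 2); when level $\ell$ is visited, all vertices with desire level $\ell$ move there and their neighbors at higher levels recompute their desire levels; a vertex moves at most once. Before a vertex $v$ moves for the first time in the batch, `mark(v, triggers)` is executed. For insertions, the triggers are the marked neighbors of $v$ at the same or a higher level than $v$ (a vertex which was at a lower level than $v$ earlier in the batch but moved above $v$ may become a trigger later). For deletions, they are the marked neighbors of $v$ at levels lower than $\ell(v)-1$. After all levels have been visited, `unmark_all` is executed and the batch ends. `mark(v, triggers)`: create a new descriptor for $v$ with `old_level` equal to the current level of $v$; let `marked_batch_neighbors` be the set of $w$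 such that edge $(v,w)$ belongs to $\mathcal B$ and $w$ is already marked; for every $w$ in `marked_batch_neighbors` or `triggers` perform `union(v,w)`; write the descriptor to `desc_array[v]`. Here `union` is the (linearizable) union operation of a concurrent union-find structure whose parent pointers are the `parent` fields: it merges the two dependency DAGs, one root being deterministically chosen as the single root of the merged DAG. The dependency DAGs of the batch are the resulting trees; each has a single root, reached from any member by following `parent` pointers. Traversals may compress paths (redirecting `parent` fields of traversed vertices to the root). The following is maintained: in each DAG the root descriptor is marked before non-root descriptors of the same DAG are marked, and is unmarked before they are unmarked. `unmark_all`: in parallel, set to UNMARKED all marked descriptors with `parent` $=$ I_AM_ROOT; after that, in parallel, set to UNMARKED all remaining marked descriptors. **Read algorithm.** `read(v)`: (1) $b_1:=$ `batch_number`; (2) $l_1:=$ live level of $v$; (3) `desc` $:=$ `desc_array[v]`; (4) `status` $:=$ `check_DAG(desc)`; (5) $l_2:=$ live level of $v$; (6) $b_2:=$ `batch_number`. If $b_1\ne b_2$, restart from (1). Otherwise, if `status` is MARKED, return the coreness estimate computed from `desc.old_level`. Otherwise, if $l_1=l_2$, return the coreness estimate computed from $l_1$, and if $l_1\neq l_2$, restart from (1). `check_DAG(desc)`: if `desc` is UNMARKED return UNMARKED; while `desc.parent` $\ne$ I_AM_ROOT, replace `desc` by the descriptor of the parent vertex and return UNMARKED if it is UNMARKED; when the root is reached return MARKED if it is marked and UNMARKED otherwise.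
   Formalization: mark is assumed never to run simultaneously for both endpoints of an edge of the batch: otherwise neither sees the other as marked, a one-edge batch can move two vertices in separate dependency DAGs unmarked at different times, and reads are not linearizable. *)

theory Defs
  imports Complex_Main
begin

section \<open>Linearizability\<close>

text \<open>
  A (finite, concurrent) history: a set of operation instances, the time of the invocation of each,
  and, if it has responded, its return value together with the time of its response.
\<close>

record ('op, 'r) history =
  operations :: "'op set"
  invoked :: "'op \<Rightarrow> nat"
  responded :: "'op \<Rightarrow> ('r \<times> nat) option"

text \<open>
  The list \<open>xs\<close> is the sequential execution.  All completed operations take effect, with the value
  that they returned; a pending operation may or may not have taken effect.  The moments at which
  the operations take effect are the real numbers \<open>pt\<close>.
\<close>

definition linearizable :: "('op, 'r) history \<Rightarrow> (('op \<times> 'r) list \<Rightarrow> bool) \<Rightarrow> bool" where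
  "linearizable H legal \<longleftrightarrow>
    (\<exists>xs (pt :: 'op \<Rightarrow> real).
       fst ` set xs \<subseteq> operations H
     \<and> (\<forall>a\<in>operations H. responded H a \<noteq> None \<longrightarrow> a \<in> fst ` set xs)
     \<and> sorted_wrt (\<lambda>x y. pt (fst x) < pt (fst y)) xs
     \<and> (\<forall>(a, r)\<in>set xs. real (invoked H a) < pt a
          \<and> (\<forall>r' t. responded H a = Some (r', t) \<longrightarrow> r' = r \<and> pt a < real t))
     \<and> legal xs)"


section \<open>Level data structure\<close>

type_synonym vertex = nat
type_synonym edge = "nat set"
type_synonym graph = "edge set"

text \<open>
  \<open>link\<close> is the deterministic rule by which a union chooses one of two marked roots as the root of
  the merged DAG.
\<close>

record params =
  nverts :: nat
  delta :: real
  lambda :: real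
  link :: "vertex \<Rightarrow> vertex \<Rightarrow> vertex"

text \<open>For a single vertex, \<open>\<lceil>log n\<rceil> = 0\<close> and there would be no level at all.\<close>

definition valid_params :: "params \<Rightarrow> bool" where
  "valid_params P \<longleftrightarrow> 2 \<le> nverts P \<and> 0 < delta P \<and> 0 < lambda P
     \<and> (\<forall>r r'. link P r r' \<in> {r, r'} \<and> link P r r' = link P r' r)"

definition edges :: "params \<Rightarrow> edge set" where
  "edges P = {{u, v} | u v. u < nverts P \<and> v < nverts P \<and> u \<noteq> v}"

definition logn :: "params \<Rightarrow> nat" where
  "logn P = nat \<lceil>log (1 + delta P) (real (nverts P))\<rceil>"

text \<open>The index \<open>i\<close> of the group \<open>g\<^sub>i\<close> of a level; the groups are \<open>g\<^sub>0, \<dots>, g\<^bsub>logn\<^esub>\<close>.\<close>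

definition group_of :: "params \<Rightarrow> nat \<Rightarrow> nat" where
  "group_of P h = h div (4 * logn P)"

definition nlevels :: "params \<Rightarrow> nat" where
  "nlevels P = (logn P + 1) * (4 * logn P)"

definition nbrs_from :: "graph \<Rightarrow> (vertex \<Rightarrow> nat) \<Rightarrow> vertex \<Rightarrow> nat \<Rightarrow> vertex set" where
  "nbrs_from E lv v h = {w. {v, w} \<in> E \<and> h \<le> lv w}"

definition inv1 :: "params \<Rightarrow> graph \<Rightarrow> (vertex \<Rightarrow> nat) \<Rightarrow> vertex \<Rightarrow> bool" where
  "inv1 P E lv v \<longleftrightarrow>
     real (card (nbrs_from E lv v (lv v))) \<le> (2 + 3 / lambda P) * (1 + delta P) ^ group_of P (lv v)"

text \<open>Invariant 2 for \<open>v\<close> if its level were \<open>h\<close>, all other levels being given by \<open>lv\<close>.\<close>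

definition inv2_at :: "params \<Rightarrow> graph \<Rightarrow> (vertex \<Rightarrow> nat) \<Rightarrow> vertex \<Rightarrow> nat \<Rightarrow> bool" where
  "inv2_at P E lv v h \<longleftrightarrow>
     (0 < h \<longrightarrow> (1 + delta P) ^ group_of P (h - 1) \<le> real (card (nbrs_from E lv v (h - 1))))"

definition inv2 :: "params \<Rightarrow> graph \<Rightarrow> (vertex \<Rightarrow> nat) \<Rightarrow> vertex \<Rightarrow> bool" where
  "inv2 P E lv v \<longleftrightarrow> inv2_at P E lv v (lv v)"

definition desire_level :: "params \<Rightarrow> graph \<Rightarrow> (vertex \<Rightarrow> nat) \<Rightarrow> vertex \<Rightarrow> nat" where
  "desire_level P E lv v = Max {d. d < lv v \<and> inv2_at P E lv v d}"

definition lds :: "params \<Rightarrow> graph \<Rightarrow> (vertex \<Rightarrow> nat) \<Rightarrow> bool" where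
  "lds P E lv \<longleftrightarrow> E \<subseteq> edges P
     \<and> (\<forall>v<nverts P. lv v < nlevels P \<and> inv1 P E lv v \<and> inv2 P E lv v)"

text \<open>The maximum with \<open>0\<close> is the truncation of the subtraction of natural numbers.\<close>

definition coreness_estimate :: "params \<Rightarrow> nat \<Rightarrow> real" where
  "coreness_estimate P h = (1 + delta P) ^ ((h + 1) div (4 * logn P) - 1)"


section \<open>Shared memory\<close>

text \<open>\<open>parent = None\<close> is \<open>I_AM_ROOT\<close>.\<close>

record desc =
  parent :: "vertex option"
  old_level :: nat

text \<open>
  A vertex is marked at most once per batch, so a descriptor object is identified by the number of
  the batch in which it is created and by its vertex.  Objects stay in the heap, because a delayed
  read may still hold a pointer to one that has been removed from \<open>desc_array\<close>.
\<close>

type_synonym ptr = "nat \<times> vertex"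

datatype kind = Insertion | Deletion

text \<open>
  \<open>Visit k B h T U\<close>: level \<open>h\<close> is being visited, the vertices in \<open>T\<close> still have to move, and \<open>mark\<close>
  is being executed for the vertices in \<open>dom U\<close>, where \<open>U\<close> gives the vertices with which the union
  is still to be performed.
\<close>

datatype phase =
    Quiet
  | Edges kind "edge set"
  | Visit kind "edge set" nat "vertex set" "vertex \<Rightarrow> vertex set option"
  | Unmark_Roots
  | Unmark_Rest

text \<open>
  Program points of \<open>read(v)\<close>; each one precedes a single access to the shared memory.  In
  \<open>R_Parent\<close> and \<open>R_Lookup\<close>, \<open>d\<close> is the descriptor of \<open>v\<close>; the remaining argument is the current
  descriptor of \<open>check_DAG\<close>, whose parent is read next, or the parent vertex, whose entry of
  \<open>desc_array\<close> is read next.  Afterwards the status is \<open>Some d\<close> for MARKED and \<open>None\<close> for UNMARKED.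
\<close>

datatype rpc =
    R_Idle
  | R_Batch1 vertex
  | R_Level1 vertex nat
  | R_Desc vertex nat nat
  | R_Parent vertex nat nat ptr ptr
  | R_Lookup vertex nat nat ptr vertex
  | R_Level2 vertex nat nat "ptr option"
  | R_Batch2 vertex nat nat "ptr option" nat
  | R_Return real

text \<open>
  \<open>desc_array s v = None\<close> is UNMARKED, and \<open>Some b\<close> is a pointer to the descriptor of \<open>v\<close> created in
  batch \<open>b\<close>.  The type \<open>'p\<close> consists of the read processes.
\<close>

record 'p state =
  batch_number :: nat
  graph :: graph
  level :: "vertex \<Rightarrow> nat"
  desc_array :: "vertex \<Rightarrow> nat option"
  heap :: "nat \<Rightarrow> vertex \<Rightarrow> desc option"
  phase :: phase
  reader :: "'p \<Rightarrow> rpc"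

definition initial :: "params \<Rightarrow> 'p state \<Rightarrow> bool" where
  "initial P s \<longleftrightarrow> batch_number s = 0 \<and> lds P (graph s) (level s)
     \<and> (\<forall>v. desc_array s v = None) \<and> (\<forall>b v. heap s b v = None)
     \<and> phase s = Quiet \<and> (\<forall>p. reader s p = R_Idle)"

definition marked :: "'p state \<Rightarrow> vertex \<Rightarrow> bool" where
  "marked s v \<longleftrightarrow> desc_array s v \<noteq> None"


section \<open>Dependency DAGs\<close>

text \<open>All of the following concerns the descriptors created in the current (or latest) batch.\<close>

definition parent_rel :: "'p state \<Rightarrow> (vertex \<times> vertex) set" where
  "parent_rel s = {(v, w). \<exists>d. heap s (batch_number s) v = Some d \<and> parent d = Some w}"

definition is_root :: "'p state \<Rightarrow> vertex \<Rightarrow> bool" where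
  "is_root s r \<longleftrightarrow> (\<exists>d. heap s (batch_number s) r = Some d \<and> parent d = None)"

definition root_of :: "'p state \<Rightarrow> vertex \<Rightarrow> vertex \<Rightarrow> bool" where
  "root_of s v r \<longleftrightarrow> (v, r) \<in> (parent_rel s)\<^sup>* \<and> is_root s r"

definition same_dag :: "'p state \<Rightarrow> vertex \<Rightarrow> vertex \<Rightarrow> bool" where
  "same_dag s v w \<longleftrightarrow> (\<exists>r. root_of s v r \<and> root_of s w r)"

definition put_desc :: "vertex \<Rightarrow> desc \<Rightarrow> 'p state \<Rightarrow> 'p state" where
  "put_desc v d s = s\<lparr>heap := (heap s)(batch_number s := (heap s (batch_number s))(v \<mapsto> d))\<rparr>"

definition set_parent :: "vertex \<Rightarrow> vertex \<Rightarrow> 'p state \<Rightarrow> 'p state" where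
  "set_parent v w s = put_desc v ((the (heap s (batch_number s) v))\<lparr>parent := Some w\<rparr>) s"

text \<open>
  A root whose descriptor is not yet in \<open>desc_array\<close> (that of the vertex for which \<open>mark\<close> is being
  executed) loses, so that a root is always marked before the other vertices of its DAG.
\<close>

definition winner :: "params \<Rightarrow> 'p state \<Rightarrow> vertex \<Rightarrow> vertex \<Rightarrow> vertex" where
  "winner P s r r' = (if \<not> marked s r then r' else if \<not> marked s r' then r else link P r r')"

definition unite :: "params \<Rightarrow> vertex \<Rightarrow> vertex \<Rightarrow> 'p state \<Rightarrow> 'p state" where
  "unite P r r' s =
     (if r = r' then s
      else if winner P s r r' = r then set_parent r' r s else set_parent r r' s)"


section \<open>Updates\<close>

fun apply_edges :: "kind \<Rightarrow> edge set \<Rightarrow> graph \<Rightarrow> graph" where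
  "apply_edges Insertion B E = E \<union> B"
| "apply_edges Deletion B E = E - B"

text \<open>
  The vertices that move when a level is visited.  As desire levels are recomputed after the moves
  of neighbors, at the beginning of a visit they are those for the current graph and levels.
\<close>

fun movers :: "params \<Rightarrow> kind \<Rightarrow> nat \<Rightarrow> 'p state \<Rightarrow> vertex set" where
  "movers P Insertion h s =
     {v. v < nverts P \<and> level s v = h \<and> \<not> inv1 P (graph s) (level s) v}"
| "movers P Deletion h s =
     {v. v < nverts P \<and> \<not> marked s v \<and> \<not> inv2 P (graph s) (level s) v
       \<and> desire_level P (graph s) (level s) v = h}"

fun target :: "kind \<Rightarrow> nat \<Rightarrow> nat" where
  "target Insertion h = h + 1"
| "target Deletion h = h"

fun triggers :: "kind \<Rightarrow> 'p state \<Rightarrow> vertex \<Rightarrow> vertex set" where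
  "triggers Insertion s v = {w. {v, w} \<in> graph s \<and> marked s w \<and> level s v \<le> level s w}"
| "triggers Deletion s v = {w. {v, w} \<in> graph s \<and> marked s w \<and> level s w + 1 < level s v}"

definition marked_batch_neighbors :: "edge set \<Rightarrow> 'p state \<Rightarrow> vertex \<Rightarrow> vertex set" where
  "marked_batch_neighbors B s v = {w. {v, w} \<in> B \<and> marked s w}"

definition enter_level :: "params \<Rightarrow> kind \<Rightarrow> edge set \<Rightarrow> nat \<Rightarrow> 'p state \<Rightarrow> 'p state" where
  "enter_level P k B h s = s\<lparr>phase := Visit k B h (movers P k h s) Map.empty\<rparr>"

text \<open>
  The steps of the update processes inside a batch.  The processing of different vertices of a level
  is interleaved arbitrarily, except that \<open>mark\<close> is not executed at the same time for both endpoints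
  of an edge of the batch: otherwise neither would see the other one as marked, and a single update
  could move two vertices in different DAGs.
\<close>

inductive work :: "params \<Rightarrow> 'p state \<Rightarrow> 'p state \<Rightarrow> bool" for P where
  change_edges:
    "phase s = Edges k B \<Longrightarrow>
     work P s (enter_level P k B 0 (s\<lparr>graph := apply_edges k B (graph s)\<rparr>))"
| mark_begin:
    "phase s = Visit k B h T U \<Longrightarrow> v \<in> T \<Longrightarrow> \<not> marked s v \<Longrightarrow> U v = None \<Longrightarrow>
     \<forall>w\<in>dom U. {v, w} \<notin> B \<Longrightarrow>
     W = marked_batch_neighbors B s v \<union> triggers k s v \<Longrightarrow>
     work P s ((put_desc v \<lparr>parent = None, old_level = level s v\<rparr> s)
                 \<lparr>phase := Visit k B h T (U(v \<mapsto> W))\<rparr>)"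
| mark_union:
    "phase s = Visit k B h T U \<Longrightarrow> U v = Some W \<Longrightarrow> w \<in> W \<Longrightarrow>
     root_of s v r \<Longrightarrow> root_of s w r' \<Longrightarrow>
     work P s ((unite P r r' s)\<lparr>phase := Visit k B h T (U(v \<mapsto> W - {w}))\<rparr>)"
| mark_end:
    "phase s = Visit k B h T U \<Longrightarrow> U v = Some {} \<Longrightarrow>
     work P s (s\<lparr>desc_array := (desc_array s)(v \<mapsto> batch_number s),
                phase := Visit k B h T (U(v := None))\<rparr>)"
| move:
    "phase s = Visit k B h T U \<Longrightarrow> v \<in> T \<Longrightarrow> marked s v \<Longrightarrow>
     work P s (s\<lparr>level := (level s)(v := target k h), phase := Visit k B h (T - {v}) U\<rparr>)"
| next_level:
    "phase s = Visit k B h {} Map.empty \<Longrightarrow> Suc h < nlevels P \<Longrightarrow>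
     work P s (enter_level P k B (Suc h) s)"
| levels_done:
    "phase s = Visit k B h {} Map.empty \<Longrightarrow> \<not> Suc h < nlevels P \<Longrightarrow>
     work P s (s\<lparr>phase := Unmark_Roots\<rparr>)"
| unmark_root:
    "phase s = Unmark_Roots \<Longrightarrow> marked s v \<Longrightarrow> is_root s v \<Longrightarrow>
     work P s (s\<lparr>desc_array := (desc_array s)(v := None)\<rparr>)"
| roots_done:
    "phase s = Unmark_Roots \<Longrightarrow> \<forall>v. \<not> (marked s v \<and> is_root s v) \<Longrightarrow>
     work P s (s\<lparr>phase := Unmark_Rest\<rparr>)"
| unmark_rest:
    "phase s = Unmark_Rest \<Longrightarrow> marked s v \<Longrightarrow>
     work P s (s\<lparr>desc_array := (desc_array s)(v := None)\<rparr>)"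


section \<open>Reads\<close>

fun read_next :: "params \<Rightarrow> 'p state \<Rightarrow> rpc \<Rightarrow> rpc option" where
  "read_next P s (R_Batch1 v) = Some (R_Level1 v (batch_number s))"
| "read_next P s (R_Level1 v b1) = Some (R_Desc v b1 (level s v))"
| "read_next P s (R_Desc v b1 l1) =
     Some (case desc_array s v of
             None \<Rightarrow> R_Level2 v b1 l1 None
           | Some b \<Rightarrow> R_Parent v b1 l1 (b, v) (b, v))"
| "read_next P s (R_Parent v b1 l1 d c) =
     Some (case parent (the (heap s (fst c) (snd c))) of
             None \<Rightarrow> R_Level2 v b1 l1 (Some d)
           | Some u \<Rightarrow> R_Lookup v b1 l1 d u)"
| "read_next P s (R_Lookup v b1 l1 d u) =
     Some (case desc_array s u of
             None \<Rightarrow> R_Level2 v b1 l1 None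
           | Some b \<Rightarrow> R_Parent v b1 l1 d (b, u))"
| "read_next P s (R_Level2 v b1 l1 st) = Some (R_Batch2 v b1 l1 st (level s v))"
| "read_next P s (R_Batch2 v b1 l1 st l2) =
     Some (if b1 \<noteq> batch_number s then R_Batch1 v
           else case st of
             Some d \<Rightarrow> R_Return (coreness_estimate P (old_level (the (heap s (fst d) (snd d)))))
           | None \<Rightarrow> if l1 = l2 then R_Return (coreness_estimate P l1) else R_Batch1 v)"
| "read_next P s R_Idle = None"
| "read_next P s (R_Return x) = None"


section \<open>Executions\<close>

datatype 'p label =
    Start_Batch kind "edge set"
  | Work
  | End_Batch
  | Compress
  | Inv_Read 'p vertex
  | Read_Step 'p
  | Res_Read 'p real
  | Stutter

text \<open>
  \<open>compress\<close> covers the path compression by any process.  The vertex which was the root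
  when a traversal reached it need not be a root any more when the parent is redirected to it, so
  the new parent is an arbitrary further ancestor.  \<open>stutter\<close> makes the infinite executions cover
  those in which nothing happens from some time on.
\<close>

inductive step :: "params \<Rightarrow> 'p state \<Rightarrow> 'p label \<Rightarrow> 'p state \<Rightarrow> bool" for P where
  start_batch:
    "phase s = Quiet \<Longrightarrow> B \<subseteq> edges P \<Longrightarrow> B \<noteq> {} \<Longrightarrow>
     step P s (Start_Batch k B) (s\<lparr>batch_number := Suc (batch_number s), phase := Edges k B\<rparr>)"
| work:
    "work P s s' \<Longrightarrow> step P s Work s'"
| end_batch:
    "phase s = Unmark_Rest \<Longrightarrow> \<forall>v. \<not> marked s v \<Longrightarrow> step P s End_Batch (s\<lparr>phase := Quiet\<rparr>)"
| compress:
    "(v, u) \<in> parent_rel s \<Longrightarrow> (u, a) \<in> (parent_rel s)\<^sup>+ \<Longrightarrow>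
     step P s Compress (set_parent v a s)"
| inv_read:
    "reader s p = R_Idle \<Longrightarrow> v < nverts P \<Longrightarrow>
     step P s (Inv_Read p v) (s\<lparr>reader := (reader s)(p := R_Batch1 v)\<rparr>)"
| read_step:
    "read_next P s (reader s p) = Some pc \<Longrightarrow>
     step P s (Read_Step p) (s\<lparr>reader := (reader s)(p := pc)\<rparr>)"
| res_read:
    "reader s p = R_Return x \<Longrightarrow>
     step P s (Res_Read p x) (s\<lparr>reader := (reader s)(p := R_Idle)\<rparr>)"
| stutter:
    "step P s Stutter s"

definition execution :: "params \<Rightarrow> (nat \<Rightarrow> 'p state) \<Rightarrow> (nat \<Rightarrow> 'p label) \<Rightarrow> bool" where
  "execution P \<sigma> l \<longleftrightarrow> initial P (\<sigma> 0) \<and> (\<forall>i. step P (\<sigma> i) (l i) (\<sigma> (Suc i)))"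

text \<open>
  An operation is identified by the index of the step by which it is invoked; the updates of a batch
  are all invoked when the batch starts and respond when it ends.
\<close>

datatype 'p operation =
    Read 'p vertex nat
  | Update kind edge nat

definition operations_of :: "(nat \<Rightarrow> 'p label) \<Rightarrow> nat \<Rightarrow> 'p operation set" where
  "operations_of l N =
     {Read p v i | p v i. i < N \<and> l i = Inv_Read p v}
   \<union> {Update k e i | k e i. i < N \<and> (\<exists>B. l i = Start_Batch k B \<and> e \<in> B)}"

fun invocation :: "'p operation \<Rightarrow> nat" where
  "invocation (Read p v i) = i"
| "invocation (Update k e i) = i"

definition first_after :: "nat \<Rightarrow> nat \<Rightarrow> (nat \<Rightarrow> bool) \<Rightarrow> nat option" where
  "first_after i N Q =
     (if \<exists>j. i < j \<and> j < N \<and> Q j then Some (LEAST j. i < j \<and> j < N \<and> Q j) else None)"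

text \<open>The return value is \<open>None\<close> for updates, and \<open>Some\<close> of the coreness estimate for reads.\<close>

fun response :: "(nat \<Rightarrow> 'p label) \<Rightarrow> nat \<Rightarrow> 'p operation \<Rightarrow> (real option \<times> nat) option" where
  "response l N (Read p v i) =
     map_option (\<lambda>j. (Some (THE x. l j = Res_Read p x), j))
       (first_after i N (\<lambda>j. \<exists>x. l j = Res_Read p x))"
| "response l N (Update k e i) =
     map_option (\<lambda>j. (None, j)) (first_after i N (\<lambda>j. l j = End_Batch))"

definition history_of :: "(nat \<Rightarrow> 'p label) \<Rightarrow> nat \<Rightarrow> ('p operation, real option) history" where
  "history_of l N =
     \<lparr>operations = operations_of l N, invoked = invocation, responded = response l N\<rparr>"


section \<open>Sequential behaviour\<close>

text \<open>
  For the batch started by step \<open>i\<close>: the state at its end, or after the first \<open>N\<close> steps if it has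
  not ended by then.
\<close>

definition batch_end :: "(nat \<Rightarrow> 'p state) \<Rightarrow> (nat \<Rightarrow> 'p label) \<Rightarrow> nat \<Rightarrow> nat \<Rightarrow> 'p state" where
  "batch_end \<sigma> l N i = \<sigma> (case first_after i N (\<lambda>j. l j = End_Batch) of Some j \<Rightarrow> j | None \<Rightarrow> N)"

text \<open>
  \<open>mv i v\<close> is the update, of the batch started by step \<open>i\<close>, that moves \<open>v\<close>.  The same update moves
  all vertices of a DAG, and its edge is incident to the DAG.
\<close>

definition mover_assignment ::
  "params \<Rightarrow> (nat \<Rightarrow> 'p state) \<Rightarrow> (nat \<Rightarrow> 'p label) \<Rightarrow> nat \<Rightarrow> (nat \<Rightarrow> vertex \<Rightarrow> edge) \<Rightarrow> bool"
  where
  "mover_assignment P \<sigma> l N mv \<longleftrightarrow>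
     (\<forall>i<N. \<forall>k B. l i = Start_Batch k B \<longrightarrow>
        (\<forall>v w. same_dag (batch_end \<sigma> l N i) v w \<longrightarrow> mv i v = mv i w)
      \<and> (\<forall>v<nverts P. level (\<sigma> i) v \<noteq> level (batch_end \<sigma> l N i) v \<longrightarrow>
           mv i v \<in> B \<and> (\<exists>w. same_dag (batch_end \<sigma> l N i) v w \<and> w \<in> mv i v)))"

type_synonym seq_state = "graph \<times> (vertex \<Rightarrow> nat)"

fun seq_step ::
  "params \<Rightarrow> (nat \<Rightarrow> 'p state) \<Rightarrow> (nat \<Rightarrow> 'p label) \<Rightarrow> nat \<Rightarrow> (nat \<Rightarrow> vertex \<Rightarrow> edge) \<Rightarrow>
   seq_state \<Rightarrow> 'p operation \<times> real option \<Rightarrow> seq_state \<Rightarrow> bool" where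
  "seq_step P \<sigma> l N mv (E, lv) (Read p v i, r) S' \<longleftrightarrow>
     r = Some (coreness_estimate P (lv v)) \<and> S' = (E, lv)"
| "seq_step P \<sigma> l N mv (E, lv) (Update k e i, r) S' \<longleftrightarrow>
     r = None
   \<and> S' = (apply_edges k {e} E, \<lambda>v. if mv i v = e then level (batch_end \<sigma> l N i) v else lv v)"

definition whole_batches :: "(nat \<Rightarrow> 'p label) \<Rightarrow> nat \<Rightarrow> 'p operation set \<Rightarrow> bool" where
  "whole_batches l N A \<longleftrightarrow>
     (\<forall>i<N. \<forall>k B. l i = Start_Batch k B \<longrightarrow>
        (\<forall>e\<in>B. Update k e i \<in> A) \<or> (\<forall>e\<in>B. Update k e i \<notin> A))"

text \<open>
  The last condition expresses that the levels are updated in accordance with the graph: the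
  invariants hold whenever no batch has been executed only partially.
\<close>

definition legal ::
  "params \<Rightarrow> (nat \<Rightarrow> 'p state) \<Rightarrow> (nat \<Rightarrow> 'p label) \<Rightarrow> nat \<Rightarrow> (nat \<Rightarrow> vertex \<Rightarrow> edge) \<Rightarrow>
   ('p operation \<times> real option) list \<Rightarrow> bool" where
  "legal P \<sigma> l N mv xs \<longleftrightarrow>
     (\<exists>S :: nat \<Rightarrow> seq_state.
        S 0 = (graph (\<sigma> 0), level (\<sigma> 0))
      \<and> (\<forall>j<length xs. seq_step P \<sigma> l N mv (S j) (xs ! j) (S (Suc j)))
      \<and> (\<forall>j\<le>length xs. whole_batches l N (fst ` set (take j xs)) \<longrightarrow> lds P (fst (S j)) (snd (S j))))"

text \<open>Linearizability concerns the history of every finite prefix of an execution.\<close>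

definition cplds_linearizable ::
  "params \<Rightarrow> (nat \<Rightarrow> 'p state) \<Rightarrow> (nat \<Rightarrow> 'p label) \<Rightarrow> bool" where
  "cplds_linearizable P \<sigma> l \<longleftrightarrow>
     (\<forall>N. \<exists>mv. mover_assignment P \<sigma> l N mv \<and> linearizable (history_of l N) (legal P \<sigma> l N mv))"


section \<open>Liveness\<close>

text \<open>
  Of the synchrony of the update processes only this is used: if from some time on the update
  processes always can take a step, then they take one.
\<close>

definition update_fair ::
  "params \<Rightarrow> (nat \<Rightarrow> 'p state) \<Rightarrow> (nat \<Rightarrow> 'p label) \<Rightarrow> bool" where
  "update_fair P \<sigma> l \<longleftrightarrow>
     (\<forall>i. (\<forall>j\<ge>i. \<exists>s'. step P (\<sigma> j) Work s' \<or> step P (\<sigma> j) End_Batch s') \<longrightarrow>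
          (\<exists>j\<ge>i. l j = Work \<or> l j = End_Batch))"

definition updates_terminate :: "(nat \<Rightarrow> 'p label) \<Rightarrow> bool" where
  "updates_terminate l \<longleftrightarrow>
     (\<forall>N k e i. Update k e i \<in> operations_of l N \<longrightarrow> (\<exists>N'. response l N' (Update k e i) \<noteq> None))"

text \<open>
  As a read process invokes a read only after its previous one has returned, the hypothesis of
  lock-freedom is that read processes take infinitely many steps, invocations included.
\<close>

definition read_step_label :: "'p label \<Rightarrow> bool" where
  "read_step_label a \<longleftrightarrow>
     (\<exists>p. (\<exists>v. a = Inv_Read p v) \<or> a = Read_Step p \<or> (\<exists>x. a = Res_Read p x))"

text \<open>Batches are nonempty, so that at least one update terminates when a batch ends.\<close>

definition terminates_operation :: "'p label \<Rightarrow> bool" where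
  "terminates_operation a \<longleftrightarrow> a = End_Batch \<or> (\<exists>p x. a = Res_Read p x)"

definition reads_lock_free :: "(nat \<Rightarrow> 'p label) \<Rightarrow> bool" where
  "reads_lock_free l \<longleftrightarrow>
     (infinite {i. read_step_label (l i)} \<longrightarrow> infinite {i. terminates_operation (l i)})"

end

theory Submission
  imports Defs
begin

text \<open>
  All vertices of a dependency DAG take their new level, in the sequential execution, when the root of
  the DAG is unmarked: that is the moment at which the update responsible for the DAG takes effect.
  Such an update exists because a vertex moves only if it lies on an edge of the batch or if a
  neighbor has moved before, whose DAG it joins; and it is responsible for one DAG only because the two
  endpoints of an edge of the batch are in the same DAG if both are marked.  A read takes effect at its
  last access to \<open>desc_array\<close>.  If this access finds a marked descriptor whose vertex turns out to be
  the root, then the DAG was not yet released at that time, and the old level is correct.  If it finds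
  an unmarked entry, then either the vertex has not yet moved, and the first level read is correct, or
  its DAG has been released, so that the level is final and the second level read is correct; hence
  equality of the two suffices.

  For liveness, the work of a batch decreases a lexicographic measure.  A read attempt is finite because
  parent pointers, compressed or not, lead to proper ancestors, and it can fail only if a batch has
  started or a level has changed since it began.
\<close>

section \<open>Trees of parent pointers\<close>

text \<open>Which edge moves a vertex is known only in retrospect, because DAGs merge until the
  levels are final. Movers and points are therefore chosen for each prefix separately, from the last
  state of a batch inside it. The traversal of a read is not atomic: between seeing a mark and
  reaching the root, trees may be merged, compressed and unmarked. Three facts that persist within a
  batch make it sound: trees only merge, a vertex that has lost its root status never regains it,
  and until unmarking begins every parent is marked. By the first two, a root found late was the
  root already when its own mark was seen; by the third, an unmarked ancestor is evidence that
  unmarking has begun. Parents stay marked because a root without an array entry loses a union: a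
  vertex being marked owns a descriptor before its entry is written.\<close>

definition prel :: "(vertex \<Rightarrow> desc option) \<Rightarrow> (vertex \<times> vertex) set" where
  "prel F = {(v, w). \<exists>d. F v = Some d \<and> parent d = Some w}"

definition rooted :: "(vertex \<Rightarrow> desc option) \<Rightarrow> vertex \<Rightarrow> vertex \<Rightarrow> bool" where
  "rooted F v r \<longleftrightarrow> (v, r) \<in> (prel F)\<^sup>* \<and> (\<exists>d. F r = Some d \<and> parent d = None)"

definition same_tree :: "(vertex \<Rightarrow> desc option) \<Rightarrow> vertex \<Rightarrow> vertex \<Rightarrow> bool" where
  "same_tree F v w \<longleftrightarrow> (\<exists>r. rooted F v r \<and> rooted F w r)"

text \<open>The condition on the range says that no parent pointer dangles; the bound
  \<open>n\<close> makes the relation finite, so following parents ends at a root. One row of the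
  heap is the only data, so that linking and compression are studied apart from the rest of the
  state.\<close>

definition forest :: "nat \<Rightarrow> (vertex \<Rightarrow> desc option) \<Rightarrow> bool" where
  "forest n F \<longleftrightarrow> dom F \<subseteq> {..<n} \<and> acyclic (prel F) \<and> Range (prel F) \<subseteq> dom F"

lemma root_no_parent: "F r = Some d \<Longrightarrow> parent d = None \<Longrightarrow> (r, x) \<in> (prel F)\<^sup>* \<Longrightarrow> x = r"
  by (erule converse_rtranclE) (auto simp: prel_def)

lemma rooted_unique:
  assumes "rooted F v r" "rooted F v r'"
  shows "r = r'"
proof -
  have "single_valued (prel F)"
    by (auto simp: prel_def single_valued_def)
  then have "(r, r') \<in> (prel F)\<^sup>* \<or> (r', r) \<in> (prel F)\<^sup>*"
    using assms by (auto simp: rooted_def dest: single_valued_confluent)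
  then show ?thesis
    using assms root_no_parent by (metis rooted_def)
qed

lemma rooted_step: "(v, w) \<in> (prel F)\<^sup>* \<Longrightarrow> rooted F w r \<Longrightarrow> rooted F v r"
  unfolding rooted_def by (meson rtrancl_trans)

lemma rooted_dom:
  assumes "rooted F v r" shows "F v \<noteq> None" "F r \<noteq> None"
proof -
  show "F r \<noteq> None" using assms by (auto simp: rooted_def)
  have "(v, r) \<in> (prel F)\<^sup>*" using assms by (auto simp: rooted_def)
  then show "F v \<noteq> None" using \<open>F r \<noteq> None\<close>
    by (cases rule: converse_rtranclE) (auto simp: prel_def)
qed

lemma forest_finite: "forest n F \<Longrightarrow> finite (prel F)"
  by (rule finite_subset[of _ "{..<n} \<times> {..<n}"]) (auto simp: forest_def prel_def)

lemma rooted_exists: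
  assumes "forest n F" "F v \<noteq> None"
  shows "\<exists>r. rooted F v r"
proof -
  have "wf ((prel F)\<inverse>)"
    using assms(1) forest_finite finite_acyclic_wf_converse by (auto simp: forest_def)
  then show ?thesis using assms(2)
  proof (induction v rule: wf_induct_rule)
    case (less v)
    then obtain d where d: "F v = Some d" by auto
    show ?case
    proof (cases "parent d")
      case None
      then show ?thesis using d by (auto simp: rooted_def)
    next
      case (Some w)
      then have vw: "(v, w) \<in> prel F" using d by (auto simp: prel_def)
      then have "F w \<noteq> None" using assms(1) by (auto simp: forest_def)
      then obtain r where "rooted F w r" using less.IH vw by auto
      then show ?thesis using rooted_step vw by (meson r_into_rtrancl)
    qed
  qed
qed

lemma same_tree_refl: "forest n F \<Longrightarrow> F v \<noteq> None \<Longrightarrow> same_tree F v v"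
  using rooted_exists by (auto simp: same_tree_def)

lemma same_tree_sym: "same_tree F v w \<Longrightarrow> same_tree F w v"
  by (auto simp: same_tree_def)

lemma same_tree_trans: "same_tree F u v \<Longrightarrow> same_tree F v w \<Longrightarrow> same_tree F u w"
  by (metis same_tree_def rooted_unique)

lemma same_tree_dom: "same_tree F v w \<Longrightarrow> F v \<noteq> None \<and> F w \<noteq> None"
  using rooted_dom by (auto simp: same_tree_def)

lemma same_tree_rooted: "same_tree F v w \<Longrightarrow> rooted F v r \<longleftrightarrow> rooted F w r"
  by (metis same_tree_def rooted_unique)

lemma rooted_same_tree: "rooted F v r \<Longrightarrow> same_tree F v r"
  by (auto simp: same_tree_def rooted_def)

text \<open>No cycle arises because \<open>r\<close> is a root other than \<open>r'\<close>, so
  \<open>r'\<close> is not among its ancestors. Only \<open>r'\<close> loses its root status, and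
  its whole tree is carried along.\<close>

lemma link_forest:
  assumes F: "forest n F" and r: "rooted F v r" "rooted F v' r'" "r \<noteq> r'"
    and F': "F' = F(r' \<mapsto> (the (F r'))\<lparr>parent := Some r\<rparr>)"
  shows "forest n F'" "prel F' = insert (r', r) (prel F)"
    "rooted F x y \<Longrightarrow> rooted F' x (if y = r' then r else y)"
    "same_tree F x z \<Longrightarrow> same_tree F' x z"
    "same_tree F' r r'"
proof -
  obtain d d' where d: "F r = Some d" "parent d = None" "F r' = Some d'" "parent d' = None"
    using r by (auto simp: rooted_def)
  show p: "prel F' = insert (r', r) (prel F)"
    using d by (auto simp: prel_def F' split: if_splits)
  have "(r, r') \<notin> (prel F)\<^sup>*" using root_no_parent d r(3) by metis
  then show "forest n F'"
    using F d unfolding forest_def p by (auto simp: F')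
  show root: "rooted F' x (if y = r' then r else y)" if "rooted F x y" for x y
  proof -
    have "(x, y) \<in> (prel F')\<^sup>*"
      using that p unfolding rooted_def by (metis rtrancl_mono subset_insertI subsetD)
    moreover have "(r', r) \<in> prel F'" using p by simp
    ultimately show ?thesis
      using that d r(3) unfolding rooted_def by (auto simp: F')
  qed
  show "same_tree F' x z" if "same_tree F x z" for x z
    using that root unfolding same_tree_def by blast
  have "rooted F r r" "rooted F r' r'" using d by (auto simp: rooted_def)
  then show "same_tree F' r r'"
    using root[of r r] root[of r' r'] r(3) by (auto simp: same_tree_def)
qed

text \<open>The new pointer lies in the transitive closure of the old ones, and \<open>v\<close> was
  no root before, so the roots are the same. The inclusion of the transitive closures is stated for
  the termination measure of reads.\<close>

lemma compress_forest:
  assumes F: "forest n F" and vu: "(v, u) \<in> prel F" and ua: "(u, a) \<in> (prel F)\<^sup>+"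
    and F': "F' = F(v \<mapsto> (the (F v))\<lparr>parent := Some a\<rparr>)"
  shows "forest n F'" "prel F' \<subseteq> (prel F)\<^sup>+" "(prel F')\<^sup>+ \<subseteq> (prel F)\<^sup>+" "rooted F' = rooted F"
    "same_tree F' = same_tree F"
proof -
  have va: "(v, a) \<in> (prel F)\<^sup>+" using vu ua by auto
  show p: "prel F' \<subseteq> (prel F)\<^sup>+"
  proof safe
    fix x y assume "(x, y) \<in> prel F'"
    then have "(x, y) = (v, a) \<or> (x, y) \<in> prel F"
      by (auto simp: prel_def F' split: if_splits)
    then show "(x, y) \<in> (prel F)\<^sup>+" using va by auto
  qed
  then show pp: "(prel F')\<^sup>+ \<subseteq> (prel F)\<^sup>+"
    by (metis trancl_mono_subset trancl_id trans_trancl)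
  have "Range (prel F') \<subseteq> Range (prel F)"
    using p by (metis Range_mono trancl_range)
  moreover have "dom F' = dom F"
    using vu by (auto simp: F' prel_def)
  ultimately show f: "forest n F'"
    using F pp unfolding forest_def acyclic_def by blast
  have root: "(\<exists>d. F' r = Some d \<and> parent d = None) \<longleftrightarrow> (\<exists>d. F r = Some d \<and> parent d = None)" for r
    using vu by (auto simp: F' prel_def)
  have ps: "(prel F')\<^sup>* \<subseteq> (prel F)\<^sup>*"
    using p by (metis rtrancl_mono rtrancl_trancl_absorb trancl_rtrancl_absorb rtrancl_subset_rtrancl trancl_into_rtrancl subset_iff)
  have le: "rooted F' x r \<Longrightarrow> rooted F x r" for x r
    using root ps unfolding rooted_def by blast
  \<comment> \<open>No path has to be rebuilt: \<open>x\<close> has some root in \<open>F'\<close>,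
    which is a root of it in \<open>F\<close> and therefore is \<open>r\<close>.\<close>
  have "rooted F' x r" if "rooted F x r" for x r
  proof -
    have "F' x \<noteq> None" using rooted_dom[OF that] by (auto simp: F')
    then obtain r' where "rooted F' x r'" using rooted_exists f by blast
    then show ?thesis using le that rooted_unique by metis
  qed
  then show eq: "rooted F' = rooted F" using le by blast
  show "same_tree F' = same_tree F"
    by (intro ext) (simp add: same_tree_def eq)
qed

lemma fresh_forest:
  assumes F: "forest n F" and v: "F v = None" "v < n"
    and F': "F' = F(v \<mapsto> d)" and d: "parent d = None"
  shows "forest n F'" "prel F' = prel F" "rooted F x r \<Longrightarrow> rooted F' x r"
    "same_tree F x y \<Longrightarrow> same_tree F' x y" "same_tree F' v v"
proof -
  show p: "prel F' = prel F"
    using v d by (fastforce simp: prel_def F' split: if_splits)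
  show "forest n F'" using F v unfolding forest_def p by (auto simp: F')
  show root: "rooted F x r \<Longrightarrow> rooted F' x r" for x r
    using v unfolding rooted_def p by (auto simp: F')
  then show "same_tree F x y \<Longrightarrow> same_tree F' x y"
    unfolding same_tree_def by blast
  have "rooted F' v v" using d by (auto simp: rooted_def F')
  then show "same_tree F' v v" by (auto simp: same_tree_def)
qed

section \<open>The level data structure\<close>

lemma in_nbrs_from [simp]: "w \<in> nbrs_from E lv v h \<longleftrightarrow> {v, w} \<in> E \<and> h \<le> lv w"
  by (simp add: nbrs_from_def)

lemma edgesD: "{v, w} \<in> edges P \<Longrightarrow> v < nverts P \<and> w < nverts P \<and> v \<noteq> w"
  by (auto simp: edges_def doubleton_eq_iff)

lemma nbrs_from_subset: "E \<subseteq> edges P \<Longrightarrow> nbrs_from E lv v h \<subseteq> {..<nverts P}"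
  using edgesD by (fastforce simp: nbrs_from_def)

lemma finite_nbrs_from: "E \<subseteq> edges P \<Longrightarrow> finite (nbrs_from E lv v h)"
  using nbrs_from_subset by (metis finite_lessThan finite_subset)

lemma card_nbrs_from_mono:
  "E \<subseteq> edges P \<Longrightarrow> nbrs_from E' lv' v' h' \<subseteq> nbrs_from E lv v h \<Longrightarrow>
   real (card (nbrs_from E' lv' v' h')) \<le> real (card (nbrs_from E lv v h))"
  using card_mono finite_nbrs_from by (metis of_nat_le_iff)

lemma group_of_mono: "h \<le> h' \<Longrightarrow> group_of P h \<le> group_of P h'"
  by (simp add: group_of_def div_le_mono)

lemma power_group_mono:
  "valid_params P \<Longrightarrow> h \<le> h' \<Longrightarrow> (1 + delta P) ^ group_of P h \<le> (1 + delta P) ^ group_of P h'"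
  by (rule power_increasing) (auto simp: valid_params_def group_of_mono)

text \<open>The factor is at least 1. This gap between the two thresholds lets a failure of one
  invariant yield the other one at the adjacent level.\<close>

lemma inv1_bound_ge:
  "valid_params P \<Longrightarrow> (1 + delta P) ^ m \<le> (2 + 3 / lambda P) * (1 + delta P) ^ m"
proof -
  assume "valid_params P"
  then have "1 * (1 + delta P) ^ m \<le> (2 + 3 / lambda P) * (1 + delta P) ^ m"
    by (intro mult_right_mono) (auto simp: valid_params_def)
  then show ?thesis by simp
qed

lemma nverts_le_power_logn:
  assumes "valid_params P" shows "real (nverts P) \<le> (1 + delta P) ^ logn P"
proof -
  have d: "0 < delta P" and n: "2 \<le> nverts P" using assms by (auto simp: valid_params_def)
  have "log (1 + delta P) (nverts P) \<le> real (logn P)"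
    by (simp add: logn_def of_nat_nat real_nat_ceiling_ge)
  then have "(1 + delta P) powr log (1 + delta P) (nverts P) \<le> (1 + delta P) powr real (logn P)"
    using d by (intro powr_mono) auto
  then show ?thesis using d n by (simp add: powr_realpow)
qed

lemma inv1_top:
  assumes P: "valid_params P" and E: "E \<subseteq> edges P" and h: "logn P \<le> group_of P (lv v)"
  shows "inv1 P E lv v"
proof -
  have "real (card (nbrs_from E lv v (lv v))) \<le> real (card {..<nverts P})"
    using card_mono[OF _ nbrs_from_subset[OF E]] by (metis finite_lessThan of_nat_le_iff)
  also have "\<dots> \<le> (1 + delta P) ^ logn P" using nverts_le_power_logn[OF P] by simp
  also have "\<dots> \<le> (1 + delta P) ^ group_of P (lv v)"
    using P h by (intro power_increasing) (auto simp: valid_params_def)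
  also have "\<dots> \<le> (2 + 3 / lambda P) * (1 + delta P) ^ group_of P (lv v)"
    by (rule inv1_bound_ge[OF P])
  finally show ?thesis by (simp add: inv1_def)
qed

text \<open>In the last group the bound is at least the number of vertices, so a violating vertex
  lies below that group, and moving up by one stays within the levels.\<close>

lemma not_inv1_below_top:
  assumes "valid_params P" "E \<subseteq> edges P" "\<not> inv1 P E lv v" "lv v < nlevels P"
  shows "Suc (lv v) < nlevels P"
proof -
  have g: "group_of P (lv v) < logn P" using inv1_top assms by (metis not_le)
  then have "lv v < logn P * (4 * logn P)"
    using div_less_iff_less_mult[of "4 * logn P"] by (simp add: group_of_def)
  then show ?thesis using g by (simp add: nlevels_def)
qed

text \<open>Going down lowers the threshold and enlarges the neighbor set. The levels at which a
  vertex satisfies Invariant 2 thus form an initial segment, which gives the desire level its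
  meaning.\<close>

lemma inv2_at_mono:
  assumes P: "valid_params P" and E: "E \<subseteq> edges P" and h: "h' \<le> h" and i: "inv2_at P E lv v h"
  shows "inv2_at P E lv v h'"
  unfolding inv2_at_def
proof
  assume h': "0 < h'"
  have "(1 + delta P) ^ group_of P (h' - 1) \<le> (1 + delta P) ^ group_of P (h - 1)"
    using P h by (intro power_group_mono) auto
  also have "\<dots> \<le> real (card (nbrs_from E lv v (h - 1)))"
    using i h h' by (simp add: inv2_at_def)
  also have "\<dots> \<le> real (card (nbrs_from E lv v (h' - 1)))"
    using h by (intro card_nbrs_from_mono[OF E]) auto
  finally show "(1 + delta P) ^ group_of P (h' - 1) \<le> real (card (nbrs_from E lv v (h' - 1)))" .
qed

lemma inv2_at_0 [simp]: "inv2_at P E lv v 0"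
  by (simp add: inv2_at_def)

lemma inv2_at_weaken:
  assumes "inv2_at P E lv v h" "E' \<subseteq> edges P"
    "0 < h \<Longrightarrow> nbrs_from E lv v (h - 1) \<subseteq> nbrs_from E' lv' v (h - 1)"
  shows "inv2_at P E' lv' v h"
  using assms card_nbrs_from_mono[OF assms(2), of E lv v "h - 1" lv' v "h - 1"]
  by (auto simp: inv2_at_def)

lemma inv1_weaken:
  assumes P: "valid_params P" and "inv1 P E lv v" "E \<subseteq> edges P"
    "nbrs_from E' lv' v (lv' v) \<subseteq> nbrs_from E lv v (lv v)" "lv v \<le> lv' v"
  shows "inv1 P E' lv' v"
proof -
  have "real (card (nbrs_from E' lv' v (lv' v))) \<le> real (card (nbrs_from E lv v (lv v)))"
    using assms by (intro card_nbrs_from_mono) auto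
  also have "\<dots> \<le> (2 + 3 / lambda P) * (1 + delta P) ^ group_of P (lv v)"
    using assms by (simp add: inv1_def)
  also have "\<dots> \<le> (2 + 3 / lambda P) * (1 + delta P) ^ group_of P (lv' v)"
    using assms power_group_mono[OF P, of "lv v" "lv' v"]
    by (intro mult_left_mono) (auto simp: valid_params_def)
  finally show ?thesis by (simp add: inv1_def)
qed

text \<open>Too many neighbors for Invariant 1 are more than enough for Invariant 2 one level
  higher, so moving up does not break Invariant 2 for the moving vertex.\<close>

lemma not_inv1_inv2_at:
  assumes P: "valid_params P" and "\<not> inv1 P E lv v" shows "inv2_at P E lv v (Suc (lv v))"
  using assms(2) inv1_bound_ge[OF P, of "group_of P (lv v)"] by (simp add: inv1_def inv2_at_def)

text \<open>The counterpart for deletions: too few neighbors for the next higher level are few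
  enough for Invariant 1 at the level to which the vertex moves.\<close>

lemma not_inv2_at_inv1:
  assumes P: "valid_params P" and E: "E \<subseteq> edges P" and i: "\<not> inv2_at P E lv v (Suc (lv' v))"
    and sub: "nbrs_from E lv' v (lv' v) \<subseteq> nbrs_from E lv v (lv' v)"
  shows "inv1 P E lv' v"
proof -
  have "real (card (nbrs_from E lv' v (lv' v))) \<le> real (card (nbrs_from E lv v (lv' v)))"
    by (rule card_nbrs_from_mono[OF E sub])
  also have "\<dots> \<le> (1 + delta P) ^ group_of P (lv' v)"
    using i by (simp add: inv2_at_def)
  also have "\<dots> \<le> (2 + 3 / lambda P) * (1 + delta P) ^ group_of P (lv' v)"
    by (rule inv1_bound_ge[OF P])
  finally show ?thesis by (simp add: inv1_def)
qed

text \<open>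
  In the clause \<open>inv2_at P E lv v (min (lv v) h)\<close> for deletions, a vertex that violates Invariant 2 has
  a desire level of at least \<open>h\<close>.
\<close>

definition pre_visit ::
  "params \<Rightarrow> kind \<Rightarrow> nat \<Rightarrow> vertex set \<Rightarrow> graph \<Rightarrow> (vertex \<Rightarrow> nat) \<Rightarrow> bool" where
  "pre_visit P k h M E lv \<longleftrightarrow> (\<forall>v<nverts P. lv v < nlevels P) \<and>
     (case k of
        Insertion \<Rightarrow> \<forall>v<nverts P. inv2 P E lv v \<and> (lv v < h \<longrightarrow> inv1 P E lv v)
      | Deletion \<Rightarrow> (\<forall>v<nverts P. inv1 P E lv v \<and> inv2_at P E lv v (min (lv v) h))
          \<and> (\<forall>v\<in>M. lv v < h))"

text \<open>For deletions, success at \<open>h\<close> and failure at \<open>Suc h\<close> express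
  that the desire level is exactly \<open>h\<close>. The clause on \<open>M - T\<close> places the
  vertices that have moved at or below the visited level; hence the restriction of
  \<open>movers\<close> to unmarked vertices overlooks no violation above it.\<close>

definition visiting ::
  "params \<Rightarrow> kind \<Rightarrow> nat \<Rightarrow> vertex set \<Rightarrow> vertex set \<Rightarrow> graph \<Rightarrow> (vertex \<Rightarrow> nat) \<Rightarrow> bool" where
  "visiting P k h T M E lv \<longleftrightarrow> (\<forall>v<nverts P. lv v < nlevels P) \<and>
     (case k of
        Insertion \<Rightarrow> T = {v. v < nverts P \<and> lv v = h \<and> \<not> inv1 P E lv v}
          \<and> (\<forall>v<nverts P. inv2 P E lv v \<and> (lv v < h \<longrightarrow> inv1 P E lv v))
      | Deletion \<Rightarrow>
          (\<forall>v\<in>T. v < nverts P \<and> h < lv v \<and> inv2_at P E lv v h \<and> \<not> inv2_at P E lv v (Suc h))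
          \<and> (\<forall>v<nverts P. inv1 P E lv v \<and> (v \<notin> T \<longrightarrow> inv2_at P E lv v (min (lv v) (Suc h))))
          \<and> (\<forall>v\<in>M - T. lv v \<le> h))"

lemma apply_edges_subset: "E \<subseteq> edges P \<Longrightarrow> B \<subseteq> edges P \<Longrightarrow> apply_edges k B E \<subseteq> edges P"
  by (cases k) auto

text \<open>Insertions only add neighbors and endanger Invariant 1 alone; deletions only remove them
  and endanger Invariant 2 alone. At \<open>h = 0\<close> the deletion clause asks for Invariant 2
  at level 0, where it is vacuous.\<close>

lemma pre_visit_start:
  assumes P: "valid_params P" and "lds P E lv" and B: "B \<subseteq> edges P"
  shows "pre_visit P k 0 {} (apply_edges k B E) lv"
proof -
  have E: "E \<subseteq> edges P" and i: "lv v < nlevels P" "inv1 P E lv v" "inv2_at P E lv v (lv v)"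
    if "v < nverts P" for v
    using assms that by (auto simp: lds_def inv2_def)
  have E: "E \<subseteq> edges P" using assms by (auto simp: lds_def)
  show ?thesis
  proof (cases k)
    case Insertion
    have "inv2 P (E \<union> B) lv v" if "v < nverts P" for v
      unfolding inv2_def by (rule inv2_at_weaken[OF i(3)[OF that]]) (use E B in auto)
    then show ?thesis using i Insertion by (simp add: pre_visit_def)
  next
    case Deletion
    have "inv1 P (E - B) lv v" if "v < nverts P" for v
      by (rule inv1_weaken[OF P i(2)[OF that] E]) auto
    then show ?thesis using i Deletion by (simp add: pre_visit_def)
  qed
qed

lemma pre_visit_done:
  assumes "pre_visit P k h M E lv" "nlevels P \<le> h" "E \<subseteq> edges P"
  shows "lds P E lv"
proof (cases k)
  case Insertion
  then show ?thesis using assms by (fastforce simp: pre_visit_def lds_def)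
next
  case Deletion
  then have "\<forall>v<nverts P. lv v < nlevels P \<and> inv1 P E lv v \<and> inv2_at P E lv v (min (lv v) h)"
    using assms by (simp add: pre_visit_def)
  moreover have "min (lv v) h = lv v" if "lv v < nlevels P" for v
    using that assms(2) by simp
  ultimately show ?thesis using assms(3) by (metis lds_def inv2_def)
qed

lemma visiting_done: "visiting P k h {} M E lv \<Longrightarrow> pre_visit P k (Suc h) M E lv"
  by (cases k) (auto simp: visiting_def pre_visit_def less_Suc_eq less_Suc_eq_le)

lemma visiting_insert: "visiting P k h T M E lv \<Longrightarrow> v \<in> T \<Longrightarrow> visiting P k h T (insert v M) E lv"
  by (cases k) (auto simp: visiting_def)

lemma desire_level_props:
  assumes P: "valid_params P" and E: "E \<subseteq> edges P" and i: "\<not> inv2 P E lv v"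
  defines "d \<equiv> desire_level P E lv v"
  shows "d < lv v" "inv2_at P E lv v d" "\<not> inv2_at P E lv v (Suc d)"
    "\<And>h. h < lv v \<Longrightarrow> inv2_at P E lv v h \<Longrightarrow> h \<le> d"
proof -
  let ?S = "{d. d < lv v \<and> inv2_at P E lv v d}"
  have "0 < lv v" using i by (cases "lv v") (auto simp: inv2_def)
  then have ne: "0 \<in> ?S" by simp
  have "d \<in> ?S"
    unfolding d_def desire_level_def using ne by (intro Max_in) auto
  then show d: "d < lv v" "inv2_at P E lv v d" by auto
  show ub: "h \<le> d" if "h < lv v" "inv2_at P E lv v h" for h
    unfolding d_def desire_level_def using that by (intro Max_ge) auto
  show "\<not> inv2_at P E lv v (Suc d)"
    using ub[of "Suc d"] d i unfolding inv2_def by (metis Suc_n_not_le_n Suc_lessI)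
qed

text \<open>For deletions, a vertex above \<open>h\<close> that violates Invariant 2 has a desire
  level of at least \<open>h\<close>. It is unmarked, since marked vertices lie below
  \<open>h\<close>; so if it does not move now, its desire level is at least
  \<open>Suc h\<close>.\<close>

lemma visiting_enter:
  assumes P: "valid_params P" and E: "graph s \<subseteq> edges P"
    and pre: "pre_visit P k h {v. marked s v} (graph s) (level s)"
  shows "visiting P k h (movers P k h s) {v. marked s v} (graph s) (level s)"
proof (cases k)
  case Insertion
  then show ?thesis using pre by (auto simp: visiting_def pre_visit_def)
next
  case Deletion
  let ?i = "inv2_at P (graph s) (level s)"
  have "?i v (min (level s v) (Suc h))"
    if v: "v < nverts P" "v \<notin> movers P k h s" for v
  proof (cases "inv2 P (graph s) (level s) v")
    case True
    then show ?thesis using inv2_at_mono[OF P E min.cobounded1] by (simp add: inv2_def)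
  next
    case False
    have i: "?i v (min (level s v) h)" "marked s v \<Longrightarrow> level s v < h"
      using pre v Deletion by (auto simp: pre_visit_def)
    have lt: "h < level s v"
      using i(1) False unfolding inv2_def by (metis min.absorb1 not_le_imp_less)
    have "?i v h" using i lt by (simp add: min_def)
    with lt have "h \<le> desire_level P (graph s) (level s) v"
      by (rule desire_level_props(4)[OF P E False])
    moreover have "h \<noteq> desire_level P (graph s) (level s) v"
      using v False i(2) lt Deletion by auto
    ultimately have "Suc h \<le> desire_level P (graph s) (level s) v" by simp
    then have "?i v (Suc h)"
      using inv2_at_mono[OF P E] desire_level_props(2)[OF P E False] by blast
    then show ?thesis using lt by (simp add: min.absorb2 Suc_leI)
  qed
  moreover have "h < level s v \<and> ?i v h \<and> \<not> ?i v (Suc h)" if "v \<in> movers P k h s" for v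
    using that desire_level_props[OF P E, of "level s" v] Deletion by auto
  moreover have "v < nverts P" if "v \<in> movers P k h s" for v
    using that Deletion by auto
  ultimately show ?thesis using pre Deletion
    unfolding visiting_def pre_visit_def by (auto simp del: movers.simps intro: less_imp_le)
qed

text \<open>\<open>u\<close> goes from \<open>h\<close> to \<open>Suc h\<close>, so it counts as
  before in every neighbor set that starts at a level up to \<open>h\<close>. Hence the moves of one
  level do not influence one another, and their order can be arbitrary.\<close>

lemma visiting_move_up:
  assumes P: "valid_params P" and E: "E \<subseteq> edges P"
    and vis: "visiting P Insertion h T M E lv" and u: "u \<in> T"
  defines "lv' \<equiv> lv(u := Suc h)"
  shows "visiting P Insertion h (T - {u}) M E lv'"
proof -
  have T: "T = {v. v < nverts P \<and> lv v = h \<and> \<not> inv1 P E lv v}"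
    and i: "\<And>v. v < nverts P \<Longrightarrow> inv2_at P E lv v (lv v)"
      "\<And>v. v < nverts P \<Longrightarrow> lv v < h \<Longrightarrow> inv1 P E lv v" "\<And>v. v < nverts P \<Longrightarrow> lv v < nlevels P"
    using vis by (auto simp: visiting_def inv2_def)
  have u': "u < nverts P" "lv u = h" "\<not> inv1 P E lv u" using u T by auto
  have "Suc h < nlevels P" using not_inv1_below_top[OF P E u'(3)] i(3) u' by auto
  then have "lv' v < nlevels P" if "v < nverts P" for v using i(3) that by (simp add: lv'_def)
  moreover have "inv2 P E lv' v" if "v < nverts P" for v
  proof -
    have "inv2_at P E lv v (lv' v)"
      using not_inv1_inv2_at[OF P u'(3)] u' i(1)[OF that] by (simp add: lv'_def)
    then show ?thesis
      unfolding inv2_def using E by (rule inv2_at_weaken) (auto simp: lv'_def u')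
  qed
  moreover have eq: "inv1 P E lv' v \<longleftrightarrow> inv1 P E lv v" if "v \<noteq> u" "lv v \<le> h" for v
  proof -
    have "nbrs_from E lv' v (lv' v) = nbrs_from E lv v (lv v)" "lv' v = lv v"
      using that u' by (auto simp: lv'_def split: if_splits)
    then show ?thesis by (simp add: inv1_def)
  qed
  moreover have "T - {u} = {v. v < nverts P \<and> lv' v = h \<and> \<not> inv1 P E lv' v}"
  proof (intro set_eqI)
    fix v
    show "v \<in> T - {u} \<longleftrightarrow> v \<in> {v. v < nverts P \<and> lv' v = h \<and> \<not> inv1 P E lv' v}"
      using eq[of v] u' by (cases "v = u") (auto simp: T lv'_def)
  qed
  moreover have "inv1 P E lv' v" if "v < nverts P" "lv' v < h" for v
  proof -
    have "v \<noteq> u" "lv v < h" using that by (auto simp: lv'_def split: if_splits)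
    then show ?thesis using eq i(2) that(1) by simp
  qed
  ultimately show ?thesis unfolding visiting_def by simp
qed

text \<open>\<open>u\<close> comes from above \<open>h\<close> and stops at \<open>h\<close>, so the
  neighbor sets that start at a level up to \<open>h\<close> are unchanged.\<close>

lemma visiting_move_down:
  assumes P: "valid_params P" and E: "E \<subseteq> edges P"
    and vis: "visiting P Deletion h T M E lv" and u: "u \<in> T"
  defines "lv' \<equiv> lv(u := h)"
  shows "visiting P Deletion h (T - {u}) M E lv'"
proof -
  have T: "\<And>v. v \<in> T \<Longrightarrow> v < nverts P \<and> h < lv v \<and> inv2_at P E lv v h \<and> \<not> inv2_at P E lv v (Suc h)"
    and i: "\<And>v. v < nverts P \<Longrightarrow> inv1 P E lv v"
      "\<And>v. v < nverts P \<Longrightarrow> v \<notin> T \<Longrightarrow> inv2_at P E lv v (min (lv v) (Suc h))"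
      "\<And>v. v < nverts P \<Longrightarrow> lv v < nlevels P"
    and M: "\<And>v. v \<in> M - T \<Longrightarrow> lv v \<le> h"
    using vis by (auto simp: visiting_def)
  have le: "lv' v \<le> lv v" for v using T[OF u] by (simp add: lv'_def)
  \<comment> \<open>Invariant 2 at \<open>d\<close> looks at level \<open>d - 1\<close>, which is
    why \<open>Suc h\<close> is still covered.\<close>
  have eq: "inv2_at P E lv' v d \<longleftrightarrow> inv2_at P E lv v d" if "d \<le> Suc h" for v d
  proof -
    have "nbrs_from E lv' v (d - 1) = nbrs_from E lv v (d - 1)"
      using that T[OF u] by (auto simp: lv'_def split: if_splits)
    then show ?thesis by (simp add: inv2_at_def)
  qed
  have "lv' v < nlevels P" if "v < nverts P" for v
    using i(3)[OF that] le le_less_trans by blast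
  moreover have "v < nverts P \<and> h < lv' v \<and> inv2_at P E lv' v h \<and> \<not> inv2_at P E lv' v (Suc h)"
    if "v \<in> T - {u}" for v
    using T[of v] that by (auto simp: eq) (simp add: lv'_def)
  moreover have "inv1 P E lv' v" if "v < nverts P" for v
  proof (cases "v = u")
    case True
    then show ?thesis using T[OF u]
      by (intro not_inv2_at_inv1[OF P E, of lv]) (auto simp: lv'_def split: if_splits)
  next
    case False
    then show ?thesis using T[OF u]
      by (intro inv1_weaken[OF P i(1)[OF that] E]) (auto simp: lv'_def split: if_splits)
  qed
  moreover have "inv2_at P E lv' v (min (lv' v) (Suc h))" if "v < nverts P" "v \<notin> T - {u}" for v
    using that i(2)[of v] T[OF u] by (cases "v = u") (simp_all add: eq, simp_all add: lv'_def)
  moreover have "lv' v \<le> h" if "v \<in> M - (T - {u})" for v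
    using that M[of v] by (auto simp: lv'_def)
  ultimately show ?thesis unfolding visiting_def by simp
qed

lemma visiting_move:
  assumes "valid_params P" "E \<subseteq> edges P" "visiting P k h T M E lv" "u \<in> T"
  shows "visiting P k h (T - {u}) M E (lv(u := target k h))"
  using assms visiting_move_up visiting_move_down by (cases k) auto

text \<open>The invariant that fails now held before the batch, so the neighbor set concerned has
  gained (insertions) or lost (deletions) some \<open>w\<close>: either the edge itself belongs to
  the batch, or the level of \<open>w\<close> has changed, and then \<open>w\<close> lies exactly
  where \<open>triggers\<close> looks for it.\<close>

lemma move_cause:
  assumes P: "valid_params P" and lds: "lds P E lv\<^sub>0" and B: "B \<subseteq> edges P"
    and vis: "visiting P k h T M (apply_edges k B E) lv" and v: "v \<in> T" "lv v = lv\<^sub>0 v"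
  shows "v \<in> \<Union>B \<or> (\<exists>w. {v, w} \<in> apply_edges k B E \<and> lv w \<noteq> lv\<^sub>0 w
           \<and> (case k of Insertion \<Rightarrow> lv v \<le> lv w | Deletion \<Rightarrow> lv w + 1 < lv v))"
proof -
  have E: "E \<subseteq> edges P" using lds by (simp add: lds_def)
  have E': "apply_edges k B E \<subseteq> edges P" using apply_edges_subset E B .
  have n: "v < nverts P" using vis v(1) by (cases k) (auto simp: visiting_def)
  then have i: "inv1 P E lv\<^sub>0 v" "inv2 P E lv\<^sub>0 v" using lds by (auto simp: lds_def)
  show ?thesis
  proof (cases k)
    case Insertion
    then have "\<not> inv1 P (apply_edges k B E) lv v" using vis v(1) by (auto simp: visiting_def)
    then have "\<not> nbrs_from (apply_edges k B E) lv v (lv v) \<subseteq> nbrs_from E lv\<^sub>0 v (lv\<^sub>0 v)"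
      using inv1_weaken[OF P i(1) E] v(2) by fastforce
    then obtain w where w: "{v, w} \<in> apply_edges k B E" "lv v \<le> lv w"
        "{v, w} \<notin> E \<or> lv w \<noteq> lv\<^sub>0 w"
      unfolding subset_iff in_nbrs_from using v(2) by metis
    then show ?thesis using Insertion by auto
  next
    case Deletion
    then have "\<not> inv2_at P (apply_edges k B E) lv v (Suc h)" "Suc h \<le> lv v"
      using vis v(1) by (auto simp: visiting_def)
    then have "\<not> inv2_at P (apply_edges k B E) lv v (lv v)"
      using inv2_at_mono[OF P E'] by blast
    then have "\<not> nbrs_from E lv\<^sub>0 v (lv\<^sub>0 v - 1) \<subseteq> nbrs_from (apply_edges k B E) lv v (lv\<^sub>0 v - 1)"
      using inv2_at_weaken[OF i(2)[unfolded inv2_def] E'] v(2) by auto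
    then have "\<exists>w. {v, w} \<in> E \<and> lv\<^sub>0 v - 1 \<le> lv\<^sub>0 w \<and> ({v, w} \<in> B \<or> lv w < lv\<^sub>0 v - 1)"
      using Deletion by (auto simp: subset_iff not_le)
    then obtain w where w: "{v, w} \<in> E" "lv\<^sub>0 v - 1 \<le> lv\<^sub>0 w" "{v, w} \<in> B \<or> lv w < lv\<^sub>0 v - 1"
      by blast
    show ?thesis
    proof (cases "{v, w} \<in> B")
      case False
      then have "{v, w} \<in> apply_edges k B E" "lv w \<noteq> lv\<^sub>0 w" "lv w + 1 < lv v"
        using w v(2) Deletion by auto
      then show ?thesis using Deletion by auto
    qed auto
  qed
qed

section \<open>Invariants of a batch\<close>

abbreviation cur :: "'p state \<Rightarrow> vertex \<Rightarrow> desc option" where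
  "cur s \<equiv> heap s (batch_number s)"

abbreviation marked_set :: "'p state \<Rightarrow> vertex set" where
  "marked_set s \<equiv> {v. marked s v}"

lemma parent_rel_eq: "parent_rel s = prel (cur s)"
  by (simp add: parent_rel_def prel_def)

lemma is_root_eq: "is_root s r \<longleftrightarrow> rooted (cur s) r r"
  by (simp add: is_root_def rooted_def)

lemma root_of_eq: "root_of s v r \<longleftrightarrow> rooted (cur s) v r"
  by (simp add: root_of_def rooted_def parent_rel_eq is_root_def)

lemma same_dag_eq: "same_dag s v w \<longleftrightarrow> same_tree (cur s) v w"
  by (simp add: same_dag_def same_tree_def root_of_eq)

lemma put_desc_simps [simp]:
  "batch_number (put_desc v d s) = batch_number s" "graph (put_desc v d s) = graph s"
  "level (put_desc v d s) = level s" "desc_array (put_desc v d s) = desc_array s"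
  "phase (put_desc v d s) = phase s" "reader (put_desc v d s) = reader s"
  "heap (put_desc v d s) (batch_number s) = (cur s)(v \<mapsto> d)"
  "c \<noteq> batch_number s \<Longrightarrow> heap (put_desc v d s) c = heap s c"
  "marked (put_desc v d s) = marked s"
  by (simp_all add: put_desc_def marked_def fun_eq_iff)

lemma marked_simps [simp]:
  "marked (s\<lparr>batch_number := x1\<rparr>) = marked s" "marked (s\<lparr>graph := x2\<rparr>) = marked s"
  "marked (s\<lparr>level := x3\<rparr>) = marked s" "marked (s\<lparr>heap := x4\<rparr>) = marked s"
  "marked (s\<lparr>phase := x5\<rparr>) = marked s" "marked (s\<lparr>reader := x6\<rparr>) = marked s"
  "marked (s\<lparr>desc_array := D\<rparr>) = (\<lambda>v. D v \<noteq> None)"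
  by (simp_all add: marked_def fun_eq_iff)

section \<open>Unions of DAGs while marking is in progress\<close>

text \<open>\<open>M\<close> stands for the marked vertices, and \<open>U\<close> for the unions
  still owed by the vertices being marked. As parents lie in \<open>M\<close>, a read that follows a
  pointer arrives at a marked vertex. Two promises are maintained: every DAG contains an endpoint of
  a batch edge, and the endpoints of a batch edge lie in one DAG. For a vertex being marked, each of
  them is either fulfilled or owed through \<open>W\<close>.\<close>

definition dags_marking ::
  "edge set \<Rightarrow> (vertex \<Rightarrow> desc option) \<Rightarrow> vertex set \<Rightarrow> (vertex \<Rightarrow> vertex set option) \<Rightarrow> bool" where
  "dags_marking B F M U \<longleftrightarrow>
     dom F = M \<union> dom U \<and> M \<inter> dom U = {} \<and> Range (prel F) \<subseteq> M
   \<and> (\<forall>v w. {v, w} \<in> B \<longrightarrow> v \<in> dom U \<longrightarrow> w \<notin> dom U)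
   \<and> (\<forall>v W. U v = Some W \<longrightarrow> W \<subseteq> M)
   \<and> (\<forall>v W. U v = Some W \<longrightarrow> W \<noteq> {} \<or> (\<exists>y\<in>\<Union>B. same_tree F v y))
   \<and> (\<forall>v w W. U v = Some W \<longrightarrow> w \<in> M \<longrightarrow> {v, w} \<in> B \<longrightarrow> w \<in> W \<or> same_tree F v w)
   \<and> (\<forall>v. v \<in> M \<longrightarrow> (\<exists>y\<in>\<Union>B. same_tree F v y))
   \<and> (\<forall>v w. v \<in> M \<longrightarrow> w \<in> M \<longrightarrow> {v, w} \<in> B \<longrightarrow> same_tree F v w)"

definition dags_complete :: "edge set \<Rightarrow> (vertex \<Rightarrow> desc option) \<Rightarrow> bool" where
  "dags_complete B F \<longleftrightarrow>
     (\<forall>v\<in>dom F. \<exists>y\<in>\<Union>B. same_tree F v y)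
   \<and> (\<forall>v\<in>dom F. \<forall>w\<in>dom F. {v, w} \<in> B \<longrightarrow> same_tree F v w)"

lemma dags_markingD:
  assumes "dags_marking B F M U"
  shows "dom F = M \<union> dom U" "M \<inter> dom U = {}" "Range (prel F) \<subseteq> M"
    "{v, w} \<in> B \<Longrightarrow> v \<in> dom U \<Longrightarrow> w \<notin> dom U"
    "U v = Some W \<Longrightarrow> W \<subseteq> M"
    "U v = Some W \<Longrightarrow> W \<noteq> {} \<or> (\<exists>y\<in>\<Union>B. same_tree F v y)"
    "U v = Some W \<Longrightarrow> w \<in> M \<Longrightarrow> {v, w} \<in> B \<Longrightarrow> w \<in> W \<or> same_tree F v w"
    "v \<in> M \<Longrightarrow> \<exists>y\<in>\<Union>B. same_tree F v y"
    "v \<in> M \<Longrightarrow> w \<in> M \<Longrightarrow> {v, w} \<in> B \<Longrightarrow> same_tree F v w"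
proof -
  note a = assms[unfolded dags_marking_def]
  show "dom F = M \<union> dom U" "M \<inter> dom U = {}" "Range (prel F) \<subseteq> M"
    using a by simp_all
  show "{v, w} \<in> B \<Longrightarrow> v \<in> dom U \<Longrightarrow> w \<notin> dom U" using a by iprover
  show "U v = Some W \<Longrightarrow> W \<subseteq> M" using a by iprover
  show "U v = Some W \<Longrightarrow> W \<noteq> {} \<or> (\<exists>y\<in>\<Union>B. same_tree F v y)" using a by iprover
  have "\<forall>v w W. U v = Some W \<longrightarrow> w \<in> M \<longrightarrow> {v, w} \<in> B \<longrightarrow> w \<in> W \<or> same_tree F v w"
    using a by (elim conjE)
  then show "U v = Some W \<Longrightarrow> w \<in> M \<Longrightarrow> {v, w} \<in> B \<Longrightarrow> w \<in> W \<or> same_tree F v w" by simp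
  show "v \<in> M \<Longrightarrow> \<exists>y\<in>\<Union>B. same_tree F v y" using a by iprover
  show "v \<in> M \<Longrightarrow> w \<in> M \<Longrightarrow> {v, w} \<in> B \<Longrightarrow> same_tree F v w" using a by iprover
qed

lemma dags_markingI:
  assumes "dom F = M \<union> dom U" "M \<inter> dom U = {}" "Range (prel F) \<subseteq> M"
    "\<And>v w. {v, w} \<in> B \<Longrightarrow> v \<in> dom U \<Longrightarrow> w \<notin> dom U"
    "\<And>v W. U v = Some W \<Longrightarrow> W \<subseteq> M"
    "\<And>v W. U v = Some W \<Longrightarrow> W \<noteq> {} \<or> (\<exists>y\<in>\<Union>B. same_tree F v y)"
    "\<And>v W w. U v = Some W \<Longrightarrow> w \<in> M \<Longrightarrow> {v, w} \<in> B \<Longrightarrow> w \<in> W \<or> same_tree F v w"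
    "\<And>v. v \<in> M \<Longrightarrow> \<exists>y\<in>\<Union>B. same_tree F v y"
    "\<And>v w. v \<in> M \<Longrightarrow> w \<in> M \<Longrightarrow> {v, w} \<in> B \<Longrightarrow> same_tree F v w"
  shows "dags_marking B F M U"
  unfolding dags_marking_def by (intro conjI allI impI; rule assms; assumption)

lemma dags_marking_empty [simp]: "dags_marking B Map.empty {} Map.empty"
  by (simp add: dags_marking_def prel_def)

lemma dags_marking_complete: "dags_marking B F M Map.empty \<Longrightarrow> dags_complete B F"
  by (simp add: dags_marking_def dags_complete_def)

lemma dags_marking_mono:
  assumes dm: "dags_marking B F M U" and F': "dom F' = dom F" "Range (prel F') \<subseteq> M"
    and le: "\<And>v w. same_tree F v w \<Longrightarrow> same_tree F' v w"
  shows "dags_marking B F' M U"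
proof (rule dags_markingI)
  show "dom F' = M \<union> dom U" using dags_markingD(1)[OF dm] F' by simp
  show "\<exists>y\<in>\<Union>B. same_tree F' v y" if "v \<in> M" for v
    using dags_markingD(8)[OF dm that] le by blast
  show "W \<noteq> {} \<or> (\<exists>y\<in>\<Union>B. same_tree F' v y)" if "U v = Some W" for v W
    using dags_markingD(6)[OF dm that] le by blast
  show "w \<in> W \<or> same_tree F' v w" if "U v = Some W" "w \<in> M" "{v, w} \<in> B" for v w W
    using dags_markingD(7)[OF dm that] le by blast
  show "same_tree F' v w" if "v \<in> M" "w \<in> M" "{v, w} \<in> B" for v w
    using dags_markingD(9)[OF dm that] le by blast
qed (use dags_markingD(2,4,5)[OF dm] F' in auto)

lemma dags_complete_mono:
  assumes "dags_complete B F" "dom F' = dom F" "\<And>v w. same_tree F v w \<Longrightarrow> same_tree F' v w"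
  shows "dags_complete B F'"
  using assms unfolding dags_complete_def by metis

text \<open>Batch neighbors of \<open>v\<close> that are marked are owed a union by
  \<open>W\<close>, and none is being marked at this moment. That \<open>W\<close> is nonempty or
  \<open>v\<close> lies on a batch edge is provided by \<open>move_cause\<close>; in the second case
  \<open>v\<close> itself is the required endpoint.\<close>

lemma dags_marking_begin:
  assumes dm: "dags_marking B F M U" and F: "forest n F" and B: "B \<subseteq> edges P"
    and v: "v \<notin> M" "U v = None" "v < n" and U: "\<forall>w\<in>dom U. {v, w} \<notin> B"
    and W: "W \<subseteq> M" "\<forall>w\<in>M. {v, w} \<in> B \<longrightarrow> w \<in> W" "W \<noteq> {} \<or> v \<in> \<Union>B" and d: "parent d = None"
  shows "dags_marking B (F(v \<mapsto> d)) M (U(v \<mapsto> W))"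
proof -
  have Fv: "F v = None" using dm v by (auto simp: dags_marking_def)
  note ff = fresh_forest[OF F Fv v(3) refl d]
  have ne: "w \<noteq> v" if "{v, w} \<in> B" for w using edgesD that B by blast
  have U': "{w, v} \<notin> B" if "w \<in> dom U" for w using U that by (metis insert_commute)
  show ?thesis
  proof (rule dags_markingI)
    show "dom (F(v \<mapsto> d)) = M \<union> dom (U(v \<mapsto> W))" "M \<inter> dom (U(v \<mapsto> W)) = {}"
        "Range (prel (F(v \<mapsto> d))) \<subseteq> M"
      using dags_markingD(1-3)[OF dm] v ff(2) by auto
    show "w' \<notin> dom (U(v \<mapsto> W))" if "{v', w'} \<in> B" "v' \<in> dom (U(v \<mapsto> W))" for v' w'
    proof -
      have "v' = v \<or> v' \<in> dom U" "w' = v \<Longrightarrow> v' \<noteq> v" using that ne by auto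
      then show ?thesis using dags_markingD(4)[OF dm that(1)] that(1) U U' by auto
    qed
    show "\<exists>y\<in>\<Union>B. same_tree (F(v \<mapsto> d)) v' y" if "v' \<in> M" for v'
      using dags_markingD(8)[OF dm that] ff(4) by blast
    show "same_tree (F(v \<mapsto> d)) v' w" if "v' \<in> M" "w \<in> M" "{v', w} \<in> B" for v' w
      using dags_markingD(9)[OF dm that] ff(4) by blast
    fix v' W' assume a: "(U(v \<mapsto> W)) v' = Some W'"
    show "W' \<subseteq> M" using a dags_markingD(5)[OF dm, of v' W'] W(1) by (auto split: if_splits)
    show "W' \<noteq> {} \<or> (\<exists>y\<in>\<Union>B. same_tree (F(v \<mapsto> d)) v' y)"
    proof (cases "v' = v")
      case True
      then show ?thesis using a W(3) ff(5) by (metis fun_upd_same option.inject)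
    next
      case False
      then show ?thesis using a dags_markingD(6)[OF dm, of v' W'] ff(4) by fastforce
    qed
    show "w \<in> W' \<or> same_tree (F(v \<mapsto> d)) v' w" if "w \<in> M" "{v', w} \<in> B" for w
      using a dags_markingD(7)[OF dm, of v' W' w] W(2) ff(4) that by (auto split: if_splits)
  qed
qed

text \<open>If \<open>w\<close> was owed, it is marked, so the tree of \<open>w\<close>, which
  \<open>v\<close> has joined, already touches a batch edge. This makes up for the loss of
  \<open>w\<close> from the set.\<close>

lemma dags_marking_union:
  assumes dm: "dags_marking B F M U" and U: "U v = Some W" and w: "same_tree F v w"
  shows "dags_marking B F M (U(v \<mapsto> W - {w}))"
proof -
  have dom: "dom (U(v \<mapsto> W - {w})) = dom U" using U by auto
  show ?thesis
  proof (rule dags_markingI)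
    fix v' W' assume a: "(U(v \<mapsto> W - {w})) v' = Some W'"
    show "W' \<subseteq> M"
      using a dags_markingD(5)[OF dm U] dags_markingD(5)[OF dm, of v' W'] by (auto split: if_splits)
    show "w' \<in> W' \<or> same_tree F v' w'" if "w' \<in> M" "{v', w'} \<in> B" for w'
      using a that w dags_markingD(7)[OF dm U, of w'] dags_markingD(7)[OF dm, of v' W' w']
      by (auto split: if_splits)
    show "W' \<noteq> {} \<or> (\<exists>y\<in>\<Union>B. same_tree F v' y)"
    proof (cases "v' = v")
      case True
      have "\<exists>y\<in>\<Union>B. same_tree F v y" if "w \<in> W"
        using dags_markingD(5)[OF dm U] dags_markingD(8)[OF dm, of w] that w same_tree_trans by blast
      moreover have "W' = W" if "w \<notin> W" using a True that by auto
      ultimately show ?thesis using dags_markingD(6)[OF dm U] True by auto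
    next
      case False
      then show ?thesis using a dags_markingD(6)[OF dm, of v' W'] by auto
    qed
  next
    show "dom F = M \<union> dom (U(v \<mapsto> W - {w}))" "M \<inter> dom (U(v \<mapsto> W - {w})) = {}"
      unfolding dom by (fact dags_markingD(1,2)[OF dm])+
    show "w' \<notin> dom (U(v \<mapsto> W - {w}))" if "{v', w'} \<in> B" "v' \<in> dom (U(v \<mapsto> W - {w}))" for v' w'
      using dags_markingD(4)[OF dm] that unfolding dom .
  qed (fact dags_markingD(3,8,9)[OF dm])+
qed

text \<open>With an empty set, \<open>v\<close> is united with all its marked batch neighbors, and
  no other vertex being marked is a batch neighbor of it, so no batch edge at \<open>v\<close>
  escapes.\<close>

lemma dags_marking_end:
  assumes dm: "dags_marking B F M U" and U: "U v = Some {}" and F: "forest n F" and B: "B \<subseteq> edges P"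
  shows "dags_marking B F (insert v M) (U(v := None))"
proof -
  have 1: "{v, w} \<in> B \<Longrightarrow> w \<in> M \<Longrightarrow> same_tree F v w" for w
    using dags_markingD(7)[OF dm U] by auto
  then have 2: "{w, v} \<in> B \<Longrightarrow> w \<in> M \<Longrightarrow> same_tree F w v" for w
    by (metis insert_commute same_tree_sym)
  have 3: "{v', v} \<notin> B" if "v' \<in> dom U" for v'
    using dags_markingD(4)[OF dm, of v' v] U that by auto
  have 4: "{v, v} \<notin> B" using B edgesD by blast
  have 5: "\<exists>y\<in>\<Union>B. same_tree F v y" using dags_markingD(6)[OF dm U] by auto
  have 6: "v \<in> dom U" using U by auto
  show ?thesis
  proof (rule dags_markingI)
    show "dom F = insert v M \<union> dom (U(v := None))" "insert v M \<inter> dom (U(v := None)) = {}"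
        "Range (prel F) \<subseteq> insert v M"
      using 6 dags_markingD(1-3)[OF dm] by auto
    show "w \<notin> dom (U(v := None))" if "{v', w} \<in> B" "v' \<in> dom (U(v := None))" for v' w
      using that dags_markingD(4)[OF dm that(1)] by auto
    show "\<exists>y\<in>\<Union>B. same_tree F v' y" if "v' \<in> insert v M" for v'
      using 5 dags_markingD(8)[OF dm] that by auto
    show "same_tree F v' w" if "v' \<in> insert v M" "w \<in> insert v M" "{v', w} \<in> B" for v' w
      using 1 2 4 dags_markingD(9)[OF dm] that by auto
    fix v' W assume a: "(U(v := None)) v' = Some W"
    then have a': "U v' = Some W" by (auto split: if_splits)
    show "W \<subseteq> insert v M" "W \<noteq> {} \<or> (\<exists>y\<in>\<Union>B. same_tree F v' y)"
      using dags_markingD(5,6)[OF dm a'] by auto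
    have "{v', v} \<notin> B" using 3 a' by auto
    then show "w \<in> W \<or> same_tree F v' w" if "w \<in> insert v M" "{v', w} \<in> B" for w
      using dags_markingD(7)[OF dm a'] that by auto
  qed
qed

text \<open>The phases in which the levels of the latest batch are final; \<open>Quiet\<close> is
  included, so that the interval between two batches belongs to the earlier one.\<close>

definition post :: "'p state \<Rightarrow> bool" where
  "post s \<longleftrightarrow> phase s \<in> {Quiet, Unmark_Roots, Unmark_Rest}"

lemma post_cases:
  obtains k B where "phase s = Edges k B" "\<not> post s"
  | k B h T U where "phase s = Visit k B h T U" "\<not> post s"
  | "post s"
  by (cases "phase s") (auto simp: post_def)

text \<open>
  In the invariants of a batch, \<open>E\<^sub>0\<close> and \<open>lv\<^sub>0\<close> are the graph and the levels before the batch.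
\<close>

definition frame ::
  "params \<Rightarrow> edge set \<Rightarrow> graph \<Rightarrow> (vertex \<Rightarrow> nat) \<Rightarrow> 'p state \<Rightarrow> bool" where
  "frame P B E\<^sub>0 lv\<^sub>0 s \<longleftrightarrow>
     lds P E\<^sub>0 lv\<^sub>0 \<and> B \<subseteq> edges P \<and> forest (nverts P) (cur s)
   \<and> (\<forall>c>batch_number s. heap s c = Map.empty)
   \<and> (\<forall>v c. desc_array s v = Some c \<longrightarrow> c = batch_number s \<and> v \<in> dom (cur s))
   \<and> (\<forall>v d. cur s v = Some d \<longrightarrow> old_level d = lv\<^sub>0 v)
   \<and> (\<forall>v. cur s v = None \<longrightarrow> level s v = lv\<^sub>0 v)"

text \<open>The last two clauses record that roots are unmarked first. They are what makes an
  unmarked entry evidence of the release of its DAG.\<close>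

definition phase_inv ::
  "params \<Rightarrow> kind \<Rightarrow> edge set \<Rightarrow> graph \<Rightarrow> (vertex \<Rightarrow> nat) \<Rightarrow> 'p state \<Rightarrow> bool" where
  "phase_inv P k B E\<^sub>0 lv\<^sub>0 s \<longleftrightarrow>
     (case phase s of
        Edges k' B' \<Rightarrow> k' = k \<and> B' = B \<and> graph s = E\<^sub>0 \<and> cur s = Map.empty
      | Visit k' B' h T U \<Rightarrow> k' = k \<and> B' = B \<and> graph s = apply_edges k B E\<^sub>0 \<and> h < nlevels P
          \<and> dom U \<subseteq> T \<and> visiting P k h T (marked_set s) (graph s) (level s)
          \<and> dags_marking B (cur s) (marked_set s) U
          \<and> (\<forall>v. \<not> marked s v \<longrightarrow> level s v = lv\<^sub>0 v)
      | _ \<Rightarrow> graph s = apply_edges k B E\<^sub>0 \<and> lds P (graph s) (level s) \<and> dags_complete B (cur s))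
   \<and> (phase s = Quiet \<longrightarrow> (\<forall>v. \<not> marked s v))
   \<and> (phase s = Unmark_Roots \<longrightarrow> (\<forall>v\<in>dom (cur s). \<not> rooted (cur s) v v \<longrightarrow> marked s v))
   \<and> (phase s = Unmark_Rest \<longrightarrow> (\<forall>v. rooted (cur s) v v \<longrightarrow> \<not> marked s v))"

definition binv ::
  "params \<Rightarrow> kind \<Rightarrow> edge set \<Rightarrow> graph \<Rightarrow> (vertex \<Rightarrow> nat) \<Rightarrow> 'p state \<Rightarrow> bool" where
  "binv P k B E\<^sub>0 lv\<^sub>0 s \<longleftrightarrow> frame P B E\<^sub>0 lv\<^sub>0 s \<and> phase_inv P k B E\<^sub>0 lv\<^sub>0 s"

text \<open>The initial state looks like the end of an empty batch.\<close>

lemma binv_initial: "initial P s \<Longrightarrow> binv P Insertion {} (graph s) (level s) s"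
  by (auto simp: initial_def binv_def frame_def phase_inv_def lds_def forest_def prel_def
      dags_complete_def marked_def acyclic_def)

lemma frame_cong:
  "frame P B E\<^sub>0 lv\<^sub>0 s \<Longrightarrow> batch_number s' = batch_number s \<Longrightarrow> heap s' = heap s \<Longrightarrow>
   level s' = level s \<Longrightarrow> (\<And>v c. desc_array s' v = Some c \<Longrightarrow> desc_array s v = Some c) \<Longrightarrow>
   frame P B E\<^sub>0 lv\<^sub>0 s'"
  unfolding frame_def by (simp, blast)

lemma binv_start:
  assumes "binv P k\<^sub>0 B\<^sub>0 E\<^sub>0 lv\<^sub>0 s" "step P s (Start_Batch k B) s'"
  shows "binv P k B (graph s) (level s) s'" "batch_number s' = Suc (batch_number s)"
proof -
  have s: "phase s = Quiet" "B \<subseteq> edges P"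
      "s' = s\<lparr>batch_number := Suc (batch_number s), phase := Edges k B\<rparr>"
    using assms(2) by (auto elim: step.cases)
  show "batch_number s' = Suc (batch_number s)" using s by simp
  have "lds P (graph s) (level s)" "\<forall>v. desc_array s v = None" "\<forall>c>batch_number s. heap s c = Map.empty"
    using assms(1) s(1) by (auto simp: binv_def frame_def phase_inv_def marked_def)
  moreover have "forest (nverts P) Map.empty" by (simp add: forest_def prel_def acyclic_def)
  ultimately show "binv P k B (graph s) (level s) s'"
    using s by (simp add: binv_def frame_def phase_inv_def)
qed

lemma nlevels_pos: "valid_params P \<Longrightarrow> 0 < nlevels P"
  using nverts_le_power_logn[of P] by (cases "logn P") (auto simp: nlevels_def valid_params_def)

lemma marked_heap: "binv P k B E\<^sub>0 lv\<^sub>0 s \<Longrightarrow> marked s v \<Longrightarrow> v \<in> dom (cur s)"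
  by (auto simp: binv_def frame_def marked_def)

lemma enter_level_simps [simp]:
  "batch_number (enter_level P k B h s) = batch_number s" "graph (enter_level P k B h s) = graph s"
  "level (enter_level P k B h s) = level s" "desc_array (enter_level P k B h s) = desc_array s"
  "heap (enter_level P k B h s) = heap s" "reader (enter_level P k B h s) = reader s"
  "phase (enter_level P k B h s) = Visit k B h (movers P k h s) Map.empty"
  "marked (enter_level P k B h s) = marked s"
  by (simp_all add: enter_level_def)

lemma binv_visit:
  assumes "binv P k B E\<^sub>0 lv\<^sub>0 s" "phase s = Visit k' B' h T U"
  shows "k' = k" "B' = B" "graph s = apply_edges k B E\<^sub>0" "h < nlevels P" "dom U \<subseteq> T"
    "visiting P k h T (marked_set s) (graph s) (level s)"
    "dags_marking B (cur s) (marked_set s) U" "\<And>v. \<not> marked s v \<Longrightarrow> level s v = lv\<^sub>0 v"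
    "E\<^sub>0 \<subseteq> edges P" "B \<subseteq> edges P" "graph s \<subseteq> edges P" "lds P E\<^sub>0 lv\<^sub>0" "forest (nverts P) (cur s)"
    "T \<subseteq> {..<nverts P}"
proof -
  show r: "k' = k" "B' = B" "graph s = apply_edges k B E\<^sub>0" "h < nlevels P" "dom U \<subseteq> T"
    "visiting P k h T (marked_set s) (graph s) (level s)"
    "dags_marking B (cur s) (marked_set s) U" "\<And>v. \<not> marked s v \<Longrightarrow> level s v = lv\<^sub>0 v"
    "E\<^sub>0 \<subseteq> edges P" "B \<subseteq> edges P" "lds P E\<^sub>0 lv\<^sub>0" "forest (nverts P) (cur s)"
    using assms by (auto simp: binv_def frame_def phase_inv_def lds_def)
  then show "graph s \<subseteq> edges P" using apply_edges_subset by metis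
  show "T \<subseteq> {..<nverts P}" using r(6) by (cases k) (auto simp: visiting_def)
qed

lemma phase_inv_visitI:
  assumes "phase s = Visit k B h T U" "graph s = apply_edges k B E\<^sub>0" "h < nlevels P" "dom U \<subseteq> T"
    "visiting P k h T (marked_set s) (graph s) (level s)"
    "dags_marking B (cur s) (marked_set s) U" "\<And>v. \<not> marked s v \<Longrightarrow> level s v = lv\<^sub>0 v"
  shows "phase_inv P k B E\<^sub>0 lv\<^sub>0 s"
  using assms by (simp add: phase_inv_def)

lemma binv_postD:
  assumes "binv P k B E\<^sub>0 lv\<^sub>0 s" "post s"
  shows "graph s = apply_edges k B E\<^sub>0" "lds P (graph s) (level s)" "dags_complete B (cur s)"
  using assms by (auto simp: binv_def phase_inv_def post_def)

text \<open>What one moment of a batch guarantees for all later moments of it. As no vertex becomes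
  a root again, a root found at the end of a traversal was one already when its mark was seen.
  Before unmarking the marks only grow, and afterwards they only shrink, with everything else that
  reads depend on frozen.\<close>

definition later :: "'p state \<Rightarrow> 'p state \<Rightarrow> bool" where
  "later s s' \<longleftrightarrow> batch_number s' = batch_number s \<and> dom (cur s) \<subseteq> dom (cur s')
     \<and> (\<forall>v w. same_tree (cur s) v w \<longrightarrow> same_tree (cur s') v w)
     \<and> (\<forall>v\<in>dom (cur s). rooted (cur s') v v \<longrightarrow> rooted (cur s) v v)
     \<and> (post s \<longrightarrow> post s' \<and> graph s' = graph s \<and> level s' = level s \<and> rooted (cur s') = rooted (cur s)
          \<and> marked_set s' \<subseteq> marked_set s)
     \<and> (\<not> post s' \<longrightarrow> marked_set s \<subseteq> marked_set s')"

lemma later_refl: "later s s"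
  by (simp add: later_def)

lemma later_trans: "later s s' \<Longrightarrow> later s' s'' \<Longrightarrow> later s s''"
  unfolding later_def by (elim conjE, intro conjI) (simp | blast | metis subset_trans)+

lemma later_cong:
  "batch_number s' = batch_number s \<Longrightarrow> heap s' = heap s \<Longrightarrow>
   (post s \<Longrightarrow> post s' \<and> graph s' = graph s \<and> level s' = level s \<and> marked_set s' \<subseteq> marked_set s) \<Longrightarrow>
   (\<not> post s' \<Longrightarrow> marked_set s \<subseteq> marked_set s') \<Longrightarrow> later s s'"
  by (simp add: later_def)

text \<open>In both linking cases the new parent is marked, by the rule of \<open>winner\<close> or
  by the assumption on \<open>r'\<close>; so parents stay marked throughout.\<close>

lemma unite_cases:
  assumes P: "valid_params P" and r: "rooted (cur s) v r" "rooted (cur s) w r'" and m: "marked s r'"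
  obtains "unite P r r' s = s" "same_tree (cur s) v w"
  | "unite P r r' s = set_parent r' r s" "r \<noteq> r'" "marked s r"
  | "unite P r r' s = set_parent r r' s" "r \<noteq> r'"
proof -
  have "winner P s r r' = r \<Longrightarrow> r \<noteq> r' \<Longrightarrow> marked s r"
    by (auto simp: winner_def split: if_splits)
  then show thesis
    using that r unfolding unite_def by (metis same_tree_def)
qed

lemma cur_set_parent:
  "heap (set_parent v w s) (batch_number s) = (cur s)(v \<mapsto> (the (cur s v))\<lparr>parent := Some w\<rparr>)"
  by (simp add: set_parent_def)

lemma set_parent_simps [simp]:
  "batch_number (set_parent v w s) = batch_number s" "graph (set_parent v w s) = graph s"
  "level (set_parent v w s) = level s" "desc_array (set_parent v w s) = desc_array s"
  "phase (set_parent v w s) = phase s" "reader (set_parent v w s) = reader s"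
  "c \<noteq> batch_number s \<Longrightarrow> heap (set_parent v w s) c = heap s c"
  "marked (set_parent v w s) = marked s"
  by (simp_all add: set_parent_def)

lemma frame_put_desc:
  assumes f: "frame P B E\<^sub>0 lv\<^sub>0 s" and F: "forest (nverts P) ((cur s)(v \<mapsto> d))"
    and d: "old_level d = lv\<^sub>0 v"
  shows "frame P B E\<^sub>0 lv\<^sub>0 (put_desc v d s)"
proof -
  show ?thesis
    unfolding frame_def put_desc_simps
  proof (intro conjI allI impI)
    fix x c assume "desc_array s x = Some c"
    then have "c = batch_number s" "x \<in> dom (cur s)" using f unfolding frame_def by blast+
    then show "c = batch_number s" "x \<in> dom ((cur s)(v \<mapsto> d))" by auto
  next
    fix c assume "batch_number s < c"
    then show "heap (put_desc v d s) c = Map.empty" using f by (simp add: frame_def)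
  qed (use f F d in \<open>auto simp: frame_def split: if_splits\<close>)
qed

lemma frame_set_parent:
  assumes f: "frame P B E\<^sub>0 lv\<^sub>0 s" and F: "forest (nverts P) (cur (set_parent v w s))"
    and v: "v \<in> dom (cur s)"
  shows "frame P B E\<^sub>0 lv\<^sub>0 (set_parent v w s)"
proof -
  obtain d where d: "cur s v = Some d" using v by auto
  then have "old_level d = lv\<^sub>0 v" using f by (simp add: frame_def)
  then show ?thesis
    using f F d unfolding set_parent_def by (intro frame_put_desc) auto
qed

lemma later_growing:
  assumes "\<not> post s" "\<not> post s'" "batch_number s' = batch_number s" "dom (cur s) \<subseteq> dom (cur s')"
    "\<And>v w. same_tree (cur s) v w \<Longrightarrow> same_tree (cur s') v w"
    "\<And>v. v \<in> dom (cur s) \<Longrightarrow> rooted (cur s') v v \<Longrightarrow> rooted (cur s) v v"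
    "marked_set s \<subseteq> marked_set s'"
  shows "later s s'"
  using assms unfolding later_def by simp

section \<open>Preservation of the invariant by the steps of a batch\<close>

lemma step_change_edges:
  assumes P: "valid_params P" and inv: "binv P k B E\<^sub>0 lv\<^sub>0 s" and ph: "phase s = Edges k' B'"
    and s': "s' = enter_level P k' B' 0 (s\<lparr>graph := apply_edges k' B' (graph s)\<rparr>)"
  shows "binv P k B E\<^sub>0 lv\<^sub>0 s'" "later s s'"
proof -
  have f: "frame P B E\<^sub>0 lv\<^sub>0 s" and k: "k' = k" "B' = B" "graph s = E\<^sub>0" "cur s = Map.empty"
    using inv ph by (auto simp: binv_def phase_inv_def)
  let ?s = "s\<lparr>graph := apply_edges k B E\<^sub>0\<rparr>"
  have m: "marked_set s = {}" and lv: "level s = lv\<^sub>0" and B: "B \<subseteq> edges P" and l: "lds P E\<^sub>0 lv\<^sub>0"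
    using f k by (auto simp: frame_def marked_def)
  have "apply_edges k B E\<^sub>0 \<subseteq> edges P"
    using apply_edges_subset l B by (auto simp: lds_def)
  then have "visiting P k 0 (movers P k 0 ?s) {v. marked ?s v} (graph ?s) (level ?s)"
    using pre_visit_start[OF P l B, of k] m lv by (intro visiting_enter[OF P]) simp_all
  then have "phase_inv P k B E\<^sub>0 lv\<^sub>0 s'"
    using m lv k nlevels_pos[OF P] unfolding s'
    by (intro phase_inv_visitI[where U = Map.empty]) (simp_all del: movers.simps)
  moreover have "frame P B E\<^sub>0 lv\<^sub>0 s'"
    using f by (rule frame_cong) (simp_all add: s')
  ultimately show "binv P k B E\<^sub>0 lv\<^sub>0 s'" by (simp add: binv_def)
  show "later s s'" using ph by (intro later_cong) (simp_all add: s' post_def)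
qed

lemma step_mark_begin:
  assumes P: "valid_params P" and inv: "binv P k B E\<^sub>0 lv\<^sub>0 s" and ph: "phase s = Visit k' B' h T U"
    and v: "v \<in> T" "\<not> marked s v" "U v = None" "\<forall>w\<in>dom U. {v, w} \<notin> B'"
    and W: "W = marked_batch_neighbors B' s v \<union> triggers k' s v"
    and s': "s' = (put_desc v \<lparr>parent = None, old_level = level s v\<rparr> s)
       \<lparr>phase := Visit k' B' h T (U(v \<mapsto> W))\<rparr>"
  shows "binv P k B E\<^sub>0 lv\<^sub>0 s'" "later s s'"
proof -
  note i = binv_visit[OF inv ph]
  have f: "frame P B E\<^sub>0 lv\<^sub>0 s" using inv by (simp add: binv_def)
  have Fv: "cur s v = None" using dags_markingD(1)[OF i(7)] v by auto
  have n: "v < nverts P" using i(14) v by auto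
  have lv: "level s v = lv\<^sub>0 v" using i(8) v by simp
  define d where "d = \<lparr>parent = None, old_level = level s v\<rparr>"
  have d: "parent d = None" "old_level d = lv\<^sub>0 v" by (auto simp: d_def lv)
  note ff = fresh_forest[OF i(13) Fv n refl d(1)]
  have cur': "cur s' = (cur s)(v \<mapsto> d)" by (simp add: s' d_def)
  \<comment> \<open>Off the batch edges, \<open>v\<close> has a neighbor whose level has changed;
    only marked vertices have changed their level, so this neighbor is a trigger.\<close>
  have "W \<noteq> {} \<or> v \<in> \<Union>B"
  proof (rule disjCI)
    assume "v \<notin> \<Union>B"
    then obtain w where w: "{v, w} \<in> graph s" "level s w \<noteq> lv\<^sub>0 w"
        "case k of Insertion \<Rightarrow> level s v \<le> level s w | Deletion \<Rightarrow> level s w + 1 < level s v"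
      using move_cause[OF P i(12,10) i(6)[unfolded i(3)] v(1) lv] i(3) by auto
    then have "w \<in> triggers k s v"
      using i(8)[of w] by (cases k) auto
    then show "W \<noteq> {}" using W i(1) by auto
  qed
  moreover have "W \<subseteq> marked_set s" "\<forall>w\<in>marked_set s. {v, w} \<in> B \<longrightarrow> w \<in> W"
    using W i(2) by (cases k'; auto simp: marked_batch_neighbors_def)+
  ultimately have dm: "dags_marking B (cur s') (marked_set s) (U(v \<mapsto> W))"
    unfolding cur' using v i(2) n d by (intro dags_marking_begin[OF i(7,13,10)]) auto
  have "phase_inv P k B E\<^sub>0 lv\<^sub>0 s'"
  proof (rule phase_inv_visitI)
    show "phase s' = Visit k B h T (U(v \<mapsto> W))" using i by (simp add: s')
    show "dags_marking B (cur s') (marked_set s') (U(v \<mapsto> W))" using dm by (simp add: s')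
    show "dom (U(v \<mapsto> W)) \<subseteq> T" using i(5) v(1) by auto
  qed (use i in \<open>simp_all add: s'\<close>)
  moreover have "frame P B E\<^sub>0 lv\<^sub>0 s'"
    by (rule frame_cong[OF frame_put_desc[OF f ff(1) d(2)]]) (simp_all add: s' d_def)
  ultimately show "binv P k B E\<^sub>0 lv\<^sub>0 s'" by (simp add: binv_def)
  show "later s s'"
  proof (rule later_growing)
    show "same_tree (cur s') x y" if "same_tree (cur s) x y" for x y
      using ff(4) that cur' by simp
    show "rooted (cur s) x x" if "x \<in> dom (cur s)" "rooted (cur s') x x" for x
      using that Fv by (auto simp: rooted_def cur' split: if_splits)
  qed (use ph in \<open>auto simp: post_def s'\<close>)
qed

lemma root_marked:
  assumes "dags_marking B F M U" "w \<in> M" "rooted F w r"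
  shows "r \<in> M"
  using assms(3) dags_markingD(3)[OF assms(1)] assms(2)
  unfolding rooted_def by (metis Range.intros rtranclE subsetD)

lemma step_mark_union:
  assumes P: "valid_params P" and inv: "binv P k B E\<^sub>0 lv\<^sub>0 s" and ph: "phase s = Visit k' B' h T U"
    and U: "U v = Some W" "w \<in> W" and r: "root_of s v r" "root_of s w r'"
    and s': "s' = (unite P r r' s)\<lparr>phase := Visit k' B' h T (U(v \<mapsto> W - {w}))\<rparr>"
  shows "binv P k B E\<^sub>0 lv\<^sub>0 s'" "later s s'"
proof -
  note i = binv_visit[OF inv ph]
  have f: "frame P B E\<^sub>0 lv\<^sub>0 s" using inv by (simp add: binv_def)
  have w: "marked s w" using dags_markingD(5)[OF i(7) U(1)] U(2) by auto
  have vw: "v \<noteq> w" using dags_markingD(2)[OF i(7)] U(1) w by auto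
  have rr: "rooted (cur s) v r" "rooted (cur s) w r'" using r by (simp_all add: root_of_eq)
  have m: "marked s r'" using root_marked[OF i(7) _ rr(2)] w by simp
  have main: "frame P B E\<^sub>0 lv\<^sub>0 (unite P r r' s)
      \<and> dags_marking B (cur (unite P r r' s)) (marked_set s) U
      \<and> same_tree (cur (unite P r r' s)) v w \<and> later s s'
      \<and> batch_number (unite P r r' s) = batch_number s \<and> graph (unite P r r' s) = graph s
      \<and> level (unite P r r' s) = level s \<and> marked (unite P r r' s) = marked s"
  proof -
    \<comment> \<open>Both directions of linking at once: the root \<open>c\<close> of
      \<open>x\<close> becomes a child of the root \<open>p\<close> of \<open>y\<close>, where
      \<open>x\<close> and \<open>y\<close> are \<open>v\<close> and \<open>w\<close> in some
      order.\<close>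
    have *: ?thesis
      if u: "unite P r r' s = set_parent c p s" and c: "rooted (cur s) x c" "x \<in> {v, w}"
        and p: "rooted (cur s) y p" "y \<in> {v, w}" and cp: "p \<noteq> c" "marked s p" "x \<noteq> y" for c p x y
    proof -
      let ?F = "heap (set_parent c p s) (batch_number s)"
      note ff = link_forest[OF i(13) p(1) c(1) cp(1) cur_set_parent]
      have cd: "c \<in> dom (cur s)" using rooted_dom[OF c(1)] by auto
      have dom: "dom ?F = dom (cur s)"
        using cd by (auto simp: cur_set_parent)
      have "same_tree ?F x c" "same_tree ?F y p"
        using ff(4) rooted_same_tree p(1) c(1) by blast+
      then have "same_tree ?F x y"
        using ff(5) same_tree_trans same_tree_sym by blast
      then have same: "same_tree ?F v w"
        using c(2) p(2) cp(3) same_tree_sym by auto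
      have dm: "dags_marking B ?F (marked_set s) U"
        using ff(2,4) dom cp(2) dags_markingD(3)[OF i(7)]
        by (intro dags_marking_mono[OF i(7)]) auto
      have "later s s'"
      proof (rule later_growing)
        show "rooted (cur s) z z" if "z \<in> dom (cur s)" "rooted (cur s') z z" for z
          using that ff(2) by (auto simp: s' u rooted_def cur_set_parent split: if_splits)
        show "same_tree (cur s') z z'" if "same_tree (cur s) z z'" for z z'
          using that ff(4) by (simp add: s' u)
      qed (use ph dom in \<open>simp_all add: s' u post_def\<close>)
      then show ?thesis
        using u dm same frame_set_parent[OF f _ cd] ff(1) by simp
    qed
    show ?thesis
    proof (rule unite_cases[OF P rr m])
      assume a: "unite P r r' s = s" "same_tree (cur s) v w"
      have "later s s'" using a ph by (intro later_cong) (simp_all add: s' post_def)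
      then show ?thesis using a f i(7) by simp
    next
      assume "unite P r r' s = set_parent r' r s" "r \<noteq> r'" "marked s r"
      then show ?thesis using *[OF _ rr(2) _ rr(1)] vw by simp
    next
      assume "unite P r r' s = set_parent r r' s" "r \<noteq> r'"
      then show ?thesis using *[OF _ rr(1) _ rr(2)] vw m by simp
    qed
  qed
  have dm: "dags_marking B (cur s') (marked_set s) (U(v \<mapsto> W - {w}))"
  proof -
    have "dags_marking B (cur (unite P r r' s)) (marked_set s) U"
        "same_tree (cur (unite P r r' s)) v w"
      using main by blast+
    from dags_marking_union[OF this(1) U(1) this(2)] show ?thesis by (simp add: s')
  qed
  have "phase_inv P k B E\<^sub>0 lv\<^sub>0 s'"
  proof (rule phase_inv_visitI)
    show "phase s' = Visit k B h T (U(v \<mapsto> W - {w}))" using i by (simp add: s')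
    show "dags_marking B (cur s') (marked_set s') (U(v \<mapsto> W - {w}))" using dm main by (simp add: s')
    show "dom (U(v \<mapsto> W - {w})) \<subseteq> T" using i(5) U(1) by auto
  qed (use i main in \<open>simp_all add: s'\<close>)
  moreover have "frame P B E\<^sub>0 lv\<^sub>0 s'"
  proof -
    have "frame P B E\<^sub>0 lv\<^sub>0 (unite P r r' s)" using main by blast
    then show ?thesis by (rule frame_cong) (simp_all add: s')
  qed
  ultimately show "binv P k B E\<^sub>0 lv\<^sub>0 s'" by (simp add: binv_def)
  show "later s s'" using main by blast
qed

lemma step_mark_end:
  assumes inv: "binv P k B E\<^sub>0 lv\<^sub>0 s" and ph: "phase s = Visit k' B' h T U" and U: "U v = Some {}"
    and s': "s' = s\<lparr>desc_array := (desc_array s)(v \<mapsto> batch_number s),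
                phase := Visit k' B' h T (U(v := None))\<rparr>"
  shows "binv P k B E\<^sub>0 lv\<^sub>0 s'" "later s s'"
proof -
  note i = binv_visit[OF inv ph]
  have f: "frame P B E\<^sub>0 lv\<^sub>0 s" using inv by (simp add: binv_def)
  have m: "marked_set s' = insert v (marked_set s)" by (auto simp: s' marked_def)
  have v: "v \<in> dom (cur s)" "v \<in> T" using dags_markingD(1)[OF i(7)] U i(5) by auto
  have "phase_inv P k B E\<^sub>0 lv\<^sub>0 s'"
  proof (rule phase_inv_visitI)
    show "phase s' = Visit k B h T (U(v := None))" using i by (simp add: s')
    show "dags_marking B (cur s') (marked_set s') (U(v := None))"
      using dags_marking_end[OF i(7) U i(13,10)] m by (simp add: s')
    show "visiting P k h T (marked_set s') (graph s') (level s')"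
      using visiting_insert[OF i(6) v(2)] unfolding m by (simp add: s')
    show "level s' x = lv\<^sub>0 x" if "\<not> marked s' x" for x
      using that i(8)[of x] by (simp add: s' marked_def split: if_splits)
    show "dom (U(v := None)) \<subseteq> T" using i(5) by auto
  qed (use i in \<open>simp_all add: s'\<close>)
  moreover have "frame P B E\<^sub>0 lv\<^sub>0 s'"
    unfolding frame_def
  proof (intro conjI allI impI)
    fix x c assume "desc_array s' x = Some c"
    then have "x = v \<and> c = batch_number s \<or> desc_array s x = Some c"
      by (auto simp: s' split: if_splits)
    then show "c = batch_number s'" "x \<in> dom (cur s')"
      using f v unfolding frame_def by (auto simp: s')
  qed (use f in \<open>simp_all add: frame_def s'\<close>)
  ultimately show "binv P k B E\<^sub>0 lv\<^sub>0 s'" by (simp add: binv_def)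
  show "later s s'" using ph m by (intro later_cong) (auto simp: s' post_def)
qed

lemma step_move:
  assumes P: "valid_params P" and inv: "binv P k B E\<^sub>0 lv\<^sub>0 s" and ph: "phase s = Visit k' B' h T U"
    and v: "v \<in> T" "marked s v"
    and s': "s' = s\<lparr>level := (level s)(v := target k' h), phase := Visit k' B' h (T - {v}) U\<rparr>"
  shows "binv P k B E\<^sub>0 lv\<^sub>0 s'" "later s s'"
proof -
  note i = binv_visit[OF inv ph]
  have f: "frame P B E\<^sub>0 lv\<^sub>0 s" using inv by (simp add: binv_def)
  have "phase_inv P k B E\<^sub>0 lv\<^sub>0 s'"
  proof (rule phase_inv_visitI)
    show "phase s' = Visit k B h (T - {v}) U" using i by (simp add: s')
    show "visiting P k h (T - {v}) (marked_set s') (graph s') (level s')"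
      using visiting_move[OF P i(11,6) v(1)] i(1) by (simp add: s')
    show "dom U \<subseteq> T - {v}" using i(5) dags_markingD(2)[OF i(7)] v(2) by auto
    show "level s' x = lv\<^sub>0 x" if "\<not> marked s' x" for x
      using that i(8)[of x] v(2) by (auto simp: s')
  qed (use i in \<open>simp_all add: s'\<close>)
  moreover have "frame P B E\<^sub>0 lv\<^sub>0 s'"
    using f marked_heap[OF inv v(2)] unfolding frame_def s' by auto
  ultimately show "binv P k B E\<^sub>0 lv\<^sub>0 s'" by (simp add: binv_def)
  show "later s s'" using ph by (intro later_cong) (simp_all add: s' post_def)
qed

lemma step_next_level:
  assumes P: "valid_params P" and inv: "binv P k B E\<^sub>0 lv\<^sub>0 s"
    and ph: "phase s = Visit k' B' h {} Map.empty" and h: "Suc h < nlevels P"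
    and s': "s' = enter_level P k' B' (Suc h) s"
  shows "binv P k B E\<^sub>0 lv\<^sub>0 s'" "later s s'"
proof -
  note i = binv_visit[OF inv ph]
  have f: "frame P B E\<^sub>0 lv\<^sub>0 s" using inv by (simp add: binv_def)
  have "phase_inv P k B E\<^sub>0 lv\<^sub>0 s'"
  proof (rule phase_inv_visitI)
    show "phase s' = Visit k B (Suc h) (movers P k (Suc h) s) Map.empty" using i by (simp add: s')
    show "visiting P k (Suc h) (movers P k (Suc h) s) (marked_set s') (graph s') (level s')"
      using visiting_enter[OF P i(11) visiting_done[OF i(6)]] by (simp add: s')
  qed (use i h in \<open>simp_all add: s'\<close>)
  moreover have "frame P B E\<^sub>0 lv\<^sub>0 s'"
    using f by (rule frame_cong) (simp_all add: s')
  ultimately show "binv P k B E\<^sub>0 lv\<^sub>0 s'" by (simp add: binv_def)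
  show "later s s'" using ph by (intro later_cong) (simp_all add: s' post_def)
qed

lemma step_levels_done:
  assumes inv: "binv P k B E\<^sub>0 lv\<^sub>0 s"
    and ph: "phase s = Visit k' B' h {} Map.empty" and h: "\<not> Suc h < nlevels P"
    and s': "s' = s\<lparr>phase := Unmark_Roots\<rparr>"
  shows "binv P k B E\<^sub>0 lv\<^sub>0 s'" "later s s'"
proof -
  note i = binv_visit[OF inv ph]
  have f: "frame P B E\<^sub>0 lv\<^sub>0 s" using inv by (simp add: binv_def)
  have "lds P (graph s) (level s)"
    using pre_visit_done[OF visiting_done[OF i(6)] _ i(11)] h by simp
  then have "phase_inv P k B E\<^sub>0 lv\<^sub>0 s'"
    using i dags_marking_complete[OF i(7)] dags_markingD(1)[OF i(7)]
    by (auto simp: phase_inv_def s')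
  moreover have "frame P B E\<^sub>0 lv\<^sub>0 s'"
    using f by (rule frame_cong) (simp_all add: s')
  ultimately show "binv P k B E\<^sub>0 lv\<^sub>0 s'" by (simp add: binv_def)
  show "later s s'" using ph by (intro later_cong) (simp_all add: s' post_def)
qed

lemma step_post:
  assumes inv: "binv P k B E\<^sub>0 lv\<^sub>0 s" and po: "post s" "post s'"
    and eq: "batch_number s' = batch_number s" "heap s' = heap s" "level s' = level s"
      "graph s' = graph s" "\<And>v. desc_array s' v \<in> {desc_array s v, None}"
    and ph: "phase s' = Quiet \<Longrightarrow> \<forall>v. \<not> marked s' v"
      "phase s' = Unmark_Roots \<Longrightarrow> \<forall>v\<in>dom (cur s). \<not> rooted (cur s) v v \<longrightarrow> marked s' v"
      "phase s' = Unmark_Rest \<Longrightarrow> \<forall>v. rooted (cur s) v v \<longrightarrow> \<not> marked s' v"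
  shows "binv P k B E\<^sub>0 lv\<^sub>0 s'" "later s s'"
proof -
  have f: "frame P B E\<^sub>0 lv\<^sub>0 s" using inv by (simp add: binv_def)
  have da: "desc_array s v = Some c" if "desc_array s' v = Some c" for v c
    using eq(5)[of v] that by auto
  have "phase_inv P k B E\<^sub>0 lv\<^sub>0 s'"
    using binv_postD[OF inv po(1)] po(2) eq ph by (auto simp: phase_inv_def post_def)
  moreover have "frame P B E\<^sub>0 lv\<^sub>0 s'"
    using f eq(1-3) da by (rule frame_cong)
  ultimately show "binv P k B E\<^sub>0 lv\<^sub>0 s'" by (simp add: binv_def)
  show "later s s'" using da po eq by (intro later_cong) (auto simp: marked_def)
qed

lemma work_inv:
  assumes P: "valid_params P" and inv: "binv P k B E\<^sub>0 lv\<^sub>0 s" and w: "work P s s'"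
  shows "binv P k B E\<^sub>0 lv\<^sub>0 s' \<and> later s s'"
  using w
proof cases
  case change_edges
  then show ?thesis by (intro conjI step_change_edges[OF P inv]) assumption+
next
  case mark_begin
  then show ?thesis by (intro conjI step_mark_begin[OF P inv]) assumption+
next
  case mark_union
  then show ?thesis by (intro conjI step_mark_union[OF P inv]) assumption+
next
  case mark_end
  then show ?thesis by (intro conjI step_mark_end[OF inv]) assumption+
next
  case move
  then show ?thesis by (intro conjI step_move[OF P inv]) assumption+
next
  case next_level
  then show ?thesis by (intro conjI step_next_level[OF P inv]) assumption+
next
  case levels_done
  then show ?thesis by (intro conjI step_levels_done[OF inv]) assumption+
next
  case (unmark_root v)
  moreover have "\<forall>x\<in>dom (cur s). \<not> rooted (cur s) x x \<longrightarrow> marked s x"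
    using inv unmark_root by (simp add: binv_def phase_inv_def)
  ultimately show ?thesis
    by (intro conjI step_post[OF inv]) (auto simp: post_def is_root_eq marked_def)
next
  case roots_done
  then show ?thesis
    by (intro conjI step_post[OF inv]) (auto simp: post_def is_root_eq)
next
  case (unmark_rest v)
  moreover have "\<forall>x. rooted (cur s) x x \<longrightarrow> \<not> marked s x"
    using inv unmark_rest by (simp add: binv_def phase_inv_def)
  ultimately show ?thesis
    by (intro conjI step_post[OF inv]) (auto simp: post_def marked_def)
qed

lemma binv_reader [simp]: "binv P k B E\<^sub>0 lv\<^sub>0 (s\<lparr>reader := R\<rparr>) \<longleftrightarrow> binv P k B E\<^sub>0 lv\<^sub>0 s"
  by (simp add: binv_def frame_def phase_inv_def split: phase.split)

lemma later_reader: "later s (s\<lparr>reader := R\<rparr>)"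
  by (rule later_cong) (simp_all add: post_def)

lemma step_compress:
  assumes inv: "binv P k B E\<^sub>0 lv\<^sub>0 s" and vu: "(v, u) \<in> parent_rel s" "(u, a) \<in> (parent_rel s)\<^sup>+"
  shows "binv P k B E\<^sub>0 lv\<^sub>0 (set_parent v a s)" "later s (set_parent v a s)"
proof -
  let ?s = "set_parent v a s"
  have f: "frame P B E\<^sub>0 lv\<^sub>0 s" and ph: "phase_inv P k B E\<^sub>0 lv\<^sub>0 s"
    using inv by (simp_all add: binv_def)
  have "forest (nverts P) (cur s)" using f by (simp add: frame_def)
  note ff = compress_forest[OF this vu[unfolded parent_rel_eq] cur_set_parent]
  have v: "v \<in> dom (cur s)" using vu(1) by (auto simp: parent_rel_eq prel_def)
  have dom: "dom (cur ?s) = dom (cur s)" using v by (auto simp: cur_set_parent)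
  have "Range (prel (cur ?s)) \<subseteq> Range (prel (cur s))"
    using Range_mono[OF ff(2)] by simp
  then have dm: "dags_marking B (cur ?s) M U" if "dags_marking B (cur s) M U" for M U
    using ff(5) dom dags_markingD(3)[OF that] by (intro dags_marking_mono[OF that]) auto
  have dc: "dags_complete B (cur ?s)" if "dags_complete B (cur s)"
    using ff(5) dom by (intro dags_complete_mono[OF that]) auto
  have ne: "cur ?s \<noteq> Map.empty" "cur s \<noteq> Map.empty" using dom v by auto
  have "phase_inv P k B E\<^sub>0 lv\<^sub>0 ?s"
    using ph dm dc dom ff(4) ne unfolding phase_inv_def by (auto split: phase.splits)
  moreover have "frame P B E\<^sub>0 lv\<^sub>0 ?s"
    using frame_set_parent[OF f _ v] ff(1) by simp
  ultimately show "binv P k B E\<^sub>0 lv\<^sub>0 ?s" by (simp add: binv_def)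
  show "later s ?s"
    using ff(4,5) dom by (simp add: later_def post_def)
qed

lemma step_inv:
  assumes P: "valid_params P" and inv: "binv P k B E\<^sub>0 lv\<^sub>0 s" and st: "step P s a s'"
    and a: "\<And>k B. a \<noteq> Start_Batch k B"
  shows "binv P k B E\<^sub>0 lv\<^sub>0 s' \<and> later s s'"
  using st
proof cases
  case work
  then show ?thesis using work_inv[OF P inv] by simp
next
  case end_batch
  then show ?thesis by (intro conjI step_post[OF inv]) (auto simp: post_def)
next
  case compress
  then show ?thesis using step_compress[OF inv] by blast
qed (use inv later_refl later_reader a in simp_all)

section \<open>Reads\<close>

lemma laterD:
  assumes "later s s'"
  shows "batch_number s' = batch_number s" "v \<in> dom (cur s) \<Longrightarrow> v \<in> dom (cur s')"
    "same_tree (cur s) v w \<Longrightarrow> same_tree (cur s') v w"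
    "v \<in> dom (cur s) \<Longrightarrow> rooted (cur s') v v \<Longrightarrow> rooted (cur s) v v"
    "post s \<Longrightarrow> post s'" "post s \<Longrightarrow> graph s' = graph s" "post s \<Longrightarrow> level s' = level s"
    "post s \<Longrightarrow> rooted (cur s') = rooted (cur s)"
    "post s \<Longrightarrow> marked s' v \<Longrightarrow> marked s v" "\<not> post s' \<Longrightarrow> marked s v \<Longrightarrow> marked s' v"
proof -
  note a = assms[unfolded later_def]
  show "batch_number s' = batch_number s" using a by blast
  show "v \<in> dom (cur s) \<Longrightarrow> v \<in> dom (cur s')" using a by blast
  show "same_tree (cur s) v w \<Longrightarrow> same_tree (cur s') v w" using a by blast
  show "v \<in> dom (cur s) \<Longrightarrow> rooted (cur s') v v \<Longrightarrow> rooted (cur s) v v" using a by blast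
  show "post s \<Longrightarrow> post s'" "post s \<Longrightarrow> graph s' = graph s" "post s \<Longrightarrow> level s' = level s"
    "post s \<Longrightarrow> rooted (cur s') = rooted (cur s)"
    using a by argo+
  show "post s \<Longrightarrow> marked s' v \<Longrightarrow> marked s v" "\<not> post s' \<Longrightarrow> marked s v \<Longrightarrow> marked s' v"
    using a by blast+
qed

text \<open>A vertex without a descriptor has no root and counts as released as soon as unmarking
  begins; as it has not moved, its level is both the old and the new one.\<close>

definition released :: "'p state \<Rightarrow> vertex \<Rightarrow> bool" where
  "released s v \<longleftrightarrow> post s \<and> (\<forall>r. rooted (cur s) v r \<longrightarrow> \<not> marked s r)"

lemma released_later:
  "later s s' \<Longrightarrow> released s v \<Longrightarrow> released s' v \<and> level s' v = level s v"
  unfolding later_def released_def by auto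

text \<open>While roots are being unmarked, an unmarked vertex that has a descriptor must be a root
  itself; in the later phases all roots are unmarked.\<close>

lemma unmarked_released:
  assumes "binv P k B E\<^sub>0 lv\<^sub>0 s" "post s" "\<not> marked s v"
  shows "released s v"
proof -
  have "\<not> marked s r" if r: "rooted (cur s) v r" for r
  proof (cases "phase s = Unmark_Roots")
    case True
    then have "rooted (cur s) v v"
      using assms rooted_dom(1)[OF r] by (auto simp: binv_def phase_inv_def)
    then show ?thesis using rooted_unique r assms(3) by metis
  next
    case False
    have "rooted (cur s) r r" using r by (auto simp: rooted_def)
    then show ?thesis using assms False by (auto simp: binv_def phase_inv_def post_def)
  qed
  then show ?thesis using assms(2) by (simp add: released_def)
qed

lemma released_same_tree: "same_tree (cur s) v w \<Longrightarrow> released s v \<longleftrightarrow> released s w"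
  using same_tree_rooted unfolding released_def by metis

lemma unmarked_level:
  assumes "binv P k B E\<^sub>0 lv\<^sub>0 s" "\<not> post s" "\<not> marked s v"
  shows "level s v = lv\<^sub>0 v"
  using assms by (auto simp: binv_def frame_def phase_inv_def post_def split: phase.splits)

section \<open>Levels of the sequential execution and the invariant of a read\<close>

text \<open>The data of the latest batch that has started, with graph and levels from before it.
  They stay in force after its end until the next start, in step with \<open>batch_number\<close>;
  at first they are those of a fictitious empty batch.\<close>

fun base :: "(nat \<Rightarrow> 'p state) \<Rightarrow> (nat \<Rightarrow> 'p label) \<Rightarrow> nat \<Rightarrow> kind \<times> edge set \<times> graph \<times> (vertex \<Rightarrow> nat)"
  where
  "base \<sigma> l 0 = (Insertion, {}, graph (\<sigma> 0), level (\<sigma> 0))"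
| "base \<sigma> l (Suc t) =
     (case l t of Start_Batch k B \<Rightarrow> (k, B, graph (\<sigma> t), level (\<sigma> t)) | _ \<Rightarrow> base \<sigma> l t)"

definition base_level :: "(nat \<Rightarrow> 'p state) \<Rightarrow> (nat \<Rightarrow> 'p label) \<Rightarrow> nat \<Rightarrow> vertex \<Rightarrow> nat" where
  "base_level \<sigma> l t = snd (snd (snd (base \<sigma> l t)))"

text \<open>The level of \<open>v\<close> in the sequential execution just before step \<open>t\<close>.\<close>

definition seq_level :: "(nat \<Rightarrow> 'p state) \<Rightarrow> (nat \<Rightarrow> 'p label) \<Rightarrow> nat \<Rightarrow> vertex \<Rightarrow> nat" where
  "seq_level \<sigma> l t v = (if released (\<sigma> t) v then level (\<sigma> t) v else base_level \<sigma> l t v)"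

text \<open>\<open>t\<close> is the candidate for the linearization point. MARKED certifies that the
  old level is right at \<open>t\<close>; what UNMARKED certifies becomes sharper with the second
  reading of the level, hence the parameter \<open>Q\<close>.\<close>

definition status_ok ::
  "(nat \<Rightarrow> 'p state) \<Rightarrow> vertex \<Rightarrow> nat \<Rightarrow> ptr option \<Rightarrow> bool \<Rightarrow> nat \<Rightarrow> bool" where
  "status_ok \<sigma> v b st Q t \<longleftrightarrow> batch_number (\<sigma> t) = b \<and>
     (case st of
        Some d \<Rightarrow> d = (b, v) \<and> v \<in> dom (cur (\<sigma> t)) \<and> \<not> released (\<sigma> t) v
      | None \<Rightarrow> Q)"

text \<open>What is known of the running attempt is conditional on \<open>b\<close> being the
  present batch number, since otherwise the attempt will be discarded. The candidates are steps of
  the read itself, so they fall between invocation and response; the point is fixed at an access to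
  \<open>desc_array\<close>, before the outcome of the attempt is known.\<close>

definition read_inv ::
  "params \<Rightarrow> (nat \<Rightarrow> 'p state) \<Rightarrow> (nat \<Rightarrow> 'p label) \<Rightarrow> nat \<Rightarrow> 'p \<Rightarrow> vertex \<Rightarrow> nat \<Rightarrow> bool" where
  "read_inv P \<sigma> l i p v T \<longleftrightarrow>
     (let lin = (\<lambda>t. i < t \<and> t < T \<and> l t = Read_Step p) in
      case reader (\<sigma> T) p of
        R_Idle \<Rightarrow> False
      | R_Batch1 v' \<Rightarrow> v' = v
      | R_Level1 v' b \<Rightarrow> v' = v \<and> b \<le> batch_number (\<sigma> T)
      | R_Desc v' b h \<Rightarrow> v' = v \<and> b \<le> batch_number (\<sigma> T) \<and>
          (b = batch_number (\<sigma> T) \<longrightarrow> \<not> post (\<sigma> T) \<longrightarrow> \<not> marked (\<sigma> T) v \<longrightarrow> h = level (\<sigma> T) v)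
      | R_Parent v' b h d c \<Rightarrow> v' = v \<and> b \<le> batch_number (\<sigma> T) \<and>
          (b = batch_number (\<sigma> T) \<longrightarrow> d = (b, v) \<and> fst c = b \<and>
             (\<exists>t. lin t \<and> batch_number (\<sigma> t) = b \<and> same_tree (cur (\<sigma> t)) v (snd c)
                \<and> marked (\<sigma> t) (snd c)))
      | R_Lookup v' b h d u \<Rightarrow> v' = v \<and> b \<le> batch_number (\<sigma> T) \<and>
          (b = batch_number (\<sigma> T) \<longrightarrow> d = (b, v) \<and> same_tree (cur (\<sigma> T)) v u \<and>
             (\<not> post (\<sigma> T) \<longrightarrow> marked (\<sigma> T) u))
      | R_Level2 v' b h st \<Rightarrow> v' = v \<and> b \<le> batch_number (\<sigma> T) \<and>
          (b = batch_number (\<sigma> T) \<longrightarrow> 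
             (\<exists>t. lin t \<and> status_ok \<sigma> v b st (released (\<sigma> t) v \<or> seq_level \<sigma> l t v = h) t))
      | R_Batch2 v' b h st h' \<Rightarrow> v' = v \<and> b \<le> batch_number (\<sigma> T) \<and>
          (b = batch_number (\<sigma> T) \<longrightarrow> 
             (\<exists>t. lin t \<and> status_ok \<sigma> v b st (seq_level \<sigma> l t v \<in> {h, h'}) t))
      | R_Return x \<Rightarrow> \<exists>t. lin t \<and> x = coreness_estimate P (seq_level \<sigma> l t v))"

locale cplds_run =
  fixes P :: params and \<sigma> :: "nat \<Rightarrow> 'p state" and l :: "nat \<Rightarrow> 'p label"
  assumes valid: "valid_params P" and exec: "execution P \<sigma> l"
begin

lemma step_at: "step P (\<sigma> t) (l t) (\<sigma> (Suc t))"
  using exec by (simp add: execution_def)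

abbreviation starts :: "nat \<Rightarrow> bool" where
  "starts t \<equiv> \<exists>k B. l t = Start_Batch k B"

lemma base_cong: "\<not> starts t \<Longrightarrow> base \<sigma> l (Suc t) = base \<sigma> l t"
  by (cases "l t") auto

lemma binv_base: "case base \<sigma> l t of (k, B, E\<^sub>0, lv\<^sub>0) \<Rightarrow> binv P k B E\<^sub>0 lv\<^sub>0 (\<sigma> t)"
proof (induction t)
  case 0
  then show ?case using exec binv_initial by (auto simp: execution_def)
next
  case (Suc t)
  obtain k B E\<^sub>0 lv\<^sub>0 where b: "base \<sigma> l t = (k, B, E\<^sub>0, lv\<^sub>0)" by (metis prod_cases4)
  with Suc have inv: "binv P k B E\<^sub>0 lv\<^sub>0 (\<sigma> t)" by simp
  show ?case
  proof (cases "starts t")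
    case True
    then obtain k' B' where "l t = Start_Batch k' B'" by blast
    then show ?thesis using binv_start(1)[OF inv] step_at[of t] by simp
  next
    case False
    then show ?thesis
      using step_inv[OF valid inv step_at] base_cong b by auto
  qed
qed

lemma binv_at:
  obtains k B E\<^sub>0 where "base \<sigma> l t = (k, B, E\<^sub>0, base_level \<sigma> l t)"
    "binv P k B E\<^sub>0 (base_level \<sigma> l t) (\<sigma> t)"
  using binv_base[of t] that unfolding base_level_def by (cases "base \<sigma> l t") auto

lemma step_cases:
  obtains k B where "l t = Start_Batch k B" "batch_number (\<sigma> (Suc t)) = Suc (batch_number (\<sigma> t))"
  | "\<not> starts t" "later (\<sigma> t) (\<sigma> (Suc t))" "batch_number (\<sigma> (Suc t)) = batch_number (\<sigma> t)"
    "base \<sigma> l (Suc t) = base \<sigma> l t"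
proof (cases "starts t")
  case True
  then show thesis using that binv_start(2) step_at binv_at by metis
next
  case False
  then have "later (\<sigma> t) (\<sigma> (Suc t))" using step_inv[OF valid _ step_at] binv_at by metis
  then show thesis using that False base_cong by (auto simp: later_def)
qed

lemma batch_number_mono: "t \<le> t' \<Longrightarrow> batch_number (\<sigma> t) \<le> batch_number (\<sigma> t')"
proof (induction rule: dec_induct)
  case (step t')
  then show ?case by (cases rule: step_cases[of t']) auto
qed simp

lemma later_at:
  assumes "t \<le> t'" "batch_number (\<sigma> t) = batch_number (\<sigma> t')"
  shows "later (\<sigma> t) (\<sigma> t') \<and> base \<sigma> l t' = base \<sigma> l t"
  using assms
proof (induction rule: dec_induct)
  case base
  then show ?case by (simp add: later_refl)
next
  case (step t')
  have "batch_number (\<sigma> t) \<le> batch_number (\<sigma> t')" "batch_number (\<sigma> t') \<le> batch_number (\<sigma> (Suc t'))"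
    using batch_number_mono[of t t'] batch_number_mono[of t' "Suc t'"] step(1) by simp_all
  with step show ?case
    by (cases rule: step_cases[of t']) (auto intro: later_trans)
qed

lemma same_batch:
  assumes "t \<le> t'" "\<And>j. t \<le> j \<Longrightarrow> j < t' \<Longrightarrow> \<not> starts j"
  shows "batch_number (\<sigma> t) = batch_number (\<sigma> t')"
  using assms
proof (induction rule: dec_induct)
  case (step t')
  then show ?case by (cases rule: step_cases[of t']) auto
qed simp

lemma unmarked_seq_level:
  assumes "\<not> marked (\<sigma> t) v" shows "seq_level \<sigma> l t v = level (\<sigma> t) v"
proof -
  obtain k B E\<^sub>0 where inv: "binv P k B E\<^sub>0 (base_level \<sigma> l t) (\<sigma> t)" using binv_at by metis
  show ?thesis
    using unmarked_released[OF inv _ assms] unmarked_level[OF inv _ assms]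
    by (cases "post (\<sigma> t)") (auto simp: seq_level_def released_def)
qed

lemma released_level:
  assumes "t \<le> t'" "batch_number (\<sigma> t) = batch_number (\<sigma> t')" "released (\<sigma> t) v"
  shows "level (\<sigma> t') v = seq_level \<sigma> l t v"
  using later_at[OF assms(1,2)] released_later assms(3) by (auto simp: seq_level_def)

text \<open>Apart from the batch number, only the clauses for \<open>R_Desc\<close> and
  \<open>R_Lookup\<close> speak of the present state; the others refer to a past moment. These two
  are stable because trees only merge and marks are not removed before unmarking.\<close>

lemma read_inv_other:
  assumes inv: "read_inv P \<sigma> l i p v T" and same: "reader (\<sigma> (Suc T)) p = reader (\<sigma> T) p"
  shows "read_inv P \<sigma> l i p v (Suc T)"
proof -
  have le: "batch_number (\<sigma> T) \<le> batch_number (\<sigma> (Suc T))" by (rule batch_number_mono) simp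
  have eq: "batch_number (\<sigma> T) = batch_number (\<sigma> (Suc T)) \<and> later (\<sigma> T) (\<sigma> (Suc T))
      \<and> base \<sigma> l (Suc T) = base \<sigma> l T"
    if "b \<le> batch_number (\<sigma> T)" "b = batch_number (\<sigma> (Suc T))" for b
    using that le later_at[of T "Suc T"] by auto
  have lvl: "h = level (\<sigma> (Suc T)) v"
    if "b = batch_number (\<sigma> (Suc T))" "b \<le> batch_number (\<sigma> T)" "\<not> post (\<sigma> (Suc T))"
      "\<not> marked (\<sigma> (Suc T)) v"
      "b = batch_number (\<sigma> T) \<longrightarrow> \<not> post (\<sigma> T) \<longrightarrow> \<not> marked (\<sigma> T) v \<longrightarrow> h = level (\<sigma> T) v" for b h
  proof -
    note e = eq[OF that(2,1)]
    then have u: "\<not> post (\<sigma> T)" "\<not> marked (\<sigma> T) v"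
      using that(3,4) unfolding later_def by blast+
    obtain k B E\<^sub>0 where i: "binv P k B E\<^sub>0 (base_level \<sigma> l T) (\<sigma> T)"
      by (rule binv_at)
    obtain k' B' E\<^sub>0' where i': "binv P k' B' E\<^sub>0' (base_level \<sigma> l (Suc T)) (\<sigma> (Suc T))"
      by (rule binv_at)
    have "base_level \<sigma> l (Suc T) = base_level \<sigma> l T" using e by (simp add: base_level_def)
    then have "level (\<sigma> (Suc T)) v = level (\<sigma> T) v"
      using unmarked_level[OF i u] unmarked_level[OF i' that(3,4)] by simp
    then show ?thesis using that(1,5) u e by simp
  qed
  show ?thesis
  proof (cases "reader (\<sigma> T) p")
    case (R_Desc v' b h)
    then have "v' = v" "b \<le> batch_number (\<sigma> T)"
      "b = batch_number (\<sigma> T) \<longrightarrow> \<not> post (\<sigma> T) \<longrightarrow> \<not> marked (\<sigma> T) v \<longrightarrow> h = level (\<sigma> T) v"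
      using inv by (simp_all add: read_inv_def)
    then show ?thesis using R_Desc same le lvl[of b h] by (simp add: read_inv_def)
  next
    case (R_Parent v' b h d c)
    then show ?thesis using inv same le eq[of b] by (auto simp: read_inv_def intro: less_SucI)
  next
    case (R_Lookup v' b h d u)
    then have *: "v' = v" "b \<le> batch_number (\<sigma> T)"
      "b = batch_number (\<sigma> T) \<longrightarrow> d = (b, v) \<and> same_tree (cur (\<sigma> T)) v u \<and>
         (\<not> post (\<sigma> T) \<longrightarrow> marked (\<sigma> T) u)"
      using inv by (simp_all add: read_inv_def)
    have "d = (b, v) \<and> same_tree (cur (\<sigma> (Suc T))) v u \<and>
        (\<not> post (\<sigma> (Suc T)) \<longrightarrow> marked (\<sigma> (Suc T)) u)" if b: "b = batch_number (\<sigma> (Suc T))"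
    proof -
      note e = eq[OF *(2) b]
      have bT: "b = batch_number (\<sigma> T)" using b e by simp
      from e have la: "later (\<sigma> T) (\<sigma> (Suc T))" by blast
      have "same_tree (cur (\<sigma> (Suc T))) v u" using *(3) bT la unfolding later_def by blast
      moreover have "marked (\<sigma> (Suc T)) u" if "\<not> post (\<sigma> (Suc T))"
        using that *(3) bT la unfolding later_def by blast
      ultimately show ?thesis using *(3) bT by blast
    qed
    then show ?thesis using * R_Lookup same le by (simp add: read_inv_def)
  next
    case (R_Level2 v' b h st)
    then show ?thesis using inv same le eq[of b] by (auto simp: read_inv_def intro: less_SucI)
  next
    case (R_Batch2 v' b h st h')
    then show ?thesis using inv same le eq[of b] by (auto simp: read_inv_def intro: less_SucI)
  qed (use inv same le in \<open>auto simp: read_inv_def intro: less_SucI\<close>)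
qed

lemma read_inv_step:
  assumes inv: "read_inv P \<sigma> l i p v T" and iT: "i < T" and lT: "l T = Read_Step p"
  shows "read_inv P \<sigma> l i p v (Suc T)"
proof -
  obtain pc where pc: "read_next P (\<sigma> T) (reader (\<sigma> T) p) = Some pc"
      and s: "\<sigma> (Suc T) = (\<sigma> T)\<lparr>reader := (reader (\<sigma> T))(p := pc)\<rparr>"
    using step_at[of T] lT by (auto elim: step.cases)
  have pc': "reader (\<sigma> (Suc T)) p = pc" and bn: "batch_number (\<sigma> (Suc T)) = batch_number (\<sigma> T)"
    and hp: "cur (\<sigma> (Suc T)) = cur (\<sigma> T)" and ma: "marked (\<sigma> (Suc T)) = marked (\<sigma> T)"
    and po: "post (\<sigma> (Suc T)) = post (\<sigma> T)" and lv: "level (\<sigma> (Suc T)) = level (\<sigma> T)"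
    by (simp_all add: s post_def)
  obtain k B E\<^sub>0 where bi: "binv P k B E\<^sub>0 (base_level \<sigma> l T) (\<sigma> T)"
    using binv_at by metis
  then have fr: "frame P B E\<^sub>0 (base_level \<sigma> l T) (\<sigma> T)" by (simp add: binv_def)
  then have F: "forest (nverts P) (cur (\<sigma> T))" by (simp add: frame_def)
  have da: "desc_array (\<sigma> T) w = Some c \<Longrightarrow> c = batch_number (\<sigma> T) \<and> w \<in> dom (cur (\<sigma> T))" for w c
    using fr unfolding frame_def by blast
  show ?thesis
  proof (cases "reader (\<sigma> T) p")
    case (R_Batch1 v')
    then show ?thesis using inv pc pc' bn by (auto simp: read_inv_def)
  next
    case (R_Level1 v' b)
    then show ?thesis using inv pc pc' bn lv by (auto simp: read_inv_def)
  next
    case (R_Desc v' b h)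
    then have *: "v' = v" "b \<le> batch_number (\<sigma> T)"
      "b = batch_number (\<sigma> T) \<longrightarrow> \<not> post (\<sigma> T) \<longrightarrow> \<not> marked (\<sigma> T) v \<longrightarrow> h = level (\<sigma> T) v"
      using inv by (simp_all add: read_inv_def)
    show ?thesis
    proof (cases "desc_array (\<sigma> T) v")
      case None
      then have um: "\<not> marked (\<sigma> T) v" by (simp add: marked_def)
      \<comment> \<open>The point is \<open>T\<close> itself. Once unmarking has begun, an unmarked
        vertex is released; before that, it has not moved and the first level was read
        correctly.\<close>
      have "status_ok \<sigma> v b None (released (\<sigma> T) v \<or> seq_level \<sigma> l T v = h) T"
        if "b = batch_number (\<sigma> T)"
        using unmarked_released[OF bi _ um] unmarked_seq_level[OF um] *(3) um that
        by (auto simp: status_ok_def)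
      then show ?thesis using R_Desc None pc pc' * iT lT bn
        by (auto simp: read_inv_def intro!: exI[of _ T])
    next
      case (Some c)
      then have "c = batch_number (\<sigma> T)" "marked (\<sigma> T) v" "same_tree (cur (\<sigma> T)) v v"
        using da[OF Some] same_tree_refl[OF F] by (auto simp: marked_def)
      then show ?thesis using R_Desc Some pc pc' * iT lT bn
        by (auto simp: read_inv_def intro!: exI[of _ T])
    qed
  next
    case (R_Parent v' b h d c)
    then have *: "v' = v" "b \<le> batch_number (\<sigma> T)"
      using inv by (simp_all add: read_inv_def)
    have **: "d = (b, v) \<and> fst c = b \<and>
             (\<exists>t. i < t \<and> t < T \<and> l t = Read_Step p \<and> batch_number (\<sigma> t) = b
                \<and> same_tree (cur (\<sigma> t)) v (snd c) \<and> marked (\<sigma> t) (snd c))"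
      if "b = batch_number (\<sigma> T)"
      using R_Parent inv that by (auto simp: read_inv_def)
    show ?thesis
    proof (cases "parent (the (heap (\<sigma> T) (fst c) (snd c)))")
      case None
      \<comment> \<open>The point is the earlier moment \<open>t\<close> at which
        \<open>snd c\<close> was seen marked. Being a root now, it was the root of \<open>v\<close>
        at \<open>t\<close> as well, and its mark shows that \<open>v\<close> was not released
        then.\<close>
      have "\<exists>t. i < t \<and> t < Suc T \<and> l t = Read_Step p \<and> status_ok \<sigma> v b (Some d) (Q t) t"
        if b: "b = batch_number (\<sigma> T)" for Q
      proof -
        obtain t where t: "d = (b, v)" "fst c = b" "i < t" "t < T" "l t = Read_Step p"
          "batch_number (\<sigma> t) = b" "same_tree (cur (\<sigma> t)) v (snd c)" "marked (\<sigma> t) (snd c)"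
          using **[OF b] by blast
        have la: "later (\<sigma> t) (\<sigma> T)" using later_at[of t T] t b by simp
        have "snd c \<in> dom (cur (\<sigma> t))" using same_tree_dom[OF t(7)] by auto
        moreover from this have "rooted (cur (\<sigma> T)) (snd c) (snd c)"
          using None t(2) b laterD(2)[OF la] by (force simp: rooted_def)
        ultimately have "rooted (cur (\<sigma> t)) (snd c) (snd c)"
          using laterD(4)[OF la] by blast
        then have "rooted (cur (\<sigma> t)) v (snd c)" using same_tree_rooted[OF t(7)] by simp
        then have "\<not> released (\<sigma> t) v" using t(8) unfolding released_def by blast
        then have "status_ok \<sigma> v b (Some d) (Q t) t"
          using t(1,6) same_tree_dom[OF t(7)] by (simp add: status_ok_def domIff)
        then show ?thesis using t(3-5) less_SucI by blast
      qed
      from this[of "\<lambda>t. released (\<sigma> t) v \<or> seq_level \<sigma> l t v = h"]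
      show ?thesis using R_Parent None pc pc' * bn
        by (auto simp: read_inv_def)
    next
      case (Some u)
      have "d = (b, v) \<and> same_tree (cur (\<sigma> T)) v u \<and> (\<not> post (\<sigma> T) \<longrightarrow> marked (\<sigma> T) u)"
        if b: "b = batch_number (\<sigma> T)"
      proof -
        obtain t where t: "d = (b, v)" "fst c = b" "t < T"
          "batch_number (\<sigma> t) = b" "same_tree (cur (\<sigma> t)) v (snd c)"
          using **[OF b] by blast
        have la: "later (\<sigma> t) (\<sigma> T)" using later_at[of t T] t b by simp
        have vc: "same_tree (cur (\<sigma> T)) v (snd c)" by (rule laterD(3)[OF la t(5)])
        then obtain e where "cur (\<sigma> T) (snd c) = Some e" using same_tree_dom by blast
        then have cu: "(snd c, u) \<in> prel (cur (\<sigma> T))" using Some t(2) b by (auto simp: prel_def)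
        then have "same_tree (cur (\<sigma> T)) (snd c) u"
          using F rooted_exists[of _ _ u] rooted_step[of "snd c" u]
          unfolding same_tree_def forest_def by (meson Range.intros domIff r_into_rtrancl subsetD F)
        \<comment> \<open>Before unmarking, pointers exist only during the visits of levels, and
          there every parent is marked.\<close>
        moreover have "marked (\<sigma> T) u" if np: "\<not> post (\<sigma> T)"
        proof (cases rule: post_cases[of "\<sigma> T"])
          case (1 k' B')
          then have "cur (\<sigma> T) = Map.empty" using bi by (simp add: binv_def phase_inv_def)
          then show ?thesis using cu by (simp add: prel_def)
        next
          case (2 k' B' h T' U)
          then show ?thesis using dags_markingD(3)[OF binv_visit(7)[OF bi 2(1)]] cu by auto
        qed (use np in simp)
        ultimately show ?thesis using vc same_tree_trans t(1) by blast
      qed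
      then show ?thesis using R_Parent Some pc pc' * bn hp ma po
        by (auto simp: read_inv_def)
    qed
  next
    case (R_Lookup v' b h d u)
    then have *: "v' = v" "b \<le> batch_number (\<sigma> T)"
      "b = batch_number (\<sigma> T) \<longrightarrow> d = (b, v) \<and> same_tree (cur (\<sigma> T)) v u \<and>
         (\<not> post (\<sigma> T) \<longrightarrow> marked (\<sigma> T) u)"
      using inv by (simp_all add: read_inv_def)
    show ?thesis
    proof (cases "desc_array (\<sigma> T) u")
      case None
      then have um: "\<not> marked (\<sigma> T) u" by (simp add: marked_def)
      \<comment> \<open>An unmarked ancestor is possible only once unmarking has begun; then its
        DAG, which is also that of \<open>v\<close>, is released.\<close>
      have "status_ok \<sigma> v b None (released (\<sigma> T) v \<or> seq_level \<sigma> l T v = h) T"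
        if "b = batch_number (\<sigma> T)"
        using unmarked_released[OF bi _ um] released_same_tree[of "\<sigma> T" v u] *(3) um that
        by (auto simp: status_ok_def)
      then show ?thesis using R_Lookup None pc pc' * iT lT bn
        by (auto simp: read_inv_def intro!: exI[of _ T])
    next
      case (Some c)
      then have "c = batch_number (\<sigma> T)" "marked (\<sigma> T) u"
        using da[OF Some] by (auto simp: marked_def)
      then show ?thesis using R_Lookup Some pc pc' * iT lT bn
        by (auto simp: read_inv_def intro!: exI[of _ T])
    qed
  next
    case (R_Level2 v' b h st)
    then have *: "v' = v" "b \<le> batch_number (\<sigma> T)" using inv by (simp_all add: read_inv_def)
    have "\<exists>t. i < t \<and> t < Suc T \<and> l t = Read_Step p
        \<and> status_ok \<sigma> v b st (seq_level \<sigma> l t v \<in> {h, level (\<sigma> T) v}) t"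
      if b: "b = batch_number (\<sigma> T)"
    proof -
      obtain t where t: "i < t" "t < T" "l t = Read_Step p"
          "status_ok \<sigma> v b st (released (\<sigma> t) v \<or> seq_level \<sigma> l t v = h) t"
        using R_Level2 inv b by (auto simp: read_inv_def)
      \<comment> \<open>A released level is final for the batch, so the second reading returns it;
        otherwise the first reading was right.\<close>
      then have "released (\<sigma> t) v \<Longrightarrow> level (\<sigma> T) v = seq_level \<sigma> l t v"
        using released_level[of t T v] b by (simp add: status_ok_def)
      with t(4) have "status_ok \<sigma> v b st (seq_level \<sigma> l t v \<in> {h, level (\<sigma> T) v}) t"
        by (auto simp: status_ok_def split: option.splits)
      then show ?thesis using t(1-3) less_SucI by blast
    qed
    then show ?thesis using R_Level2 pc pc' * bn
      by (auto simp: read_inv_def)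
  next
    case (R_Batch2 v' b h st h')
    then have *: "v' = v" "b \<le> batch_number (\<sigma> T)" using inv by (simp_all add: read_inv_def)
    show ?thesis
    proof (cases "b = batch_number (\<sigma> T)")
      case False
      then show ?thesis using R_Batch2 pc pc' * by (auto simp: read_inv_def)
    next
      case b: True
      then obtain t where t: "i < t" "t < T" "l t = Read_Step p"
          "status_ok \<sigma> v b st (seq_level \<sigma> l t v \<in> {h, h'}) t"
        using R_Batch2 inv by (auto simp: read_inv_def)
      have be: "base_level \<sigma> l t = base_level \<sigma> l T"
        using later_at[of t T] t b by (simp add: status_ok_def base_level_def)
      show ?thesis
      proof (cases st)
        case None
        then have "seq_level \<sigma> l t v \<in> {h, h'}" using t by (simp add: status_ok_def)
        then have "pc = R_Batch1 v \<or> pc = R_Return (coreness_estimate P (seq_level \<sigma> l t v))"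
          using R_Batch2 None pc * b by (auto split: if_splits)
        then show ?thesis using pc' t by (auto simp: read_inv_def intro!: exI[of _ t])
      next
        case (Some d)
        then have d: "d = (b, v)" "v \<in> dom (cur (\<sigma> t))" "\<not> released (\<sigma> t) v" "batch_number (\<sigma> t) = b"
          using t by (auto simp: status_ok_def)
        \<comment> \<open>Not being released at \<open>t\<close>, the vertex has at that point its
          level from before the batch, which its descriptor stores.\<close>
        have "later (\<sigma> t) (\<sigma> T)" using later_at[of t T] t(2) b d(4) by simp
        then have "v \<in> dom (cur (\<sigma> T))" using d(2) laterD(2) by blast
        then obtain e where e: "cur (\<sigma> T) v = Some e" by auto
        then have "old_level e = base_level \<sigma> l T v" using fr by (simp add: frame_def)
        then have "pc = R_Return (coreness_estimate P (seq_level \<sigma> l t v))"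
          using R_Batch2 Some pc b d e be by (simp add: seq_level_def)
        then show ?thesis using pc' t by (auto simp: read_inv_def intro!: exI[of _ t])
      qed
    qed
  qed (use inv pc in \<open>simp_all add: read_inv_def\<close>)
qed

lemma read_inv_holds:
  assumes "l i = Inv_Read p v" "i < T" "\<And>j x. i < j \<Longrightarrow> j < T \<Longrightarrow> l j \<noteq> Res_Read p x"
  shows "read_inv P \<sigma> l i p v T"
  using assms(2,3)
proof (induction T)
  case (Suc T)
  show ?case
  proof (cases "T = i")
    case True
    then have "reader (\<sigma> (Suc T)) p = R_Batch1 v"
      using step_at[of i] assms(1) by (auto elim: step.cases)
    then show ?thesis by (simp add: read_inv_def)
  next
    case False
    then have inv: "read_inv P \<sigma> l i p v T" and iT: "i < T" using Suc by auto
    have res: "l T \<noteq> Res_Read p x" for x using Suc.prems iT by simp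
    have idle: "reader (\<sigma> T) p \<noteq> R_Idle" using inv by (auto simp: read_inv_def)
    show ?thesis
    proof (cases "l T = Read_Step p")
      case True
      then show ?thesis using read_inv_step inv iT by blast
    next
      case False
      have "reader (\<sigma> (Suc T)) p = reader (\<sigma> T) p"
        using step_at[of T]
      proof cases
        case work
        then show ?thesis by (auto elim!: work.cases simp: unite_def)
      qed (use False res idle in auto)
      then show ?thesis using read_inv_other inv by blast
    qed
  qed
qed simp

lemma read_value:
  assumes "l i = Inv_Read p v" "i < j" "\<And>j' x. i < j' \<Longrightarrow> j' < j \<Longrightarrow> l j' \<noteq> Res_Read p x"
    "l j = Res_Read p x"
  shows "\<exists>t. i < t \<and> t < j \<and> l t = Read_Step p \<and> x = coreness_estimate P (seq_level \<sigma> l t v)"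
proof -
  have "reader (\<sigma> j) p = R_Return x" using step_at[of j] assms(4) by (auto elim: step.cases)
  then show ?thesis using read_inv_holds[OF assms(1-3)] by (auto simp: read_inv_def)
qed

end

section \<open>Points of linearization\<close>

lemma moved_incident:
  assumes inv: "binv P k B E\<^sub>0 lv\<^sub>0 s" and v: "level s v \<noteq> lv\<^sub>0 v"
  shows "\<exists>y\<in>\<Union>B. same_tree (cur s) v y"
proof (cases rule: post_cases[of s])
  case (1 k' B')
  then show ?thesis using inv v by (auto simp: binv_def frame_def phase_inv_def)
next
  case (2 k' B' h T U)
  note i = binv_visit[OF inv 2(1)]
  show ?thesis using dags_markingD(8)[OF i(7)] i(8) v by blast
next
  case 3
  have "v \<in> dom (cur s)" using inv v by (auto simp: binv_def frame_def)
  then show ?thesis using binv_postD(3)[OF inv 3] by (auto simp: dags_complete_def)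
qed

lemma finite_edges: "finite (edges P)"
  by (rule finite_subset[of _ "Pow {..<nverts P}"]) (auto simp: edges_def)

lemma not_quiet_step:
  assumes "step P s a s'" "phase s \<noteq> Quiet" "a \<noteq> End_Batch"
  shows "phase s' \<noteq> Quiet \<and> (\<forall>k B. a \<noteq> Start_Batch k B)"
  using assms
proof cases
  case work
  then show ?thesis using assms(2) by (auto elim!: work.cases simp: unite_def)
qed (use assms in auto)

lemma first_after_Some:
  assumes "first_after i N Q = Some j"
  shows "i < j" "j < N" "Q j" "\<And>j'. i < j' \<Longrightarrow> j' < j \<Longrightarrow> \<not> Q j'"
proof -
  have ex: "\<exists>j. i < j \<and> j < N \<and> Q j" and j: "j = (LEAST j. i < j \<and> j < N \<and> Q j)"
    using assms by (auto simp: first_after_def split: if_splits)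
  show "i < j" "j < N" "Q j" using LeastI_ex[OF ex] j by auto
  fix j' assume "i < j'" "j' < j"
  then show "\<not> Q j'" using not_less_Least[of j' "\<lambda>j. i < j \<and> j < N \<and> Q j"] j \<open>j < N\<close> by auto
qed

lemma first_after_None: "first_after i N Q = None \<Longrightarrow> i < j \<Longrightarrow> j < N \<Longrightarrow> \<not> Q j"
  by (auto simp: first_after_def split: if_splits)

text \<open>Ties between equal keys are broken by perturbing the keys.\<close>

lemma ordering_by_key:
  fixes key :: "'a \<Rightarrow> nat"
  assumes "finite A"
  obtains xs and pt :: "'a \<Rightarrow> real" where "set xs = A" "sorted_wrt (\<lambda>x y. pt x < pt y) xs"
    "\<And>a. real (key a) < pt a" "\<And>a. pt a < real (key a) + 1"
proof -
  obtain enc :: "'a \<Rightarrow> nat" where enc: "inj_on enc A"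
    using finite_imp_inj_to_nat_seg[OF assms] by metis
  define pt where "pt a = real (key a) + 1 / (real (enc a) + 2)" for a
  have r: "real (key a) < pt a" "pt a < real (key a) + 1" for a
    by (simp_all add: pt_def)
  have inj: "inj_on pt A"
  proof (rule inj_onI)
    fix a b assume ab: "a \<in> A" "b \<in> A" "pt a = pt b"
    then have "key a = key b" using r[of a] r[of b] by linarith
    then have "enc a = enc b" using ab(3) by (simp add: pt_def)
    then show "a = b" using enc ab by (simp add: inj_on_def)
  qed
  obtain ys where ys: "set ys = A" "distinct ys" using finite_distinct_list[OF assms] by auto
  define xs where "xs = sort_key pt ys"
  have xs: "set xs = A" "distinct xs" "sorted (map pt xs)" using ys by (simp_all add: xs_def)
  then have "sorted_wrt (<) (map pt xs)"
    using inj by (simp add: strict_sorted_iff distinct_map)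
  then have "sorted_wrt (\<lambda>x y. pt x < pt y) xs" by (simp add: sorted_wrt_map)
  with xs(1) r show thesis using that by blast
qed

section \<open>Assignment of DAGs to updates, and points of the operations\<close>

fun apply_op ::
  "(nat \<Rightarrow> 'p state) \<Rightarrow> (nat \<Rightarrow> 'p label) \<Rightarrow> nat \<Rightarrow> (nat \<Rightarrow> vertex \<Rightarrow> edge) \<Rightarrow> seq_state \<Rightarrow> 'p operation \<Rightarrow>
   seq_state" where
  "apply_op \<sigma> l N mv (E, lv) (Read p v i) = (E, lv)"
| "apply_op \<sigma> l N mv (E, lv) (Update k e i) =
     (apply_edges k {e} E, \<lambda>v. if mv i v = e then level (batch_end \<sigma> l N i) v else lv v)"

definition end_index :: "(nat \<Rightarrow> 'p label) \<Rightarrow> nat \<Rightarrow> nat \<Rightarrow> nat" where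
  "end_index l N i = (case first_after i N (\<lambda>j. l j = End_Batch) of Some j \<Rightarrow> j | None \<Rightarrow> N)"

definition batch_edges :: "(nat \<Rightarrow> 'p label) \<Rightarrow> nat \<Rightarrow> edge set" where
  "batch_edges l i = (case l i of Start_Batch k B \<Rightarrow> B | _ \<Rightarrow> {})"

text \<open>The choice depends on the vertex only through its DAG, so all vertices of a DAG get the
  same edge. The default \<open>{}\<close> is no edge and hence never in a batch.\<close>

definition mover :: "(nat \<Rightarrow> 'p state) \<Rightarrow> (nat \<Rightarrow> 'p label) \<Rightarrow> nat \<Rightarrow> nat \<Rightarrow> vertex \<Rightarrow> edge" where
  "mover \<sigma> l N i v =
     (let F = cur (batch_end \<sigma> l N i) in
      if v \<in> dom F then SOME e. e \<in> batch_edges l i \<and> (\<exists>w. same_tree F v w \<and> w \<in> e) else {})"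

locale cplds_prefix = cplds_run P \<sigma> l
  for P and \<sigma> :: "nat \<Rightarrow> 'p state" and l +
  fixes N :: nat
begin

abbreviation endx :: "nat \<Rightarrow> nat" where
  "endx \<equiv> end_index l N"

abbreviation mv :: "nat \<Rightarrow> vertex \<Rightarrow> edge" where
  "mv \<equiv> mover \<sigma> l N"

lemma batch_end_eq: "batch_end \<sigma> l N i = \<sigma> (endx i)"
  by (simp add: batch_end_def end_index_def)

lemma start_props:
  assumes "l i = Start_Batch k B"
  shows "phase (\<sigma> i) = Quiet" "phase (\<sigma> (Suc i)) \<noteq> Quiet" "B \<subseteq> edges P" "B \<noteq> {}"
  using step_at[of i] assms by (auto elim: step.cases)

lemma running:
  assumes "l i = Start_Batch k B" "i < t" "\<And>j. i < j \<Longrightarrow> j < t \<Longrightarrow> l j \<noteq> End_Batch"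
  shows "phase (\<sigma> t) \<noteq> Quiet"
  using assms(2,3)
proof (induction t)
  case (Suc t)
  show ?case
  proof (cases "t = i")
    case True
    then show ?thesis using start_props[OF assms(1)] by simp
  next
    case False
    then have "phase (\<sigma> t) \<noteq> Quiet" "l t \<noteq> End_Batch" using Suc by auto
    then show ?thesis using not_quiet_step[OF step_at] by blast
  qed
qed simp

lemma end_index_props:
  assumes i: "l i = Start_Batch k B" "i < N"
  shows "i < endx i" "endx i \<le> N" "endx i < N \<Longrightarrow> l (endx i) = End_Batch"
    "\<And>t. i < t \<Longrightarrow> t \<le> endx i \<Longrightarrow> phase (\<sigma> t) \<noteq> Quiet"
    "\<And>j. i < j \<Longrightarrow> j < endx i \<Longrightarrow> \<not> starts j"
proof -
  have "i < endx i \<and> endx i \<le> N \<and> (endx i < N \<longrightarrow> l (endx i) = End_Batch)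
      \<and> (\<forall>j. i < j \<longrightarrow> j < endx i \<longrightarrow> l j \<noteq> End_Batch)"
  proof (cases "first_after i N (\<lambda>j. l j = End_Batch)")
    case None
    then show ?thesis using first_after_None[OF None] i(2) by (simp add: end_index_def)
  next
    case (Some e)
    then show ?thesis using first_after_Some[OF Some] by (simp add: end_index_def)
  qed
  note e = this
  then show "i < endx i" "endx i \<le> N" "endx i < N \<Longrightarrow> l (endx i) = End_Batch"
    by simp_all
  have no: "l j \<noteq> End_Batch" if "i < j" "j < endx i" for j using e that by simp
  show q: "phase (\<sigma> t) \<noteq> Quiet" if "i < t" "t \<le> endx i" for t
    using running[OF i(1) that(1)] no that(2) by simp
  show "\<not> starts j" if "i < j" "j < endx i" for j
    using q[of j] that start_props(1) by fastforce
qed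

lemma in_batch:
  assumes i: "l i = Start_Batch k B" "i < t" "\<And>j. i < j \<Longrightarrow> j < t \<Longrightarrow> \<not> starts j"
  shows "batch_number (\<sigma> t) = Suc (batch_number (\<sigma> i))"
    "base \<sigma> l t = (k, B, graph (\<sigma> i), level (\<sigma> i))"
    "binv P k B (graph (\<sigma> i)) (level (\<sigma> i)) (\<sigma> t)"
proof -
  have "batch_number (\<sigma> (Suc i)) = batch_number (\<sigma> t)"
    using i(2,3) by (intro same_batch) auto
  then have bn: "batch_number (\<sigma> t) = batch_number (\<sigma> (Suc i))" by simp
  then show "batch_number (\<sigma> t) = Suc (batch_number (\<sigma> i))"
    using i(1) by (cases rule: step_cases[of i]) auto
  show b: "base \<sigma> l t = (k, B, graph (\<sigma> i), level (\<sigma> i))"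
    using later_at[of "Suc i" t] bn i by simp
  show "binv P k B (graph (\<sigma> i)) (level (\<sigma> i)) (\<sigma> t)"
    using binv_base[of t] by (simp add: b)
qed

lemma later_in_batch:
  assumes i: "l i = Start_Batch k B" "i < t" "t \<le> t'" "\<And>j. i < j \<Longrightarrow> j < t' \<Longrightarrow> \<not> starts j"
  shows "later (\<sigma> t) (\<sigma> t')"
  using later_at[OF i(3)] in_batch(1)[OF i(1,2)] in_batch(1)[OF i(1), of t'] i(2-4) by simp

lemma batch_end_inv:
  assumes i: "l i = Start_Batch k B" "i < N"
  shows "binv P k B (graph (\<sigma> i)) (level (\<sigma> i)) (\<sigma> (endx i))"
  using in_batch(3)[OF i(1)] end_index_props[OF i] by blast

text \<open>From the start of unmarking until the next batch, graph, levels and roots are frozen, so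
  \<open>t\<close> may precede or follow the end of the batch.\<close>

lemma post_in_batch:
  assumes i: "l i = Start_Batch k B" "i < N" and t: "i < t" "\<And>j. i < j \<Longrightarrow> j < t \<Longrightarrow> \<not> starts j"
    and po: "post (\<sigma> t)" "post (\<sigma> (endx i))"
  shows "graph (\<sigma> t) = graph (\<sigma> (endx i))" "level (\<sigma> t) = level (\<sigma> (endx i))"
    "rooted (cur (\<sigma> t)) = rooted (cur (\<sigma> (endx i)))"
proof -
  have "later (\<sigma> t) (\<sigma> (endx i)) \<or> later (\<sigma> (endx i)) (\<sigma> t)"
    using later_in_batch[OF i(1) t(1), of "endx i"] later_in_batch[OF i(1) _ _ t(2)]
      end_index_props[OF i] by (metis nat_le_linear)
  then show "graph (\<sigma> t) = graph (\<sigma> (endx i))" "level (\<sigma> t) = level (\<sigma> (endx i))"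
    "rooted (cur (\<sigma> t)) = rooted (cur (\<sigma> (endx i)))"
    using laterD(6-8) po by metis+
qed

lemma ended:
  assumes i: "l i = Start_Batch k B" "i < N" and e: "endx i < N"
  shows "post (\<sigma> (endx i))" "released (\<sigma> (endx i)) v"
proof -
  have "phase (\<sigma> (endx i)) = Unmark_Rest" "\<forall>v. \<not> marked (\<sigma> (endx i)) v"
    using step_at[of "endx i"] end_index_props(3)[OF i e] by (auto elim: step.cases)
  then show "post (\<sigma> (endx i))" "released (\<sigma> (endx i)) v"
    by (auto simp: post_def released_def)
qed

lemma ended_before:
  assumes i: "l i = Start_Batch k B" "i < N" and i': "starts i'" "i < i'" "i' \<le> N"
  shows "endx i < i'"
proof (rule ccontr)
  assume "\<not> endx i < i'"
  then have "phase (\<sigma> i') \<noteq> Quiet" using end_index_props(4)[OF i i'(2)] by simp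
  then show False using i'(1) start_props(1) by blast
qed

lemma mover_in_batch:
  assumes i: "l i = Start_Batch k B" and y: "\<exists>y\<in>\<Union>B. same_tree (cur (\<sigma> (endx i))) v y"
  shows "mv i v \<in> B" "\<exists>w. same_tree (cur (\<sigma> (endx i))) v w \<and> w \<in> mv i v"
proof -
  let ?F = "cur (\<sigma> (endx i))"
  have v: "v \<in> dom ?F" using y same_tree_dom by blast
  have "\<exists>e. e \<in> B \<and> (\<exists>w. same_tree ?F v w \<and> w \<in> e)" using y by blast
  from someI_ex[OF this] v i show "mv i v \<in> B" "\<exists>w. same_tree ?F v w \<and> w \<in> mv i v"
    by (auto simp: mover_def batch_edges_def batch_end_eq)
qed

lemma mover_same_tree:
  assumes "same_tree (cur (\<sigma> (endx i))) v w" shows "mv i v = mv i w"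
proof -
  have "same_tree (cur (\<sigma> (endx i))) v x \<longleftrightarrow> same_tree (cur (\<sigma> (endx i))) w x" for x
    using assms same_tree_trans same_tree_sym by blast
  then show ?thesis
    using same_tree_dom[OF assms] by (simp add: mover_def batch_end_eq domIff)
qed

lemma mover_assignment: "mover_assignment P \<sigma> l N mv"
  unfolding mover_assignment_def same_dag_eq batch_end_eq
proof (intro allI impI conjI)
  fix i k B v w assume i: "i < N" "l i = Start_Batch k B"
  show "mv i v = mv i w" if "same_tree (cur (\<sigma> (endx i))) v w"
    using mover_same_tree that .
  assume "level (\<sigma> i) v \<noteq> level (\<sigma> (endx i)) v"
  then have "\<exists>y\<in>\<Union>B. same_tree (cur (\<sigma> (endx i))) v y"
    using moved_incident[OF batch_end_inv[OF i(2,1)]] by metis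
  then show "mv i v \<in> B" "\<exists>w. same_tree (cur (\<sigma> (endx i))) v w \<and> w \<in> mv i v"
    using mover_in_batch[OF i(2)] by blast+
qed

text \<open>Both DAGs contain an endpoint of the same batch edge: they share one, or they contain
  the two, which lie in one DAG. Marking must be complete for this, as a pending union may still
  separate the endpoints; hence \<open>post\<close>.\<close>

lemma mover_inj:
  assumes i: "l i = Start_Batch k B" "i < N" and po: "post (\<sigma> (endx i))"
    and e: "mv i v = mv i w" "mv i v \<in> B"
  shows "same_tree (cur (\<sigma> (endx i))) v w"
proof -
  let ?F = "cur (\<sigma> (endx i))"
  have B: "B \<subseteq> edges P" using start_props(3)[OF i(1)] .
  have dc: "dags_complete B ?F" using binv_postD(3)[OF batch_end_inv[OF i] po] .
  have ne: "mv i v \<noteq> {}" using e(2) B by (auto simp: edges_def)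
  have "v \<in> dom ?F" "w \<in> dom ?F"
    using ne e(1) by (auto simp: mover_def batch_end_eq Let_def split: if_splits)
  then have "\<exists>y\<in>\<Union>B. same_tree ?F v y" "\<exists>y\<in>\<Union>B. same_tree ?F w y"
    using dc by (auto simp: dags_complete_def)
  then obtain x y where x: "same_tree ?F v x" "x \<in> mv i v" and y: "same_tree ?F w y" "y \<in> mv i v"
    using mover_in_batch(2)[OF i(1)] e(1) by metis
  obtain a b where "mv i v = {a, b}" using e(2) B by (auto simp: edges_def)
  then have "x = y \<or> mv i v = {x, y}" using x(2) y(2) by auto
  then have "same_tree ?F x y"
  proof
    assume "x = y"
    then show ?thesis
      using x(1) same_tree_trans same_tree_sym by blast
  next
    assume "mv i v = {x, y}"
    then show ?thesis
      using dc e(2) same_tree_dom[OF x(1)] same_tree_dom[OF y(1)]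
      by (simp add: dags_complete_def domIff)
  qed
  then show ?thesis using x(1) y(1) same_tree_trans same_tree_sym by blast
qed

lemma mover_notin:
  assumes i: "l i = Start_Batch k B" "i < N" and e: "mv i v \<notin> B"
  shows "level (\<sigma> (endx i)) v = level (\<sigma> i) v"
  using moved_incident[OF batch_end_inv[OF i]] mover_in_batch(1)[OF i(1)] e by metis

text \<open>An update to which no vertex is assigned takes effect at its invocation, and one whose
  DAG is not released within the prefix at \<open>N\<close>, after all completed reads.\<close>

definition update_point :: "edge \<Rightarrow> nat \<Rightarrow> nat" where
  "update_point e i =
     (LEAST j. i \<le> j \<and> (j = N \<or> (\<forall>v. mv i v = e \<longrightarrow> released (\<sigma> (Suc j)) v)))"

lemma update_point_bounds:
  assumes i: "l i = Start_Batch k B" "i < N"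
  shows "i \<le> update_point e i" "update_point e i \<le> N" "endx i < N \<Longrightarrow> update_point e i < endx i"
    "update_point e i < N \<Longrightarrow> mv i v = e \<Longrightarrow> released (\<sigma> (Suc (update_point e i))) v"
proof -
  let ?Q = "\<lambda>j. i \<le> j \<and> (j = N \<or> (\<forall>v. mv i v = e \<longrightarrow> released (\<sigma> (Suc j)) v))"
  have N: "?Q N" using i by simp
  note L = LeastI[of ?Q, OF N, folded update_point_def]
  show "i \<le> update_point e i" using L by blast
  show "update_point e i < N \<Longrightarrow> mv i v = e \<Longrightarrow> released (\<sigma> (Suc (update_point e i))) v"
    using L by simp
  show "update_point e i \<le> N"
    unfolding update_point_def using N by (rule Least_le)
  assume e: "endx i < N"
  have "i < endx i" using end_index_props(1)[OF i] .
  \<comment> \<open>A batch ends only when nothing is marked, so all DAGs are released in the state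
    that step \<open>endx i - 1\<close> produces. This puts the point strictly before the
    response.\<close>
  then have "?Q (endx i - 1)" using ended(2)[OF i e] by auto
  then have "update_point e i \<le> endx i - 1"
    unfolding update_point_def by (rule Least_le)
  then show "update_point e i < endx i" using \<open>i < endx i\<close> by simp
qed

text \<open>Release is permanent within a batch, which gives one direction. For the other, all
  vertices assigned to the edge lie in the DAG of \<open>v\<close> and so are released together with
  it.\<close>

lemma update_point_less:
  assumes i: "l i = Start_Batch k B" "i < N" and t: "i < t" "t \<le> N"
    "\<And>j. i < j \<Longrightarrow> j < t \<Longrightarrow> \<not> starts j" and po: "post (\<sigma> (endx i))" and e: "mv i v \<in> B"
  shows "update_point (mv i v) i < t \<longleftrightarrow> released (\<sigma> t) v"
proof
  let ?j = "update_point (mv i v) i"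
  assume j: "?j < t"
  then have "released (\<sigma> (Suc ?j)) v" using update_point_bounds(4)[OF i] t(2) by simp
  moreover have "i < Suc ?j" "Suc ?j \<le> t"
    using j update_point_bounds(1)[OF i, of "mv i v"] by simp_all
  then have "later (\<sigma> (Suc ?j)) (\<sigma> t)" using later_in_batch[OF i(1)] t(3) by blast
  ultimately show "released (\<sigma> t) v" using released_later by blast
next
  assume r: "released (\<sigma> t) v"
  then have "post (\<sigma> t)" by (simp add: released_def)
  note eq = post_in_batch(3)[OF i t(1,3) this po]
  have "released (\<sigma> t) w" if "mv i w = mv i v" for w
  proof -
    have "same_tree (cur (\<sigma> (endx i))) v w" using mover_inj[OF i po that[symmetric] e] .
    then have "same_tree (cur (\<sigma> t)) v w" by (simp add: same_tree_def eq)
    then show ?thesis using r released_same_tree by blast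
  qed
  then have "update_point (mv i v) i \<le> t - 1"
    unfolding update_point_def using t(1) by (intro Least_le) auto
  then show "update_point (mv i v) i < t" using t(1) by simp
qed

text \<open>A batch cut off before unmarking is dropped entirely, since reads are then explained by
  the levels before it. One cut off later is kept entirely: reads may already have observed some of
  its DAGs, and the invariants are known only for its final levels.\<close>

definition effective :: "'p operation set" where
  "effective = {a \<in> operations_of l N. case a of
     Read p v i \<Rightarrow> response l N a \<noteq> None | Update k e i \<Rightarrow> post (\<sigma> (endx i))}"

lemma finite_effective: "finite effective"
proof -
  let ?R = "(\<lambda>i. case l i of Inv_Read p v \<Rightarrow> Read p v i) ` {..<N}"
  let ?U = "\<Union>i<N. (\<lambda>e. case l i of Start_Batch k B \<Rightarrow> Update k e i) ` edges P"
  have "operations_of l N \<subseteq> ?R \<union> ?U"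
  proof
    fix a assume "a \<in> operations_of l N"
    then show "a \<in> ?R \<union> ?U"
      unfolding operations_of_def
    proof (elim UnE CollectE exE conjE)
      fix p v i assume "a = Read p v i" "i < N" "l i = Inv_Read p v"
      then show ?thesis by (auto intro!: image_eqI[of _ _ i])
    next
      fix k e i B assume "a = Update k e i" "i < N" "l i = Start_Batch k B" "e \<in> B"
      then show ?thesis using start_props(3)[of i k B] by (auto intro!: bexI[of _ i] image_eqI[of _ _ e])
    qed
  qed
  moreover have "finite (?R \<union> ?U)" by (simp add: finite_edges)
  ultimately have "finite (operations_of l N)" by (rule finite_subset)
  then show ?thesis by (simp add: effective_def)
qed

lemma update_effective:
  "Update k e i \<in> effective \<longleftrightarrow> i < N \<and> (\<exists>B. l i = Start_Batch k B \<and> e \<in> B) \<and> post (\<sigma> (endx i))"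
  by (auto simp: effective_def operations_of_def)

fun point :: "'p operation \<Rightarrow> nat" where
  "point (Read p v i) =
     (SOME t. \<exists>x j. response l N (Read p v i) = Some (x, j) \<and> i < t \<and> t < j \<and> l t = Read_Step p
        \<and> x = Some (coreness_estimate P (seq_level \<sigma> l t v)))"
| "point (Update k e i) = update_point e i"

definition return_value :: "'p operation \<Rightarrow> real option" where
  "return_value a = (case response l N a of Some (x, j) \<Rightarrow> x | None \<Rightarrow> None)"

lemma read_point:
  assumes "Read p v i \<in> effective"
  obtains j where "response l N (Read p v i) = Some (return_value (Read p v i), j)"
    "i < point (Read p v i)" "point (Read p v i) < j" "j < N"
    "l (point (Read p v i)) = Read_Step p"
    "return_value (Read p v i) = Some (coreness_estimate P (seq_level \<sigma> l (point (Read p v i)) v))"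
proof -
  let ?a = "Read p v i"
  have a: "l i = Inv_Read p v" "response l N ?a \<noteq> None"
    using assms by (auto simp: effective_def operations_of_def)
  then obtain j where j: "first_after i N (\<lambda>j. \<exists>x. l j = Res_Read p x) = Some j" by auto
  note f = first_after_Some[OF j]
  obtain x where x: "l j = Res_Read p x" using f(3) by blast
  have r: "response l N ?a = Some (Some x, j)" using j x by simp
  have "\<exists>t. i < t \<and> t < j \<and> l t = Read_Step p \<and> x = coreness_estimate P (seq_level \<sigma> l t v)"
    using read_value[OF a(1) f(1) _ x] f(4) by blast
  then have "\<exists>t x j. response l N ?a = Some (x, j) \<and> i < t \<and> t < j \<and> l t = Read_Step p
      \<and> x = Some (coreness_estimate P (seq_level \<sigma> l t v))"
    using r by auto
  from someI_ex[OF this, folded point.simps(1)] obtain x' j'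
    where *: "response l N ?a = Some (x', j')" "i < point ?a" "point ?a < j'"
      "l (point ?a) = Read_Step p"
      "x' = Some (coreness_estimate P (seq_level \<sigma> l (point ?a) v))"
    by (elim exE conjE)
  have rv: "return_value ?a = x'" unfolding return_value_def *(1) by simp
  have "j' = j" using *(1) unfolding r by simp
  then show thesis using that[of j'] * rv f(2) by (simp del: response.simps point.simps)
qed

end

section \<open>The sequential execution\<close>

lemma apply_edges_insert: "apply_edges k {e} (apply_edges k S E) = apply_edges k (insert e S) E"
  by (cases k) auto

lemma apply_edges_empty [simp]: "apply_edges k {} E = E"
  by (cases k) auto

context cplds_prefix
begin

declare point.simps(1) [simp del]

text \<open>
  An update whose point is \<open>j\<close> has taken effect in \<open>\<sigma> (Suc j)\<close> but not in \<open>\<sigma> j\<close>, whereas a read whose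
  point is \<open>j\<close> refers to \<open>\<sigma> j\<close>; hence reads precede updates with the same point.
\<close>

definition key :: "'p operation \<Rightarrow> nat" where
  "key a = 2 * point a + (case a of Read p v i \<Rightarrow> 0 | Update k e i \<Rightarrow> 1)"

definition replay :: "'p operation list \<Rightarrow> seq_state" where
  "replay os = foldl (apply_op \<sigma> l N mv) (graph (\<sigma> 0), level (\<sigma> 0)) os"

lemma replay_Nil [simp]: "replay [] = (graph (\<sigma> 0), level (\<sigma> 0))"
  by (simp add: replay_def)

lemma replay_snoc [simp]: "replay (os @ [x]) = apply_op \<sigma> l N mv (replay os) x"
  by (simp add: replay_def)

lemma replay_reads: "(\<And>k e i. Update k e i \<notin> set os) \<Longrightarrow> replay os = (graph (\<sigma> 0), level (\<sigma> 0))"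
proof (induction os rule: rev_induct)
  case (snoc x os)
  then obtain p v i where "x = Read p v i" by (cases x) auto
  then show ?case using snoc by simp
qed simp

lemma before_first_start:
  assumes "\<And>j. j < t \<Longrightarrow> \<not> starts j"
  shows "graph (\<sigma> t) = graph (\<sigma> 0)" "level (\<sigma> t) = level (\<sigma> 0)" "seq_level \<sigma> l t v = level (\<sigma> 0) v"
proof -
  have "batch_number (\<sigma> 0) = batch_number (\<sigma> t)" using assms by (intro same_batch) auto
  then have la: "later (\<sigma> 0) (\<sigma> t)" and b: "base \<sigma> l t = base \<sigma> l 0" using later_at[of 0 t] by auto
  have "post (\<sigma> 0)" using exec by (simp add: execution_def initial_def post_def)
  then show "graph (\<sigma> t) = graph (\<sigma> 0)" "level (\<sigma> t) = level (\<sigma> 0)" using laterD[OF la] by auto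
  then show "seq_level \<sigma> l t v = level (\<sigma> 0) v" by (simp add: seq_level_def base_level_def b)
qed

lemma update_order:
  assumes "Update k e i \<in> effective" "Update k' e' i' \<in> effective" "i < i'"
  shows "key (Update k e i) < key (Update k' e' i')"
proof -
  obtain B B' where i: "l i = Start_Batch k B" "i < N" and i': "l i' = Start_Batch k' B'" "i' < N"
    using assms by (auto simp: update_effective)
  have "endx i < i'" using ended_before[OF i] i' assms(3) by auto
  then show ?thesis
    using update_point_bounds(3)[OF i, of e] update_point_bounds(1)[OF i', of e'] i'(2)
    by (simp add: key_def)
qed

lemma ended_effective:
  assumes i: "l i = Start_Batch k B" "i < N" and i': "starts i'" "i < i'" "i' \<le> N" and e: "e \<in> B"
  shows "Update k e i \<in> effective"
  using ended(1)[OF i] ended_before[OF i i'] i i' e by (auto simp: update_effective)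

text \<open>A vertex assigned to no edge of the batch has not moved, so its old level is also its
  final one.\<close>

lemma whole_batch_state:
  assumes i: "l i = Start_Batch k B" "i < N" and po: "post (\<sigma> (endx i))"
    and S: "S \<subseteq> effective" "\<And>e. e \<in> B \<Longrightarrow> Update k e i \<in> S"
  shows "(apply_edges k {e. Update k e i \<in> S} (graph (\<sigma> i)),
          \<lambda>v. if Update k (mv i v) i \<in> S then level (\<sigma> (endx i)) v else level (\<sigma> i) v)
       = (graph (\<sigma> (endx i)), level (\<sigma> (endx i)))"
proof -
  have eq: "Update k e i \<in> S \<longleftrightarrow> e \<in> B" for e
    using S i by (auto simp: update_effective)
  have "{e. Update k e i \<in> S} = B" using eq by auto
  moreover have "graph (\<sigma> (endx i)) = apply_edges k B (graph (\<sigma> i))"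
    using binv_postD(1)[OF batch_end_inv[OF i] po] .
  moreover have "(if Update k (mv i v) i \<in> S then level (\<sigma> (endx i)) v else level (\<sigma> i) v)
      = level (\<sigma> (endx i)) v" for v
    using mover_notin[OF i, of v] by (simp add: eq)
  ultimately show ?thesis by simp
qed

context
  fixes os :: "'p operation list" and pt :: "'p operation \<Rightarrow> real"
  assumes os: "set os = effective" and sorted: "sorted_wrt (\<lambda>x y. pt x < pt y) os"
    and pt_gt: "\<And>a. real (key a) < pt a" and pt_lt: "\<And>a. pt a < real (key a) + 1"
begin

lemma pt_less: "key a < key b \<Longrightarrow> pt a < pt b"
  using pt_gt[of b] pt_lt[of a] by linarith

lemma pt_lessD: "pt a < pt b \<Longrightarrow> key a \<le> key b"
  using pt_gt[of a] pt_lt[of b] by linarith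

lemma in_prefix:
  assumes "os = ys @ x # zs" "b \<in> effective" "pt b < pt x"
  shows "b \<in> set ys"
proof -
  have "b \<in> set ys \<union> {x} \<union> set zs" using assms(1,2) os by auto
  moreover have "pt x < pt z" if "z \<in> set zs" for z
    using sorted that assms(1) by (auto simp: sorted_wrt_append)
  ultimately show ?thesis using assms(3) by fastforce
qed

lemma prefix_less: "os = ys @ x # zs \<Longrightarrow> y \<in> set ys \<Longrightarrow> pt y < pt x"
  using sorted by (auto simp: sorted_wrt_append)

text \<open>
  For the replay, \<open>i\<close> is the start of the batch that is being executed: everything before it is done,
  nothing after it has begun.
\<close>

lemma replay_batch:
  assumes "os = ys @ zs" "l i = Start_Batch k B" "i < N"
    "\<And>k e i'. Update k e i' \<in> set ys \<Longrightarrow> i' \<le> i"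
    "\<And>k e i'. Update k e i' \<in> effective \<Longrightarrow> i' < i \<Longrightarrow> Update k e i' \<in> set ys"
  shows "replay ys = (apply_edges k {e. Update k e i \<in> set ys} (graph (\<sigma> i)),
     \<lambda>v. if Update k (mv i v) i \<in> set ys then level (\<sigma> (endx i)) v else level (\<sigma> i) v)"
  using assms
proof (induction ys arbitrary: i k B zs rule: rev_induct)
  case Nil
  \<comment> \<open>An earlier batch would have ended before \<open>i\<close> and, being nonempty,
    would contribute an effective update to the empty list.\<close>
  have "\<not> starts j" if ji: "j < i" for j
  proof
    assume "starts j"
    then obtain k' B' where j: "l j = Start_Batch k' B'" by blast
    then obtain e where "e \<in> B'" using start_props(4) by blast
    then have "Update k' e j \<in> effective"
      using ended_effective[OF j, of i] Nil.prems(2,3) ji by auto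
    then show False using Nil.prems(5) ji by auto
  qed
  then show ?case using before_first_start[of i] by simp
next
  case (snoc x ys)
  have split: "os = ys @ x # zs" using snoc.prems(1) by simp
  show ?case
  proof (cases x)
    case (Read p v j)
    have IH: "replay ys = (apply_edges k {e. Update k e i \<in> set ys} (graph (\<sigma> i)),
        \<lambda>v. if Update k (mv i v) i \<in> set ys then level (\<sigma> (endx i)) v else level (\<sigma> i) v)"
      using snoc.prems Read by (intro snoc.IH) auto
    have eq: "Update k e i \<in> set (ys @ [x]) \<longleftrightarrow> Update k e i \<in> set ys" for e using Read by simp
    show ?thesis unfolding eq replay_snoc IH by (simp add: Read)
  next
    case (Update k\<^sub>x e\<^sub>x j)
    have x: "Update k\<^sub>x e\<^sub>x j \<in> effective" using split os Update by auto
    then obtain B\<^sub>x where j: "l j = Start_Batch k\<^sub>x B\<^sub>x" "j < N" and po: "post (\<sigma> (endx j))"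
      by (auto simp: update_effective)
    have sub: "set (ys @ [x]) \<subseteq> effective" using split os by auto
    \<comment> \<open>\<open>x\<close> is last in the order, and the updates of later batches come
      later, so the list contains none from a batch after that of \<open>x\<close>.\<close>
    have le: "i' \<le> j" if "Update k' e' i' \<in> set (ys @ [x])" for k' e' i'
    proof (rule ccontr)
      assume "\<not> i' \<le> j"
      then have "pt x < pt (Update k' e' i')"
        using update_order[OF x, of k' e' i'] pt_less sub that Update by auto
      moreover have "Update k' e' i' \<in> set ys" using \<open>\<not> i' \<le> j\<close> that Update by auto
      ultimately show False using prefix_less[OF split] by fastforce
    qed
    have IH: "replay ys = (apply_edges k\<^sub>x {e. Update k\<^sub>x e j \<in> set ys} (graph (\<sigma> j)),
        \<lambda>v. if Update k\<^sub>x (mv j v) j \<in> set ys then level (\<sigma> (endx j)) v else level (\<sigma> j) v)"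
    proof (rule snoc.IH[OF split j])
      show "i' \<le> j" if "Update k' e' i' \<in> set ys" for k' e' i' using le that by auto
      show "Update k' e' i' \<in> set ys" if "Update k' e' i' \<in> effective" "i' < j" for k' e' i'
        using in_prefix[OF split that(1)] update_order[OF that(1) x that(2)] pt_less Update by auto
    qed
    have "insert e\<^sub>x {e. Update k\<^sub>x e j \<in> set ys} = {e. Update k\<^sub>x e j \<in> set (ys @ [x])}"
      using Update by auto
    then have here: "replay (ys @ [x]) =
        (apply_edges k\<^sub>x {e. Update k\<^sub>x e j \<in> set (ys @ [x])} (graph (\<sigma> j)),
        \<lambda>v. if Update k\<^sub>x (mv j v) j \<in> set (ys @ [x]) then level (\<sigma> (endx j)) v else level (\<sigma> j) v)"
      unfolding replay_snoc IH by (auto simp: Update apply_edges_insert batch_end_eq)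
    have "j \<le> i" using snoc.prems(4)[of k\<^sub>x e\<^sub>x j] Update by simp
    show ?thesis
    proof (cases "j = i")
      case True
      then have "k\<^sub>x = k" using j(1) snoc.prems(2) by simp
      then show ?thesis using here unfolding True by simp
    next
      \<comment> \<open>Batch \<open>i\<close> has not begun in the list: \<open>j\<close> is the
        batch just before it and is complete, so the replay has reached the end of \<open>j\<close>,
        which has the graph and levels with which \<open>i\<close> starts.\<close>
      case False
      then have ji: "j < i" using \<open>j \<le> i\<close> by simp
      have st: "starts i" using snoc.prems(2) by blast
      have no: "\<not> starts i'" if i': "j < i'" "i' < i" for i'
      proof
        assume "starts i'"
        then obtain k' B' where l': "l i' = Start_Batch k' B'" by blast
        then obtain e where "e \<in> B'" using start_props(4) by blast
        then have "Update k' e i' \<in> effective"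
          using ended_effective[OF l' _ st i'(2)] snoc.prems(3) i'(2) by simp
        then show False using snoc.prems(5) le i' by fastforce
      qed
      have "Update k\<^sub>x e j \<in> set (ys @ [x])" if "e \<in> B\<^sub>x" for e
        using snoc.prems(3,5) ended_effective[OF j st ji _ that] ji by simp
      from whole_batch_state[OF j po sub this] here
      have "replay (ys @ [x]) = (graph (\<sigma> (endx j)), level (\<sigma> (endx j)))" by simp
      moreover have "post (\<sigma> i)" using start_props(1)[OF snoc.prems(2)] by (simp add: post_def)
      note post_in_batch[OF j ji no this po]
      moreover have "Update k e i \<notin> set (ys @ [x])" for e using le[of k e i] ji by auto
      ultimately show ?thesis by simp
    qed
  qed
qed

text \<open>The latest batch that occurs in the prefix occurs there as a whole, so the replay has
  arrived at the state in which that batch ended or was cut off, where its levels are final.\<close>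

lemma replay_lds:
  assumes j: "j \<le> length os" and whole: "whole_batches l N (set (take j os))"
  shows "lds P (fst (replay (take j os))) (snd (replay (take j os)))"
proof (cases "\<exists>k e i. Update k e i \<in> set (take j os)")
  case False
  then have "replay (take j os) = (graph (\<sigma> 0), level (\<sigma> 0))" by (intro replay_reads) auto
  then show ?thesis using exec by (simp add: execution_def initial_def)
next
  case True
  let ?ys = "take j os"
  let ?I = "{i. \<exists>k e. Update k e i \<in> set ?ys}"
  have sub: "set ?ys \<subseteq> effective" using os set_take_subset by metis
  have "?I \<subseteq> {..<N}" using sub by (auto simp: update_effective)
  then have fin: "finite ?I" using finite_subset by blast
  define i where "i = Max ?I"
  have "i \<in> ?I" unfolding i_def using fin True by (intro Max_in) auto
  then obtain k e where ke: "Update k e i \<in> set ?ys" by auto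
  then obtain B where i: "l i = Start_Batch k B" "i < N" "e \<in> B" and po: "post (\<sigma> (endx i))"
    using sub update_effective by blast
  have le: "i' \<le> i" if "Update k' e' i' \<in> set ?ys" for k' e' i'
    unfolding i_def using fin that by (intro Max_ge) auto
  have split: "os = ?ys @ drop j os" by simp
  have lt: "Update k' e' i' \<in> set ?ys" if "Update k' e' i' \<in> effective" "i' < i" for k' e' i'
  proof -
    have "pt (Update k' e' i') < pt (Update k e i)"
      using pt_less update_order[OF that(1) _ that(2)] ke sub by blast
    moreover have "pt (Update k e i) < pt z" if "z \<in> set (drop j os)" for z
      using sorted ke that by (metis append_take_drop_id sorted_wrt_append)
    moreover have "Update k' e' i' \<in> set ?ys \<union> set (drop j os)"
      using that(1) os split by (metis set_append)
    ultimately show ?thesis by fastforce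
  qed
  have "Update k e' i \<in> set ?ys" if "e' \<in> B" for e'
    using whole i ke that unfolding whole_batches_def by blast
  from whole_batch_state[OF i(1,2) po sub this] replay_batch[OF split i(1,2) le lt]
  have "replay ?ys = (graph (\<sigma> (endx i)), level (\<sigma> (endx i)))" by simp
  then show ?thesis using binv_postD(2)[OF batch_end_inv[OF i(1,2)] po] by simp
qed

text \<open>The updates before the read are those with a point below \<open>t\<close>. For the last
  batch started before \<open>t\<close>, the replay gives \<open>v\<close> its final level if the
  update assigned to \<open>v\<close> is among them; by \<open>update_point_less\<close> this means
  that \<open>v\<close> is released at \<open>t\<close>, which is the case distinction of
  \<open>seq_level\<close>.\<close>

lemma replay_read:
  assumes split: "os = ys @ Read p v m # zs"
  shows "snd (replay ys) v = seq_level \<sigma> l (point (Read p v m)) v"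
proof -
  let ?a = "Read p v m"
  define t where "t = point ?a"
  have a: "?a \<in> effective" using split os by auto
  obtain j where j: "m < point ?a" "point ?a < j" "j < N" using read_point[OF a] by blast
  have t: "m < t" "t < N" "key ?a = 2 * t"
    using j by (simp_all add: t_def key_def)
  have sub: "set ys \<subseteq> effective" using split os by auto
  have mem: "Update k e i \<in> set ys \<longleftrightarrow> Update k e i \<in> effective \<and> update_point e i < t" for k e i
  proof
    assume y: "Update k e i \<in> set ys"
    then have "key (Update k e i) \<le> key ?a" using prefix_less[OF split y] pt_lessD by blast
    \<comment> \<open>The key of a read is even and that of an update odd, so the weak inequality of
      keys is a strict one of points.\<close>
    then have "update_point e i < t" unfolding t(3) by (simp add: key_def)
    then show "Update k e i \<in> effective \<and> update_point e i < t" using y sub by blast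
  next
    assume "Update k e i \<in> effective \<and> update_point e i < t"
    then show "Update k e i \<in> set ys"
      using in_prefix[OF split, of "Update k e i"] pt_less[of "Update k e i" ?a] t(3)
      by (simp add: key_def)
  qed
  have idx: "i \<le> update_point e i" if "Update k e i \<in> effective" for k e i
    using that update_point_bounds(1) by (auto simp: update_effective)
  have started: "i < t" "starts i" if "Update k e i \<in> set ys" for k e i
    using that mem[of k e i] idx[of k e i] by (auto simp: update_effective)
  show ?thesis
    unfolding t_def[symmetric]
  proof (cases "\<exists>i<t. starts i")
    case False
    then have "Update k e i \<notin> set ys" for k e i using started by blast
    then have "replay ys = (graph (\<sigma> 0), level (\<sigma> 0))" by (rule replay_reads)
    then show "snd (replay ys) v = seq_level \<sigma> l t v"
      using before_first_start(3)[of t v] False by auto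
  next
    case True
    define i where "i = Max {i. i < t \<and> starts i}"
    have fin: "finite {i. i < t \<and> starts i}" by simp
    have "i \<in> {i. i < t \<and> starts i}" unfolding i_def using fin True by (intro Max_in) auto
    then obtain k B where i: "l i = Start_Batch k B" "i < N" and it: "i < t" using t(2) by auto
    have max: "i' \<le> i" if "i' < t" "starts i'" for i'
      unfolding i_def using fin that by (intro Max_ge) auto
    have no: "\<not> starts j" if "i < j" "j < t" for j using max[of j] that by auto
    have rep: "snd (replay ys) v
        = (if Update k (mv i v) i \<in> set ys then level (\<sigma> (endx i)) v else level (\<sigma> i) v)"
    proof (subst replay_batch[OF split i])
      show "i' \<le> i" if "Update k' e' i' \<in> set ys" for k' e' i'
        using max started[OF that] by blast
      show "Update k' e' i' \<in> set ys" if y: "Update k' e' i' \<in> effective" "i' < i" for k' e' i'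
      proof -
        obtain B' where i': "l i' = Start_Batch k' B'" "i' < N"
          using y(1) by (auto simp: update_effective)
        have "endx i' < i" using ended_before[OF i' _ y(2)] i by auto
        then have "update_point e' i' < t"
          using update_point_bounds(3)[OF i', of e'] i(2) it by auto
        then show ?thesis using mem y(1) by blast
      qed
    qed simp_all
    have base: "base_level \<sigma> l t v = level (\<sigma> i) v"
      using in_batch(2)[OF i(1) it no] by (simp add: base_level_def)
    show "snd (replay ys) v = seq_level \<sigma> l t v"
    proof (cases "released (\<sigma> t) v")
      case True
      then have po_t: "post (\<sigma> t)" by (simp add: released_def)
      have po: "post (\<sigma> (endx i))"
      proof (cases "endx i < N")
        case True
        then show ?thesis using ended(1)[OF i] by blast
      next
        case False
        then have "endx i = N" using end_index_props(2)[OF i] by simp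
        then have "later (\<sigma> t) (\<sigma> (endx i))"
          using later_in_batch[OF i(1) it] end_index_props(5)[OF i] t(2) by simp
        then show ?thesis using laterD(5) po_t by blast
      qed
      have lv: "level (\<sigma> t) v = level (\<sigma> (endx i)) v"
        using post_in_batch(2)[OF i it no po_t po] by simp
      have "Update k (mv i v) i \<in> set ys" if "mv i v \<in> B"
        using that update_point_less[OF i it _ no po that] t(2) True i po
        by (simp add: mem update_effective)
      then show ?thesis
        using rep lv True mover_notin[OF i, of v]
        by (cases "mv i v \<in> B") (auto simp: seq_level_def)
    next
      case False
      have "Update k (mv i v) i \<notin> set ys"
      proof
        assume "Update k (mv i v) i \<in> set ys"
        then have "mv i v \<in> B" "post (\<sigma> (endx i))" "update_point (mv i v) i < t"
          using mem i by (auto simp: update_effective)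
        then show False using update_point_less[OF i it _ no] t(2) False by simp
      qed
      then show ?thesis using rep False base by (simp add: seq_level_def)
    qed
  qed
qed

lemma legal_os: "legal P \<sigma> l N mv (map (\<lambda>a. (a, return_value a)) os)"
proof -
  let ?xs = "map (\<lambda>a. (a, return_value a)) os"
  have "seq_step P \<sigma> l N mv (replay (take j os)) (?xs ! j) (replay (take (Suc j) os))"
    if j: "j < length ?xs" for j
  proof -
    have j': "j < length os" using j by simp
    have split: "os = take j os @ os ! j # drop (Suc j) os" using j' by (simp add: id_take_nth_drop)
    have suc: "replay (take (Suc j) os) = apply_op \<sigma> l N mv (replay (take j os)) (os ! j)"
      using j' by (simp add: take_Suc_conv_app_nth)
    have mem: "os ! j \<in> effective" using os j' nth_mem by blast
    obtain E lv where S: "replay (take j os) = (E, lv)" by fastforce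
    show ?thesis
    proof (cases "os ! j")
      case (Read p v i)
      obtain "return_value (Read p v i)
          = Some (coreness_estimate P (seq_level \<sigma> l (point (Read p v i)) v))"
        using read_point mem Read by metis
      moreover have "lv v = seq_level \<sigma> l (point (Read p v i)) v"
        using replay_read[of "take j os" p v i] split S Read by simp
      ultimately show ?thesis using Read suc S j' by simp
    next
      case (Update k e i)
      have "return_value (Update k e i) = None"
        by (auto simp: return_value_def split: option.splits)
      then show ?thesis using Update suc S j' by simp
    qed
  qed
  moreover have "lds P (fst (replay (take j os))) (snd (replay (take j os)))"
    if "j \<le> length ?xs" "whole_batches l N (fst ` set (take j ?xs))" for j
  proof -
    have "fst ` set (take j ?xs) = set (take j os)" by (simp add: take_map image_image)
    then show ?thesis using replay_lds that by simp
  qed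
  ultimately show ?thesis
    unfolding legal_def by (intro exI[of _ "\<lambda>j. replay (take j os)"]) auto
qed

end

lemma linearizable: "linearizable (history_of l N) (legal P \<sigma> l N mv)"
proof -
  obtain os pt where os: "set os = effective" "sorted_wrt (\<lambda>x y. pt x < pt y) os"
    and pt: "\<And>a. real (key a) < pt a" "\<And>a. pt a < real (key a) + 1"
    using ordering_by_key[OF finite_effective] by metis
  let ?xs = "map (\<lambda>a. (a, return_value a)) os"
  \<comment> \<open>Keys are twice the points plus at most 1, so halving puts each operation
    strictly between its point and the next step.\<close>
  let ?pt = "\<lambda>a. pt a / 2"
  have mem: "fst ` set ?xs = effective" using os(1) by (simp add: image_image)
  have bounds: "real (point a) < ?pt a" "?pt a < real (point a) + 1" for a
    using pt[of a] by (cases a; simp add: key_def)+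
  have resp: "a \<in> effective" if a: "a \<in> operations_of l N" "response l N a \<noteq> None" for a
  proof (cases a)
    case (Read p v i)
    then show ?thesis using a by (simp add: effective_def)
  next
    case (Update k e i)
    then obtain B where i: "l i = Start_Batch k B" "i < N" "e \<in> B"
      using a(1) by (auto simp: operations_of_def)
    have "endx i < N"
      using a(2) Update first_after_Some(2)[of i N "\<lambda>j. l j = End_Batch"]
      by (auto simp: end_index_def split: option.splits)
    then show ?thesis using ended(1)[OF i(1,2)] i Update by (auto simp: update_effective)
  qed
  have times: "real (invocation a) < ?pt a \<and> (\<forall>r' t. response l N a = Some (r', t) \<longrightarrow>
      r' = return_value a \<and> ?pt a < real t)" if a: "a \<in> effective" for a
  proof -
    have "invocation a \<le> point a \<and> (\<forall>r' t. response l N a = Some (r', t) \<longrightarrow>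
        r' = return_value a \<and> point a < t)"
    proof (cases a)
      case (Read p v i)
      obtain j where j: "response l N a = Some (return_value a, j)" "i < point a" "point a < j"
        using read_point a Read by metis
      show ?thesis using j Read by (simp del: response.simps)
    next
      case (Update k e i)
      then obtain B where i: "l i = Start_Batch k B" "i < N"
        using a by (auto simp: update_effective)
      have "r' = return_value a \<and> point a < t" if r: "response l N a = Some (r', t)" for r' t
      proof -
        have f: "first_after i N (\<lambda>j. l j = End_Batch) = Some t" "r' = None"
          using r Update by auto
        then have "endx i = t" "t < N" using first_after_Some(2) by (auto simp: end_index_def)
        then have "point a < t" using update_point_bounds(3)[OF i] Update by simp
        moreover have "return_value a = None" using f Update by (simp add: return_value_def)
        ultimately show ?thesis using f by simp
      qed
      then show ?thesis using update_point_bounds(1)[OF i] Update by simp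
    qed
    then have "real (invocation a) \<le> real (point a)"
      "\<forall>r' t. response l N a = Some (r', t) \<longrightarrow> r' = return_value a \<and> real (point a) + 1 \<le> real t"
      by auto
    then show ?thesis using bounds[of a] by fastforce
  qed
  have "legal P \<sigma> l N mv ?xs" using legal_os[OF os pt] .
  moreover have "sorted_wrt (\<lambda>x y. ?pt (fst x) < ?pt (fst y)) ?xs"
    using os(2) by (simp add: sorted_wrt_map)
  moreover have "fst ` set ?xs \<subseteq> operations (history_of l N)"
    unfolding mem by (auto simp: history_of_def effective_def)
  moreover have "\<forall>a\<in>operations (history_of l N). responded (history_of l N) a \<noteq> None \<longrightarrow>
      a \<in> fst ` set ?xs"
    unfolding mem using resp by (auto simp: history_of_def)
  moreover have "\<forall>(a, r)\<in>set ?xs. real (invoked (history_of l N) a) < ?pt a \<and>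
      (\<forall>r' t. responded (history_of l N) a = Some (r', t) \<longrightarrow> r' = r \<and> ?pt a < real t)"
    using times os(1) by (auto simp: history_of_def)
  ultimately show ?thesis
    unfolding linearizable_def by (intro exI[of _ ?xs] exI[of _ ?pt] conjI)
qed

end

lemma (in cplds_run) cplds_linearizable: "cplds_linearizable P \<sigma> l"
proof -
  have "mover_assignment P \<sigma> l N (mover \<sigma> l N) \<and>
      linearizable (history_of l N) (legal P \<sigma> l N (mover \<sigma> l N))" for N
  proof -
    interpret cplds_prefix P \<sigma> l N by unfold_locales
    show ?thesis using mover_assignment linearizable by blast
  qed
  then show ?thesis unfolding cplds_linearizable_def by blast
qed

section \<open>Liveness\<close>

text \<open>A minimal value of the tail is attained at some \<open>m\<close>; from then on any
  change would lead below it, so the sequence is constant.\<close>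

lemma finite_descents:
  assumes wf: "wf r" and tr: "trans r"
    and le: "\<And>i. M \<le> i \<Longrightarrow> f (Suc i) = f i \<or> (f (Suc i), f i) \<in> r"
  shows "finite {i. (f (Suc i), f i) \<in> r}"
proof -
  have "f M \<in> f ` {M..}" by simp
  from wfE_min[OF wf this] obtain z
    where z: "z \<in> f ` {M..}" "\<And>y. (y, z) \<in> r \<Longrightarrow> y \<notin> f ` {M..}" by blast
  then obtain m where m: "M \<le> m" "z = f m" by auto
  have min: "(f i, f m) \<notin> r" if "M \<le> i" for i using z(2)[of "f i"] m(2) that by auto
  have const: "f i = f m" if "m \<le> i" for i
    using that
  proof (induction rule: dec_induct)
    case (step i)
    then have "M \<le> i" using m(1) by simp
    then have "f (Suc i) = f i \<or> (f (Suc i), f i) \<in> r" "(f (Suc i), f m) \<notin> r"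
      using le[OF \<open>M \<le> i\<close>] min[of "Suc i"] \<open>M \<le> i\<close> by simp_all
    then show ?case using step.IH by metis
  qed simp
  have "(f (Suc i), f i) \<notin> r" if "m \<le> i" for i
    using const[of i] const[of "Suc i"] that wf_not_refl[OF wf] by simp
  then have "{i. (f (Suc i), f i) \<in> r} \<subseteq> {..<m}" by (auto simp: not_le[symmetric])
  then show ?thesis using finite_subset by blast
qed

section \<open>Measure for the work of a batch\<close>

text \<open>Weight 1 is kept for the move of a marked vertex, 2 for a mark without pending unions,
  and each pending union adds 1. At most \<open>nverts P\<close> unions can be pending, so
  \<open>nverts P + 3\<close> exceeds the weight once a mark has begun.\<close>

definition mark_weight :: "params \<Rightarrow> 'p state \<Rightarrow> (vertex \<Rightarrow> vertex set option) \<Rightarrow> vertex \<Rightarrow> nat" where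
  "mark_weight P s U v =
     (if marked s v then 1 else case U v of Some W \<Rightarrow> card W + 2 | None \<Rightarrow> nverts P + 3)"

definition work_left :: "params \<Rightarrow> 'p state \<Rightarrow> nat \<times> nat \<times> nat" where
  "work_left P s =
     (case phase s of
        Quiet \<Rightarrow> (0, 0, 0)
      | Edges k B \<Rightarrow> (4, 0, 0)
      | Visit k B h T U \<Rightarrow> (3, nlevels P - h, \<Sum>v\<in>T. mark_weight P s U v)
      | Unmark_Roots \<Rightarrow> (2, 0, card (marked_set s))
      | Unmark_Rest \<Rightarrow> (1, 0, card (marked_set s)))"

definition work_order :: "((nat \<times> nat \<times> nat) \<times> (nat \<times> nat \<times> nat)) set" where
  "work_order = less_than <*lex*> less_than <*lex*> less_than"

lemma wf_work_order: "wf work_order"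
  by (simp add: work_order_def wf_lex_prod)

lemma trans_work_order: "trans work_order"
  by (simp add: work_order_def)

lemma marked_set_finite:
  assumes "binv P k B E\<^sub>0 lv\<^sub>0 s" shows "marked_set s \<subseteq> {..<nverts P}" "finite (marked_set s)"
proof -
  have "dom (cur s) \<subseteq> {..<nverts P}" using assms by (simp add: binv_def frame_def forest_def)
  then show "marked_set s \<subseteq> {..<nverts P}" using marked_heap[OF assms] by blast
  then show "finite (marked_set s)" using finite_subset by blast
qed

lemma visit_decreases:
  assumes "phase s = Visit k B h T U" "phase s' = Visit k B h T U'" "finite T" "v \<in> T"
    "mark_weight P s' U' v < mark_weight P s U v"
    "\<And>x. x \<in> T \<Longrightarrow> x \<noteq> v \<Longrightarrow> mark_weight P s' U' x = mark_weight P s U x"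
  shows "(work_left P s', work_left P s) \<in> work_order"
proof -
  have "mark_weight P s' U' x \<le> mark_weight P s U x" if "x \<in> T" for x
    using assms(5) assms(6)[OF that] by (cases "x = v") auto
  then have "(\<Sum>x\<in>T. mark_weight P s' U' x) < (\<Sum>x\<in>T. mark_weight P s U x)"
    using assms(3-5) by (intro sum_strict_mono_ex1) auto
  then show ?thesis using assms(1,2) by (simp add: work_left_def work_order_def)
qed

lemma unmark_decreases:
  assumes inv: "binv P k B E\<^sub>0 lv\<^sub>0 s" and v: "marked s v" and ph: "phase s \<in> {Unmark_Roots, Unmark_Rest}"
  shows "(work_left P (s\<lparr>desc_array := (desc_array s)(v := None)\<rparr>), work_left P s) \<in> work_order"
proof -
  let ?s = "s\<lparr>desc_array := (desc_array s)(v := None)\<rparr>"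
  have "marked_set ?s = marked_set s - {v}" by (auto simp: marked_def)
  then have "card (marked_set ?s) < card (marked_set s)"
    using marked_set_finite(2)[OF inv] v by (metis card_Diff1_less mem_Collect_eq)
  then show ?thesis using ph unfolding work_left_def work_order_def by auto
qed

lemma work_decreases:
  assumes inv: "binv P k B E\<^sub>0 lv\<^sub>0 s" and w: "work P s s'"
  shows "(work_left P s', work_left P s) \<in> work_order"
  using w
proof cases
  case (change_edges k' B')
  then show ?thesis by (simp add: work_left_def work_order_def)
next
  case (mark_begin k' B' h T U v W)
  note i = binv_visit[OF inv mark_begin(2)]
  have "W \<subseteq> marked_set s" using mark_begin by (cases k') (auto simp: marked_batch_neighbors_def)
  then have "W \<subseteq> {..<nverts P}" using marked_set_finite(1)[OF inv] by blast
  then have "card W \<le> card {..<nverts P}" by (intro card_mono) auto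
  then have W: "card W \<le> nverts P" by simp
  have T: "finite T" using i(14) finite_subset by blast
  show ?thesis
    using mark_begin W by (intro visit_decreases[where U' = "U(v \<mapsto> W)", OF mark_begin(2) _ T mark_begin(3)])
      (auto simp: mark_weight_def)
next
  case (mark_union k' B' h T U v W w r r')
  note i = binv_visit[OF inv mark_union(2)]
  have m: "marked (unite P r r' s) = marked s" by (simp add: unite_def)
  have T: "finite T" using i(14) finite_subset by blast
  have v: "v \<in> T" "\<not> marked s v" using mark_union(3) i(5) dags_markingD(2)[OF i(7)] by auto
  have "W \<subseteq> marked_set s" using dags_markingD(5)[OF i(7) mark_union(3)] .
  then have "finite W" using marked_set_finite(2)[OF inv] finite_subset by blast
  then have "card (W - {w}) < card W" using mark_union(4) by (intro card_Diff1_less)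
  then show ?thesis
    using mark_union(1,3) v by (intro visit_decreases[where U' = "U(v \<mapsto> W - {w})", OF mark_union(2) _ T v(1)])
      (auto simp: mark_weight_def m)
next
  case (mark_end k' B' h T U v)
  note i = binv_visit[OF inv mark_end(2)]
  have T: "finite T" using i(14) finite_subset by blast
  have v: "v \<in> T" "\<not> marked s v" using mark_end(3) i(5) dags_markingD(2)[OF i(7)] by auto
  show ?thesis
    using mark_end(1,3) v by (intro visit_decreases[where U' = "U(v := None)", OF mark_end(2) _ T v(1)])
      (auto simp: mark_weight_def marked_def)
next
  case (move k' B' h T U v)
  note i = binv_visit[OF inv move(2)]
  have T: "finite T" using i(14) finite_subset by blast
  have "mark_weight P s' U = mark_weight P s U" using move(1) by (simp add: mark_weight_def fun_eq_iff)
  moreover have "(\<Sum>v\<in>T - {v}. mark_weight P s U v) < (\<Sum>v\<in>T. mark_weight P s U v)"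
    using T move(3,4) by (intro sum_strict_mono2[where b = v]) (auto simp: mark_weight_def)
  ultimately show ?thesis using move(1,2) by (simp add: work_left_def work_order_def)
next
  case (next_level k' B' h)
  then show ?thesis by (simp add: work_left_def work_order_def)
next
  case (levels_done k' B' h)
  then show ?thesis by (simp add: work_left_def work_order_def)
next
  case (unmark_root v)
  then show ?thesis using unmark_decreases[OF inv] by simp
next
  case roots_done
  then show ?thesis by (simp add: work_left_def work_order_def)
next
  case (unmark_rest v)
  then show ?thesis using unmark_decreases[OF inv] by simp
qed

lemma work_left_cong:
  "phase s' = phase s \<Longrightarrow> marked s' = marked s \<Longrightarrow> work_left P s' = work_left P s"
  by (simp add: work_left_def mark_weight_def split: phase.split)

text \<open>The exclusion in \<open>mark_begin\<close> cannot cause a deadlock: if some mark is in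
  progress, it can continue, and otherwise the exclusion is vacuous.\<close>

lemma progress:
  assumes inv: "binv P k B E\<^sub>0 lv\<^sub>0 s" and q: "phase s \<noteq> Quiet"
  shows "\<exists>s'. step P s Work s' \<or> step P s End_Batch s'"
proof -
  have "(\<exists>s'. work P s s') \<or> phase s = Unmark_Rest \<and> (\<forall>v. \<not> marked s v)"
  proof (cases "phase s")
    case (Edges k' B')
    then show ?thesis using work.change_edges by blast
  next
    case (Visit k' B' h T U)
    note i = binv_visit[OF inv Visit]
    show ?thesis
    proof (cases "T = {}")
      case True
      then have "U = Map.empty" using i(5) by auto
      then show ?thesis
        using Visit True work.next_level[of s k' B' h P] work.levels_done[of s k' B' h P] by blast
    next
      case False
      then obtain v where v: "v \<in> T" by auto
      show ?thesis
      proof (cases "dom U = {}")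
        case True
        show ?thesis
        proof (cases "marked s v")
          case True
          then show ?thesis using work.move[OF Visit v] by blast
        next
          case False
          then show ?thesis using work.mark_begin[OF Visit v False] True by blast
        qed
      next
        case False
        then obtain u where "u \<in> dom U" by blast
        then obtain W where u: "U u = Some W" by blast
        show ?thesis
        proof (cases "W = {}")
          case True
          then show ?thesis using work.mark_end[OF Visit] u by blast
        next
          case False
          then obtain w where w: "w \<in> W" by auto
          then have "w \<in> dom (cur s)" "u \<in> dom (cur s)"
            using dags_markingD(1)[OF i(7)] dags_markingD(5)[OF i(7) u] u by auto
          then obtain r r' where "root_of s u r" "root_of s w r'"
            using rooted_exists[OF i(13)] unfolding root_of_eq by blast
          then show ?thesis using work.mark_union[OF Visit u w] by blast
        qed
      qed
    qed
  next
    case Unmark_Roots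
    then show ?thesis using work.unmark_root work.roots_done by blast
  next
    case Unmark_Rest
    then show ?thesis using work.unmark_rest by blast
  qed (use q in simp)
  then show ?thesis using step.work step.end_batch by blast
qed

section \<open>Measure for the reads\<close>

text \<open>The depth of \<open>u\<close> in its tree. Compression can only shrink the set of proper
  ancestors, so it never sets a traversal back.\<close>

definition rank :: "'p state \<Rightarrow> vertex \<Rightarrow> nat" where
  "rank s u = card {w. (u, w) \<in> (prel (cur s))\<^sup>+}"

lemma rank_le:
  assumes F: "forest n (cur s)" shows "rank s u \<le> n" "finite {w. (u, w) \<in> (prel (cur s))\<^sup>+}"
proof -
  have "{w. (u, w) \<in> (prel (cur s))\<^sup>+} \<subseteq> Range (prel (cur s))"
    unfolding trancl_range[of "prel (cur s)", symmetric] by (blast intro: Range.intros)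
  then have sub: "{w. (u, w) \<in> (prel (cur s))\<^sup>+} \<subseteq> {..<n}"
    using F unfolding forest_def by blast
  then show "finite {w. (u, w) \<in> (prel (cur s))\<^sup>+}" using finite_subset by blast
  have "card {w. (u, w) \<in> (prel (cur s))\<^sup>+} \<le> card {..<n}" using sub by (intro card_mono) auto
  then show "rank s u \<le> n" by (simp add: rank_def)
qed

lemma rank_parent:
  assumes F: "forest n (cur s)" and u: "(c, u) \<in> prel (cur s)" shows "rank s u < rank s c"
proof -
  let ?R = "(prel (cur s))\<^sup>+"
  have "u \<in> {w. (c, w) \<in> ?R}" "u \<notin> {w. (u, w) \<in> ?R}"
    using u F by (auto simp: forest_def acyclic_def)
  moreover have "{w. (u, w) \<in> ?R} \<subseteq> {w. (c, w) \<in> ?R}"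
    using u by auto
  ultimately have "{w. (u, w) \<in> ?R} \<subset> {w. (c, w) \<in> ?R}" by blast
  then show ?thesis unfolding rank_def using rank_le(2)[OF F] by (intro psubset_card_mono)
qed

text \<open>
  Without further work of the update processes, an attempt succeeds if the batch number and the level
  that it has read so far are the present ones, and the attempt after a failed one is of this kind.
\<close>

fun fresh :: "'p state \<Rightarrow> rpc \<Rightarrow> bool" where
  "fresh s (R_Level1 v b) \<longleftrightarrow> b = batch_number s"
| "fresh s (R_Desc v b h) \<longleftrightarrow> b = batch_number s \<and> h = level s v"
| "fresh s (R_Parent v b h d c) \<longleftrightarrow> b = batch_number s \<and> h = level s v"
| "fresh s (R_Lookup v b h d u) \<longleftrightarrow> b = batch_number s \<and> h = level s v"
| "fresh s (R_Level2 v b h st) \<longleftrightarrow> b = batch_number s \<and> h = level s v"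
| "fresh s (R_Batch2 v b h st h') \<longleftrightarrow> b = batch_number s \<and> h = h'"
| "fresh s _ \<longleftrightarrow> True"

text \<open>Each ancestor costs two steps, for its array entry and for its parent, whence
  \<open>2 * rank\<close>. A descriptor from an older batch may lead to any vertex of the present
  trees; its weight \<open>2 * n + 6\<close> exceeds that of every \<open>R_Lookup\<close>, as ranks
  are at most \<open>n\<close>.\<close>

fun attempt_left :: "nat \<Rightarrow> 'p state \<Rightarrow> rpc \<Rightarrow> nat" where
  "attempt_left n s (R_Level1 v b) = 2 * n + 8"
| "attempt_left n s (R_Desc v b h) = 2 * n + 7"
| "attempt_left n s (R_Parent v b h d c) =
     (if fst c = batch_number s then 2 * rank s (snd c) + 4 else 2 * n + 6)"
| "attempt_left n s (R_Lookup v b h d u) = 2 * rank s u + 5"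
| "attempt_left n s (R_Level2 v b h st) = 3"
| "attempt_left n s (R_Batch2 v b h st h') = 2"
| "attempt_left n s (R_Return x) = 0"
| "attempt_left n s (R_Batch1 v) = 2 * n + 9"
| "attempt_left n s R_Idle = 2 * n + 10"

text \<open>The surcharge of an attempt that is not fresh pays for the restart it may cause: the new
  attempt starts at \<open>2 * n + 9\<close> and is fresh.\<close>

definition read_left :: "nat \<Rightarrow> 'p state \<Rightarrow> rpc \<Rightarrow> nat" where
  "read_left n s pc = attempt_left n s pc + (if fresh s pc then 0 else 2 * n + 10)"

text \<open>A delayed read may hold a pointer from an earlier batch, but one of the present batch
  refers to an existing descriptor, so following its parent lowers the rank.\<close>

definition pointers_ok :: "'p state \<Rightarrow> bool" where
  "pointers_ok s \<longleftrightarrow> (\<forall>p v b h d c. reader s p = R_Parent v b h d c \<longrightarrow>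
     fst c \<le> batch_number s \<and> (fst c = batch_number s \<longrightarrow> snd c \<in> dom (cur s)))"

lemma read_decreases:
  assumes inv: "binv P k B E\<^sub>0 lv\<^sub>0 s" and ok: "pointers_ok s"
    and nx: "read_next P s (reader s p) = Some pc"
  shows "read_left (nverts P) s pc < read_left (nverts P) s (reader s p)"
proof -
  have F: "forest (nverts P) (cur s)" using inv by (simp add: binv_def frame_def)
  have da: "c = batch_number s" if "desc_array s v = Some c" for v c
    using inv that unfolding binv_def frame_def by blast
  show ?thesis
  proof (cases "reader s p")
    case (R_Desc v b h)
    then show ?thesis
      using nx da[of v] rank_le(1)[OF F, of v] by (auto simp: read_left_def split: option.splits)
  next
    case (R_Lookup v b h d u)
    then show ?thesis
      using nx da[of u] by (auto simp: read_left_def split: option.splits)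
  next
    case (R_Parent v b h d c)
    show ?thesis
    proof (cases "parent (the (heap s (fst c) (snd c)))")
      case None
      then show ?thesis using nx R_Parent by (auto simp: read_left_def)
    next
      case (Some u)
      then have pc: "pc = R_Lookup v b h d u" using nx R_Parent by simp
      have "2 * rank s u + 5 < attempt_left (nverts P) s (R_Parent v b h d c)"
      proof (cases "fst c = batch_number s")
        case True
        then have "snd c \<in> dom (cur s)" using ok R_Parent unfolding pointers_ok_def by blast
        then have "(snd c, u) \<in> prel (cur s)" using Some True by (auto simp: prel_def)
        then show ?thesis using rank_parent[OF F] True by fastforce
      next
        case False
        then show ?thesis using rank_le(1)[OF F, of u] by simp
      qed
      then show ?thesis using pc R_Parent by (simp add: read_left_def)
    qed
  next
    case (R_Batch2 v b h st h')
    then show ?thesis using nx by (auto simp: read_left_def split: option.splits if_splits)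
  qed (use nx in \<open>auto simp: read_left_def\<close>)
qed

lemma read_left_compress:
  assumes inv: "binv P k B E\<^sub>0 lv\<^sub>0 s" and vu: "(v, u) \<in> parent_rel s" "(u, a) \<in> (parent_rel s)\<^sup>+"
  shows "read_left n (set_parent v a s) pc \<le> read_left n s pc"
proof -
  have F: "forest (nverts P) (cur s)" using inv by (simp add: binv_def frame_def)
  note ff = compress_forest[OF F vu[unfolded parent_rel_eq] cur_set_parent]
  have "rank (set_parent v a s) x \<le> rank s x" for x
    unfolding rank_def using ff(3) rank_le(2)[OF F] by (intro card_mono) auto
  then show ?thesis by (cases pc) (auto simp: read_left_def)
qed

lemma read_left_reader [simp]: "read_left n (s\<lparr>reader := R\<rparr>) pc = read_left n s pc"
  by (cases pc) (auto simp: read_left_def rank_def)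

lemma read_next_pointer:
  assumes "read_next P s pc = Some (R_Parent v b h d c)"
  shows "\<exists>w. desc_array s w = Some (fst c) \<and> snd c = w"
  using assms by (cases pc) (auto split: option.splits if_splits)

text \<open>The finiteness of the set of read processes enters here: with the sum over all of them,
  a step of any one is a descent.\<close>

definition reads_left :: "params \<Rightarrow> ('p :: finite) state \<Rightarrow> nat" where
  "reads_left P s = (\<Sum>p\<in>UNIV. read_left (nverts P) s (reader s p))"

lemma reads_left_step:
  assumes "read_left (nverts P) s pc < read_left (nverts P) s (reader s p)"
  shows "reads_left P (s\<lparr>reader := (reader s)(p := pc)\<rparr>) < reads_left P s"
  unfolding reads_left_def using assms by (intro sum_strict_mono_ex1) auto

context cplds_run
begin

section \<open>Termination of updates and lock-freedom of reads\<close>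

lemma pointers_ok: "pointers_ok (\<sigma> t)"
proof (induction t)
  case 0
  then show ?case using exec by (simp add: execution_def initial_def pointers_ok_def)
next
  case (Suc t)
  obtain k B E\<^sub>0 where inv: "binv P k B E\<^sub>0 (base_level \<sigma> l t) (\<sigma> t)" by (rule binv_at)
  show ?case
    unfolding pointers_ok_def
  proof (intro allI impI)
    fix p v b h d c assume rd: "reader (\<sigma> (Suc t)) p = R_Parent v b h d c"
    have "fst c \<le> batch_number (\<sigma> t) \<and> (fst c = batch_number (\<sigma> t) \<longrightarrow> snd c \<in> dom (cur (\<sigma> t)))"
    proof (cases "reader (\<sigma> (Suc t)) p = reader (\<sigma> t) p")
      case True
      then show ?thesis using Suc rd unfolding pointers_ok_def by metis
    next
      case False
      have "read_next P (\<sigma> t) (reader (\<sigma> t) p) = Some (R_Parent v b h d c)"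
        using step_at[of t]
      proof cases
        case work
        then have "reader (\<sigma> (Suc t)) = reader (\<sigma> t)" by (auto elim!: work.cases simp: unite_def)
        then show ?thesis using False by simp
      qed (use False rd in \<open>auto split: if_splits\<close>)
      then obtain w where "desc_array (\<sigma> t) w = Some (fst c)" "snd c = w"
        using read_next_pointer by blast
      moreover from this have "fst c = batch_number (\<sigma> t) \<and> w \<in> dom (cur (\<sigma> t))"
        using inv unfolding binv_def frame_def by blast
      ultimately show ?thesis by simp
    qed
    then show "fst c \<le> batch_number (\<sigma> (Suc t)) \<and>
        (fst c = batch_number (\<sigma> (Suc t)) \<longrightarrow> snd c \<in> dom (cur (\<sigma> (Suc t))))"
      by (cases rule: step_cases[of t]) (auto dest!: laterD(2)[where v = "snd c"])
  qed
qed

lemma work_left_step: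
  assumes "\<not> starts t" "l t \<noteq> End_Batch"
  shows "l t = Work \<Longrightarrow> (work_left P (\<sigma> (Suc t)), work_left P (\<sigma> t)) \<in> work_order"
    "l t \<noteq> Work \<Longrightarrow> work_left P (\<sigma> (Suc t)) = work_left P (\<sigma> t)"
proof -
  obtain k B E\<^sub>0 where inv: "binv P k B E\<^sub>0 (base_level \<sigma> l t) (\<sigma> t)" by (rule binv_at)
  show "(work_left P (\<sigma> (Suc t)), work_left P (\<sigma> t)) \<in> work_order" if "l t = Work"
    using step_at[of t] that work_decreases[OF inv] by (auto elim: step.cases)
  show "work_left P (\<sigma> (Suc t)) = work_left P (\<sigma> t)" if "l t \<noteq> Work"
    using step_at[of t] that assms
    by (intro work_left_cong) (auto elim!: step.cases)
qed

text \<open>If the batch never ended, \<open>progress\<close> and fairness would yield infinitely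
  many steps of work, each a descent of \<open>work_left\<close>, while all other steps leave it
  unchanged.\<close>

lemma updates_terminate:
  assumes fair: "update_fair P \<sigma> l"
  shows "updates_terminate l"
  unfolding updates_terminate_def
proof (intro allI impI)
  fix N k e i assume "Update k e i \<in> operations_of l N"
  then obtain B where i: "l i = Start_Batch k B" by (auto simp: operations_of_def)
  have "\<exists>j>i. l j = End_Batch"
  proof (rule ccontr)
    assume no: "\<not> (\<exists>j>i. l j = End_Batch)"
    have q: "phase (\<sigma> j) \<noteq> Quiet" if "i < j" for j
      using cplds_prefix.running[of P \<sigma> l, OF _ i that] no cplds_prefix.intro cplds_run_axioms by blast
    have ns: "\<not> starts j" if "i < j" for j
      using q[OF that] step_at[of j] by (auto elim: step.cases)
    have "\<exists>s'. step P (\<sigma> j) Work s' \<or> step P (\<sigma> j) End_Batch s'" if "i < j" for j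
      using progress[OF _ q[OF that]] binv_at by metis
    then have "\<exists>j\<ge>m. l j = Work \<or> l j = End_Batch" if "i < m" for m
      using fair that unfolding update_fair_def by (meson less_le_trans)
    then have "\<exists>j\<ge>m. l j = Work \<and> i < j" for m
      using no by (metis le_trans less_le_trans lessI max.cobounded1 max.cobounded2 not_less_eq_eq)
    then have "\<exists>j\<ge>m. (work_left P (\<sigma> (Suc j)), work_left P (\<sigma> j)) \<in> work_order" for m
      using work_left_step(1) no ns by metis
    moreover have "finite {j. (work_left P (\<sigma> (Suc j)), work_left P (\<sigma> j)) \<in> work_order}"
    proof (rule finite_descents[OF wf_work_order trans_work_order])
      fix j assume "Suc i \<le> j"
      then have "\<not> starts j" "l j \<noteq> End_Batch" using no ns by auto
      then show "work_left P (\<sigma> (Suc j)) = work_left P (\<sigma> j) \<or>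
          (work_left P (\<sigma> (Suc j)), work_left P (\<sigma> j)) \<in> work_order"
        using work_left_step by blast
    qed
    ultimately show False
      unfolding finite_nat_set_iff_bounded_le by (metis (no_types, lifting) Suc_n_not_le_n le_trans mem_Collect_eq)
  qed
  then obtain j where j: "i < j" "l j = End_Batch" by blast
  then have "first_after i (Suc j) (\<lambda>j. l j = End_Batch) \<noteq> None"
    by (auto simp: first_after_def)
  then show "\<exists>N'. response l N' (Update k e i) \<noteq> None" by (intro exI[of _ "Suc j"]) simp
qed

end

locale cplds_finite_run = cplds_run P \<sigma> l
  for P and \<sigma> :: "nat \<Rightarrow> ('p :: finite) state" and l
begin

text \<open>If nothing terminates any more, at most one further batch can start, since it never
  ends. Its work may set reads back arbitrarily, but lowers \<open>work_left\<close>; so this is the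
  first component of the measure, and \<open>reads_left\<close> the second.\<close>

lemma reads_lock_free: "reads_lock_free l"
  unfolding reads_lock_free_def
proof (intro impI notI)
  assume inf: "infinite {i. read_step_label (l i)}" and "finite {i. terminates_operation (l i)}"
  then obtain M where M: "\<And>i. M \<le> i \<Longrightarrow> \<not> terminates_operation (l i)"
    by (metis (no_types, lifting) finite_nat_set_iff_bounded_le mem_Collect_eq not_less_eq_eq)
  have ne: "l i \<noteq> End_Batch" "l i \<noteq> Res_Read p x" if "M \<le> i" for i p x
    using M[OF that] by (auto simp: terminates_operation_def)
  obtain M' where M': "M \<le> M'" "\<And>i. M' \<le> i \<Longrightarrow> \<not> starts i"
  proof (cases "\<exists>i\<ge>M. starts i")
    case False
    then show ?thesis using that[of M] by blast
  next
    case True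
    then obtain i k B where i: "M \<le> i" "l i = Start_Batch k B" by blast
    have "phase (\<sigma> j) \<noteq> Quiet" if "i < j" for j
      using cplds_prefix.running[of P \<sigma> l, OF _ i(2) that] ne(1) i(1)
        cplds_prefix.intro cplds_run_axioms by (meson le_trans less_imp_le)
    then have "\<not> starts j" if "i < j" for j
      using that step_at[of j] by (fastforce elim: step.cases)
    then show ?thesis using that[of "Suc i"] i(1) by auto
  qed
  let ?f = "\<lambda>i. (work_left P (\<sigma> i), reads_left P (\<sigma> i))"
  let ?r = "work_order <*lex*> less_than"
  have step: "?f (Suc i) = ?f i \<or> (?f (Suc i), ?f i) \<in> ?r"
      "read_step_label (l i) \<Longrightarrow> (?f (Suc i), ?f i) \<in> ?r" if i: "M' \<le> i" for i
  proof -
    have l: "\<not> starts i" "l i \<noteq> End_Batch" "\<And>p x. l i \<noteq> Res_Read p x"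
      using M'(2)[OF i] ne M'(1) i by auto
    obtain k B E\<^sub>0 where inv: "binv P k B E\<^sub>0 (base_level \<sigma> l i) (\<sigma> i)" by (rule binv_at)
    have "(?f (Suc i), ?f i) \<in> ?r \<or> ?f (Suc i) = ?f i \<and> \<not> read_step_label (l i)"
      using step_at[of i]
    proof cases
      case work
      then show ?thesis using work_left_step(1)[OF l(1,2)] by simp
    next
      case (compress v u a)
      have "reads_left P (\<sigma> (Suc i)) \<le> reads_left P (\<sigma> i)"
        unfolding reads_left_def compress(2) set_parent_simps
        by (intro sum_mono read_left_compress[OF inv compress(3,4)])
      then show ?thesis
        using work_left_step(2)[OF l(1,2)] compress(1)
        by (auto simp: read_step_label_def le_less)
    next
      case (inv_read p v)
      then have "reads_left P (\<sigma> (Suc i)) < reads_left P (\<sigma> i)"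
        unfolding inv_read(2) by (intro reads_left_step) (simp add: read_left_def)
      then show ?thesis using work_left_step(2)[OF l(1,2)] inv_read(1) by simp
    next
      case (read_step p pc)
      then have "reads_left P (\<sigma> (Suc i)) < reads_left P (\<sigma> i)"
        unfolding read_step(2)
        by (intro reads_left_step read_decreases[OF inv pointers_ok])
      then show ?thesis using work_left_step(2)[OF l(1,2)] read_step(1) by simp
    qed (use l in \<open>auto simp: read_step_label_def\<close>)
    then show "?f (Suc i) = ?f i \<or> (?f (Suc i), ?f i) \<in> ?r"
      "read_step_label (l i) \<Longrightarrow> (?f (Suc i), ?f i) \<in> ?r"
      by blast+
  qed
  have "finite {i. (?f (Suc i), ?f i) \<in> ?r}"
    using step(1) wf_work_order trans_work_order
    by (intro finite_descents[where M = M']) (auto intro!: trans_lex_prod wf_lex_prod)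
  moreover have "{i. read_step_label (l i)} \<subseteq> {..<M'} \<union> {i. (?f (Suc i), ?f i) \<in> ?r}"
    using step(2) by (force simp: not_less[symmetric])
  ultimately have "finite {i. read_step_label (l i)}"
    using finite_subset by (metis (no_types, lifting) finite_Un finite_lessThan)
  then show False using inf by contradiction
qed

end

theorem theorem6p1:
  fixes P :: params
    and \<sigma> :: "nat \<Rightarrow> ('p :: finite) state"
    and l :: "nat \<Rightarrow> 'p label"
  assumes "valid_params P"
    and "execution P \<sigma> l"
  shows "cplds_linearizable P \<sigma> l
       \<and> (update_fair P \<sigma> l \<longrightarrow> updates_terminate l)
       \<and> reads_lock_free l"
proof -
  interpret cplds_finite_run P \<sigma> l using assms by unfold_locales
  show ?thesis using cplds_linearizable updates_terminate reads_lock_free by blast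
qed

end
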